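(* Let $\Sigma$ be a $2$-torus and let $\Phi\colon\Sigma\to\mathbb{S}^n$ be a non-constant branched minimal immersion by first eigenfunctions. Then the image of $\Phi$ cannot be an equatorial $2$-sphere.
   Context: $\mathbb{S}^n\subset\mathbb{R}^{n+1}$ is the unit sphere with its canonical metric $g_{\mathrm{can}}$. An equatorial $2$-sphere of $\mathbb{S}^n$ is the intersection of $\mathbb{S}^n$ with a $3$-dimensional linear subspace of $\mathbb{R}^{n+1}$. Fix a smooth Riemannian metric $g_0$ on $\Sigma$ representing its conformal structure. A branched minimal immersion is a smooth map $\Phi\colon\Sigma\to\mathbb{S}^n$ which is harmonic and conformal away from the points where $D_p\Phi=0$ (for non-constant $\Phi$ there are finitely many such points, called branch points). The induced metric $g=\Phi^*g_{\mathrm{can}}$ can be written $g=fg_0$ with $f\ge 0$ smooth and vanishing only at the branch points (it has conical singularities there). For such $g$, $\lambda_1(g)=\inf\left\{\frac{\int_\Sigma|\nabla u|^2_{g_0}\,dV(g_0)}{\int_\Sigma u^2\,dV(g)} : u\in H^1(\Sigma,g),\ u\neq 0,\ \int_\Sigma u\,dV(g)=0\right\}$, where $H^1(\Sigma,g)$ is the completion of $\{u\in L^2(\Sigma,dV(g)):\int_\Sigma|\nabla u|^2_{g_0}dV(g_0)<\infty\}$ in the norm $\|u\|^2=\int_\Sigma u^2\,dV(g)+\int_\Sigma|\nabla u|^2_{g_0}\,dV(g_0)$ (it coincides with the usual Sobolev space $H^1(\Sigma,g_0)$). First eigenfunctions are the functions attaining the infimum; equivalently they satisfy $\Delta_{g_0}u=\lambda_1(g)fu$.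 $\Phi$ is by first eigenfunctions if each of its coordinate functions (as a map to $\mathbb{R}^{n+1}$) lies in the $\lambda_1(g)$-eigenspace of $g=\Phi^*g_{\mathrm{can}}$ (the zero function being allowed). *)

theory Defs
  imports "HOL-Analysis.Analysis"
begin

text \<open>
  The smooth \<open>2\<close>-torus is the quotient of the plane by the integer lattice. Functions, maps and
  tensors on it are given by their \<open>1\<close>-periodic lifts to \<open>real^2\<close>, written in the standard
  coordinates, and integrals over it are integrals over the unit square. The conformal structure
  is that of an arbitrary smooth Riemannian metric, which need not be flat.
\<close>

definition periodic :: "(real^2 \<Rightarrow> 'b) \<Rightarrow> bool" where
  "periodic u \<longleftrightarrow> (\<forall>x i. u (x + axis i 1) = u x)"

primrec Ck_map :: "nat \<Rightarrow> ('a::real_normed_vector \<Rightarrow> 'b::real_normed_vector) \<Rightarrow> bool" where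
  "Ck_map 0 f \<longleftrightarrow> continuous_on UNIV f"
| "Ck_map (Suc k) f \<longleftrightarrow> (\<forall>x. f differentiable (at x)) \<and>
     (\<forall>v. Ck_map k (\<lambda>x. frechet_derivative f (at x) v))"

definition smooth_map :: "('a::real_normed_vector \<Rightarrow> 'b::real_normed_vector) \<Rightarrow> bool" where
  "smooth_map f \<longleftrightarrow> (\<forall>k. Ck_map k f)"

definition pd :: "2 \<Rightarrow> (real^2 \<Rightarrow> 'b::real_normed_vector) \<Rightarrow> real^2 \<Rightarrow> 'b" where
  "pd i f x = frechet_derivative f (at x) (axis i 1)"

definition riemannian_metric :: "(real^2 \<Rightarrow> real^2^2) \<Rightarrow> bool" where
  "riemannian_metric g \<longleftrightarrow> smooth_map g \<and> periodic g \<and>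
     (\<forall>x. transpose (g x) = g x) \<and> (\<forall>x v. v \<noteq> 0 \<longrightarrow> v \<bullet> (g x *v v) > 0)"

text \<open>The area measure also makes sense for the degenerate metrics induced by branched maps.\<close>

definition area :: "(real^2 \<Rightarrow> real^2^2) \<Rightarrow> (real^2) measure" where
  "area g = density lborel (\<lambda>x. ennreal (indicator (cbox 0 1) x * sqrt (det (g x))))"

text \<open>The squared norm of a covector, so that \<open>|\<nabla>u|\<^sup>2\<close> is that of the differential of \<open>u\<close>.\<close>

definition conorm_sq :: "(real^2 \<Rightarrow> real^2^2) \<Rightarrow> real^2 \<Rightarrow> real^2 \<Rightarrow> real" where
  "conorm_sq g x w = w \<bullet> (matrix_inv (g x) *v w)"

text \<open>The Laplacian is nonnegative, \<open>\<Delta> = - div \<nabla>\<close>, and acts componentwise on vector-valued maps.\<close>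

definition laplace_beltrami ::
  "(real^2 \<Rightarrow> real^2^2) \<Rightarrow> (real^2 \<Rightarrow> 'b::real_normed_vector) \<Rightarrow> real^2 \<Rightarrow> 'b" where
  "laplace_beltrami g u x = - (1 / sqrt (det (g x))) *\<^sub>R
     (\<Sum>i\<in>UNIV. pd i (\<lambda>y. sqrt (det (g y)) *\<^sub>R
        (\<Sum>j\<in>UNIV. (matrix_inv (g y) $ i $ j) *\<^sub>R pd j u y)) x)"

definition induced_metric :: "(real^2 \<Rightarrow> real^'m) \<Rightarrow> real^2 \<Rightarrow> real^2^2" where
  "induced_metric \<Phi> x = (\<chi> i j. pd i \<Phi> x \<bullet> pd j \<Phi> x)"

text \<open>
  The tension field of a map into the unit sphere is, up to sign, the component of its Euclidean
  Laplacian tangent to the sphere.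
\<close>

definition harmonic_into_sphere :: "(real^2 \<Rightarrow> real^2^2) \<Rightarrow> (real^2 \<Rightarrow> real^'m) \<Rightarrow> bool" where
  "harmonic_into_sphere g0 \<Phi> \<longleftrightarrow>
     (\<forall>x. laplace_beltrami g0 \<Phi> x - (laplace_beltrami g0 \<Phi> x \<bullet> \<Phi> x) *\<^sub>R \<Phi> x = 0)"

definition branched_minimal_immersion ::
  "(real^2 \<Rightarrow> real^2^2) \<Rightarrow> (real^2 \<Rightarrow> real^'m) \<Rightarrow> bool" where
  "branched_minimal_immersion g0 \<Phi> \<longleftrightarrow>
     smooth_map \<Phi> \<and> periodic \<Phi> \<and> (\<forall>x. \<Phi> x \<in> sphere 0 1) \<and>
     harmonic_into_sphere g0 \<Phi> \<and>
     (\<forall>x. frechet_derivative \<Phi> (at x) \<noteq> (\<lambda>_. 0) \<longrightarrow>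
        (\<exists>c>0. induced_metric \<Phi> x = c *\<^sub>R g0 x))"

text \<open>
  The differential in the sense of distributions on the torus. Test functions are periodic, so
  that integration by parts over the unit square has no boundary terms.
\<close>

definition weak_differential :: "(real^2 \<Rightarrow> real) \<Rightarrow> (real^2 \<Rightarrow> real^2) \<Rightarrow> bool" where
  "weak_differential u w \<longleftrightarrow>
     set_integrable lborel (cbox 0 1) u \<and> set_integrable lborel (cbox 0 1) w \<and>
     (\<forall>\<phi> :: real^2 \<Rightarrow> real. smooth_map \<phi> \<and> periodic \<phi> \<longrightarrow>
        (\<forall>i. (LINT x:cbox 0 1|lborel. u x * pd i \<phi> x) =
             - (LINT x:cbox 0 1|lborel. w x $ i * \<phi> x)))"

definition L2_pairs ::
  "(real^2 \<Rightarrow> real^2^2) \<Rightarrow> (real^2 \<Rightarrow> real^2^2) \<Rightarrow> ((real^2 \<Rightarrow> real) \<times> (real^2 \<Rightarrow> real^2)) set" where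
  "L2_pairs g0 g = {(u, w).
     u \<in> borel_measurable borel \<and> periodic u \<and> integrable (area g) (\<lambda>x. (u x)\<^sup>2) \<and>
     w \<in> borel_measurable borel \<and> periodic w \<and> integrable (area g0) (\<lambda>x. conorm_sq g0 x (w x))}"

definition H1_norm_sq ::
  "(real^2 \<Rightarrow> real^2^2) \<Rightarrow> (real^2 \<Rightarrow> real^2^2) \<Rightarrow> (real^2 \<Rightarrow> real) \<Rightarrow> (real^2 \<Rightarrow> real^2) \<Rightarrow> real" where
  "H1_norm_sq g0 g u w = (LINT x|area g. (u x)\<^sup>2) + (LINT x|area g0. conorm_sq g0 x (w x))"

definition pre_H1 ::
  "(real^2 \<Rightarrow> real^2^2) \<Rightarrow> (real^2 \<Rightarrow> real^2^2) \<Rightarrow> ((real^2 \<Rightarrow> real) \<times> (real^2 \<Rightarrow> real^2)) set" where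
  "pre_H1 g0 g = {(u, w) \<in> L2_pairs g0 g. weak_differential u w}"

text \<open>
  The map \<open>u \<mapsto> (u, du)\<close> embeds \<open>pre_H1\<close> isometrically into the Hilbert space of pairs of a
  square-integrable function (for \<open>g\<close>) and a square-integrable covector field (for \<open>g0\<close>). Its
  completion is therefore the closure of its image there. As for Lebesgue spaces, elements are
  represented by functions rather than by classes modulo null sets.
\<close>

definition H1 ::
  "(real^2 \<Rightarrow> real^2^2) \<Rightarrow> (real^2 \<Rightarrow> real^2^2) \<Rightarrow> ((real^2 \<Rightarrow> real) \<times> (real^2 \<Rightarrow> real^2)) set" where
  "H1 g0 g = {(u, w) \<in> L2_pairs g0 g. \<exists>U W. (\<forall>k. (U k, W k) \<in> pre_H1 g0 g) \<and>
     (\<lambda>k::nat. H1_norm_sq g0 g (\<lambda>x. U k x - u x) (\<lambda>x. W k x - w x)) \<longlonglongrightarrow> 0}"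

text \<open>The condition that \<open>u \<noteq> 0\<close> is meant modulo null sets of \<open>dV(g)\<close>.\<close>

definition admissible ::
  "(real^2 \<Rightarrow> real^2^2) \<Rightarrow> (real^2 \<Rightarrow> real^2^2) \<Rightarrow> (real^2 \<Rightarrow> real) \<Rightarrow> (real^2 \<Rightarrow> real^2) \<Rightarrow> bool" where
  "admissible g0 g u w \<longleftrightarrow>
     (u, w) \<in> H1 g0 g \<and> \<not> (AE x in area g. u x = 0) \<and> (LINT x|area g. u x) = 0"

definition rayleigh ::
  "(real^2 \<Rightarrow> real^2^2) \<Rightarrow> (real^2 \<Rightarrow> real^2^2) \<Rightarrow> (real^2 \<Rightarrow> real) \<Rightarrow> (real^2 \<Rightarrow> real^2) \<Rightarrow> real" where
  "rayleigh g0 g u w = (LINT x|area g0. conorm_sq g0 x (w x)) / (LINT x|area g. (u x)\<^sup>2)"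

definition lambda1 :: "(real^2 \<Rightarrow> real^2^2) \<Rightarrow> (real^2 \<Rightarrow> real^2^2) \<Rightarrow> real" where
  "lambda1 g0 g = Inf {rayleigh g0 g u w | u w. admissible g0 g u w}"

definition first_eigenfunction ::
  "(real^2 \<Rightarrow> real^2^2) \<Rightarrow> (real^2 \<Rightarrow> real^2^2) \<Rightarrow> (real^2 \<Rightarrow> real) \<Rightarrow> bool" where
  "first_eigenfunction g0 g u \<longleftrightarrow>
     (\<exists>w. admissible g0 g u w \<and> rayleigh g0 g u w = lambda1 g0 g)"

definition by_first_eigenfunctions ::
  "(real^2 \<Rightarrow> real^2^2) \<Rightarrow> (real^2 \<Rightarrow> real^'m) \<Rightarrow> bool" where
  "by_first_eigenfunctions g0 \<Phi> \<longleftrightarrow>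
     (\<forall>i. (\<forall>x. \<Phi> x $ i = 0) \<or> first_eigenfunction g0 (induced_metric \<Phi>) (\<lambda>x. \<Phi> x $ i))"

definition equatorial_2_sphere :: "(real^'m) set \<Rightarrow> bool" where
  "equatorial_2_sphere S \<longleftrightarrow> (\<exists>V. subspace V \<and> dim V = 3 \<and> S = sphere 0 1 \<inter> V)"

end

theory Submission
  imports Defs
begin

text \<open>
  Suppose that the image is an equatorial sphere. The coordinate
  functions have eigenvalue \<open>2\<close>, so the quadratic form \<open>\<integral> |du|\<^sup>2 - 2 \<integral> u\<^sup>2 dV(g)\<close> is nonnegative on functions of
  mean zero, hence also on vector-valued ones. Uniformising the torus gives a parallel orthogonal
  frame \<open>D1\<close>, \<open>D2\<close> of the conformal structure, and \<open>D1 \<Phi>\<close>, \<open>D2 \<Phi>\<close> are holomorphic sections of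
  \<open>\<Phi>\<^sup>*TS\<^sup>2\<close>, on which the form vanishes, as it does on the conformal fields
  \<open>a - (a \<bullet> \<Phi>) \<Phi>\<close>. A combination of mean zero lies in the kernel of the form, which forces it to be
  divergence free: \<open>D\<^sub>i f = 2 f (a\<^sub>i \<bullet> \<Phi>)\<close>, where \<open>f\<close> is the density of the induced metric. Therefore
  \<open>f\<close> has no zeros, that is, \<open>\<Phi>\<close> has no branch points, and the induced metric is a metric of curvature
  one on the torus, in contradiction to the theorem of Gauss and Bonnet.

  The frame comes from a nowhere vanishing solution of a Beltrami equation. It is written as an
  exponential, whose exponent is a Neumann series; the series converges together with all its
  derivatives because the Beurling transform is an isometry of \<open>L\<^sup>2\<close> that commutes with derivatives.
\<close>

subsection \<open>Smooth maps\<close>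

text \<open>The inclusion of a round two-sphere in three-space is itself by first eigenfunctions, so
  the topology of the torus has to enter. It does so through the parallel frame, which exists
  globally, and through periodicity, which removes all boundary terms. The form vanishes on
  \<open>D1 \<Phi>\<close> because \<open>Lap X + 2 f X\<close> is normal for this tangent field
  \<open>X\<close>. A vector on which a nonnegative form vanishes lies in its kernel, and normal
  test fields then give the scalar equation. The obstacle throughout is that \<open>f\<close> may
  have zeros: weighted integrals see nothing there and \<open>log f\<close> is undefined, so the
  identities keep powers of \<open>f\<close> as factors until positivity is known. After that,
  Gauss-Bonnet amounts to integrating a single divergence. The Beltrami equation is solved by an
  exponential because the frame needs a solution without zeros. An exact isometry of
  \<open>L2\<close> matters for the series: the supremum of the Beltrami coefficient is below one,
  but may be arbitrarily close to it, so an estimate of the Beurling transform with a larger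
  constant would not give convergence.\<close>

lemma Ck_map_SucI:
  assumes "\<And>x. (f has_derivative f' x) (at x)" and "\<And>v. Ck_map k (\<lambda>x. f' x v)"
  shows "Ck_map (Suc k) f"
proof -
  have "frechet_derivative f (at x) = f' x" for x
    using frechet_derivative_at[OF assms(1)] by simp
  moreover have "f differentiable (at x)" for x
    using assms(1) unfolding differentiable_def by blast
  ultimately show ?thesis
    using assms(2) unfolding Ck_map.simps by presburger
qed

lemma Ck_map_continuous:
  assumes "Ck_map k f" shows "continuous_on UNIV f"
proof (cases k)
  case (Suc m)
  then have "f differentiable_on UNIV"
    using assms unfolding differentiable_on_def by simp
  then show ?thesis by (rule differentiable_imp_continuous_on)
qed (use assms in simp)

lemma Ck_map_has_derivative:
  "Ck_map (Suc k) f \<Longrightarrow> (f has_derivative frechet_derivative f (at x)) (at x)"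
  using frechet_derivative_works by auto

lemma Ck_map_Suc_imp: "Ck_map (Suc k) f \<Longrightarrow> Ck_map k f"
proof (induction k arbitrary: f)
  case 0
  then show ?case using Ck_map_continuous[OF 0] by simp
next
  case (Suc k)
  have "Ck_map k (\<lambda>x. frechet_derivative f (at x) v)" for v
    using Suc.IH Suc.prems by simp
  then show ?case using Suc.prems by simp
qed

lemma Ck_map_const: "Ck_map k (\<lambda>x. c)"
proof (induction k arbitrary: c)
  case (Suc k)
  show ?case
    by (rule Ck_map_SucI[where f' = "\<lambda>x v. 0"]) (rule has_derivative_const, rule Suc)
qed auto

lemma Ck_map_bounded_linear:
  assumes "bounded_linear h" "Ck_map k f"
  shows "Ck_map k (\<lambda>x. h (f x))"
  using assms(2)
proof (induction k arbitrary: f)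
  case 0
  then show ?case using bounded_linear.continuous_on[OF assms(1), of UNIV f] by simp
next
  case (Suc k)
  show ?case
  proof (rule Ck_map_SucI)
    show "((\<lambda>x. h (f x)) has_derivative (\<lambda>v. h (frechet_derivative f (at x) v))) (at x)" for x
      using bounded_linear.has_derivative[OF assms(1) Ck_map_has_derivative[OF Suc.prems]] .
    show "Ck_map k (\<lambda>x. h (frechet_derivative f (at x) v))" for v
      by (rule Suc.IH) (use Suc.prems in simp)
  qed
qed

lemma Ck_map_add:
  assumes "Ck_map k f" "Ck_map k g"
  shows "Ck_map k (\<lambda>x. f x + g x)"
  using assms
proof (induction k arbitrary: f g)
  case 0
  then show ?case by (auto intro!: continuous_intros)
next
  case (Suc k)
  show ?case
  proof (rule Ck_map_SucI)
    show "((\<lambda>x. f x + g x) has_derivative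
        (\<lambda>v. frechet_derivative f (at x) v + frechet_derivative g (at x) v)) (at x)" for x
      by (intro has_derivative_add Ck_map_has_derivative[OF Suc.prems(1)]
          Ck_map_has_derivative[OF Suc.prems(2)])
    show "Ck_map k (\<lambda>x. frechet_derivative f (at x) v + frechet_derivative g (at x) v)" for v
      by (rule Suc.IH) (use Suc.prems in simp_all)
  qed
qed

lemma Ck_map_bounded_bilinear:
  assumes h: "bounded_bilinear h" and "Ck_map k f" "Ck_map k g"
  shows "Ck_map k (\<lambda>x. h (f x) (g x))"
  using assms(2,3)
proof (induction k arbitrary: f g)
  case 0
  then show ?case using bounded_bilinear.continuous_on[OF h] by auto
next
  case (Suc k)
  show ?case
  proof (rule Ck_map_SucI)
    show "((\<lambda>x. h (f x) (g x)) has_derivative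
        (\<lambda>v. h (f x) (frechet_derivative g (at x) v) + h (frechet_derivative f (at x) v) (g x))) (at x)" for x
      by (intro bounded_bilinear.FDERIV[OF h] Ck_map_has_derivative[OF Suc.prems(1)]
          Ck_map_has_derivative[OF Suc.prems(2)])
    have "Ck_map k (\<lambda>x. h (f x) (frechet_derivative g (at x) v))" for v
      by (rule Suc.IH) (use Suc.prems Ck_map_Suc_imp in simp_all)
    moreover have "Ck_map k (\<lambda>x. h (frechet_derivative f (at x) v) (g x))" for v
      by (rule Suc.IH) (use Suc.prems Ck_map_Suc_imp in simp_all)
    ultimately show "Ck_map k (\<lambda>x. h (f x) (frechet_derivative g (at x) v)
        + h (frechet_derivative f (at x) v) (g x))" for v
      by (rule Ck_map_add)
  qed
qed

text \<open>The derivative is built from the function itself and a derivative of \<open>f\<close>,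
  so order \<open>k\<close> of the function yields order \<open>k\<close> of its derivative. The
  same bootstrap serves square roots and exponentials and replaces a chain rule for
  \<open>Ck_map\<close>.\<close>

lemma Ck_map_inverse:
  fixes f :: "'a::real_normed_vector \<Rightarrow> 'b::real_normed_field"
  assumes "Ck_map k f" "\<And>x. f x \<noteq> 0"
  shows "Ck_map k (\<lambda>x. inverse (f x))"
  using assms(1)
proof (induction k)
  case 0
  then show ?case using assms(2) by (auto intro!: continuous_intros)
next
  case (Suc k)
  show ?case
  proof (rule Ck_map_SucI)
    show "((\<lambda>x. inverse (f x)) has_derivative
        (\<lambda>v. - (inverse (f x) * frechet_derivative f (at x) v * inverse (f x)))) (at x)" for x
      by (intro Deriv.has_derivative_inverse Ck_map_has_derivative[OF Suc.prems] assms(2))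
    have 1: "Ck_map k (\<lambda>x. inverse (f x))"
      by (rule Suc.IH[OF Ck_map_Suc_imp[OF Suc.prems]])
    have 2: "Ck_map k (\<lambda>x. inverse (f x) * frechet_derivative f (at x) v * inverse (f x))" for v
      by (intro Ck_map_bounded_bilinear[OF bounded_bilinear_mult] 1) (use Suc.prems in auto)
    show "Ck_map k (\<lambda>x. - (inverse (f x) * frechet_derivative f (at x) v * inverse (f x)))" for v
      by (rule Ck_map_bounded_linear[OF bounded_linear_minus[OF bounded_linear_ident] 2])
  qed
qed

lemma Ck_map_sqrt:
  assumes "Ck_map k f" "\<And>x. f x > 0"
  shows "Ck_map k (\<lambda>x. sqrt (f x))"
  using assms(1)
proof (induction k)
  case 0
  then show ?case by (auto intro!: continuous_intros)
next
  case (Suc k)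
  show ?case
  proof (rule Ck_map_SucI)
    show "((\<lambda>x. sqrt (f x)) has_derivative
        (\<lambda>v. inverse (sqrt (f x)) * (1/2 * frechet_derivative f (at x) v))) (at x)" for x
      by (rule has_derivative_eq_rhs[OF has_derivative_real_sqrt[OF assms(2) Ck_map_has_derivative[OF Suc.prems]]])
        (auto simp: field_simps)
    have 1: "Ck_map k (\<lambda>x. sqrt (f x))"
      by (rule Suc.IH[OF Ck_map_Suc_imp[OF Suc.prems]])
    have "sqrt (f x) \<noteq> 0" for x using assms(2)[of x] by simp
    then have 2: "Ck_map k (\<lambda>x. inverse (sqrt (f x)))" by (rule Ck_map_inverse[OF 1])
    show "Ck_map k (\<lambda>x. inverse (sqrt (f x)) * (1/2 * frechet_derivative f (at x) v))" for v
      by (intro Ck_map_bounded_bilinear[OF bounded_bilinear_mult] 2 Ck_map_const) (use Suc.prems in auto)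
  qed
qed

lemma Ck_map_exp:
  fixes f :: "'a::real_normed_vector \<Rightarrow> 'b::{real_normed_field,banach}"
  assumes "Ck_map k f"
  shows "Ck_map k (\<lambda>x. exp (f x))"
  using assms(1)
proof (induction k)
  case 0
  then show ?case by (auto intro!: continuous_intros)
next
  case (Suc k)
  show ?case
  proof (rule Ck_map_SucI)
    show "((\<lambda>x. exp (f x)) has_derivative (\<lambda>v. exp (f x) * frechet_derivative f (at x) v)) (at x)" for x
    proof -
      have "(exp has_derivative (\<lambda>v. exp (f x) * v)) (at (f x))"
        using DERIV_exp[of "f x"] by (simp add: has_field_derivative_def)
      from has_derivative_compose[OF Ck_map_has_derivative[OF Suc.prems] this]
      show ?thesis .
    qed
    have 1: "Ck_map k (\<lambda>x. exp (f x))"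
      by (rule Suc.IH[OF Ck_map_Suc_imp[OF Suc.prems]])
    show "Ck_map k (\<lambda>x. exp (f x) * frechet_derivative f (at x) v)" for v
      by (intro Ck_map_bounded_bilinear[OF bounded_bilinear_mult] 1) (use Suc.prems in auto)
  qed
qed

named_theorems smooth_intros

lemma smooth_map_has_derivative:
  "smooth_map f \<Longrightarrow> (f has_derivative frechet_derivative f (at x)) (at x)"
  using Ck_map_has_derivative unfolding smooth_map_def by blast

lemma smooth_map_differentiable: "smooth_map f \<Longrightarrow> f differentiable (at x)"
  using smooth_map_has_derivative differentiable_def by blast

lemma smooth_map_continuous: "smooth_map f \<Longrightarrow> continuous_on S f"
  using Ck_map_continuous continuous_on_subset unfolding smooth_map_def by blast

lemma smooth_map_frechet [smooth_intros]:
  assumes "smooth_map f"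
  shows "smooth_map (\<lambda>x. frechet_derivative f (at x) v)"
  unfolding smooth_map_def
proof
  fix k
  have "Ck_map (Suc k) f" using assms unfolding smooth_map_def by blast
  then show "Ck_map k (\<lambda>x. frechet_derivative f (at x) v)" by simp
qed

lemma smooth_map_pd [smooth_intros]: "smooth_map f \<Longrightarrow> smooth_map (pd i f)"
  unfolding pd_def by (rule smooth_map_frechet)

lemma smooth_map_const [smooth_intros]: "smooth_map (\<lambda>x. c)"
  by (simp add: smooth_map_def Ck_map_const)

lemma smooth_map_bounded_linear:
  "bounded_linear h \<Longrightarrow> smooth_map f \<Longrightarrow> smooth_map (\<lambda>x. h (f x))"
  by (simp add: smooth_map_def Ck_map_bounded_linear)

lemma smooth_map_bounded_bilinear:
  "bounded_bilinear h \<Longrightarrow> smooth_map f \<Longrightarrow> smooth_map g \<Longrightarrow> smooth_map (\<lambda>x. h (f x) (g x))"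
  by (simp add: smooth_map_def Ck_map_bounded_bilinear)

lemma smooth_map_add [smooth_intros]:
  "smooth_map f \<Longrightarrow> smooth_map g \<Longrightarrow> smooth_map (\<lambda>x. f x + g x)"
  by (simp add: smooth_map_def Ck_map_add)

lemmas smooth_map_mult [smooth_intros] = smooth_map_bounded_bilinear[OF bounded_bilinear_mult]
lemmas smooth_map_scaleR [smooth_intros] = smooth_map_bounded_bilinear[OF bounded_bilinear_scaleR]
lemmas smooth_map_inner [smooth_intros] = smooth_map_bounded_bilinear[OF bounded_bilinear_inner]
lemmas smooth_map_minus [smooth_intros] =
  smooth_map_bounded_linear[OF bounded_linear_minus[OF bounded_linear_ident]]
lemmas smooth_map_Re [smooth_intros] = smooth_map_bounded_linear[OF bounded_linear_Re]
lemmas smooth_map_Im [smooth_intros] = smooth_map_bounded_linear[OF bounded_linear_Im]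
lemmas smooth_map_complex_of_real [smooth_intros] = smooth_map_bounded_linear[OF bounded_linear_of_real]
lemmas smooth_map_vec_nth [smooth_intros] = smooth_map_bounded_linear[OF bounded_linear_vec_nth]

lemma smooth_map_diff [smooth_intros]:
  fixes f g :: "'a::real_normed_vector \<Rightarrow> 'b::real_normed_vector"
  assumes "smooth_map f" "smooth_map g" shows "smooth_map (\<lambda>x. f x - g x)"
  using smooth_map_add[OF assms(1) smooth_map_minus[OF assms(2)]] by simp

lemma smooth_map_sum [smooth_intros]:
  "(\<And>i. i \<in> S \<Longrightarrow> smooth_map (f i)) \<Longrightarrow> smooth_map (\<lambda>x. \<Sum>i\<in>S. f i x)"
  by (induction S rule: infinite_finite_induct) (auto intro!: smooth_intros)

lemma smooth_map_power2 [smooth_intros]: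
  fixes f :: "'a::real_normed_vector \<Rightarrow> 'b::real_normed_field"
  shows "smooth_map f \<Longrightarrow> smooth_map (\<lambda>x. (f x)\<^sup>2)"
  unfolding power2_eq_square by (intro smooth_intros)

lemma smooth_map_inverse [smooth_intros]:
  fixes f :: "'a::real_normed_vector \<Rightarrow> 'b::real_normed_field"
  shows "smooth_map f \<Longrightarrow> (\<And>x. f x \<noteq> 0) \<Longrightarrow> smooth_map (\<lambda>x. inverse (f x))"
  by (simp add: smooth_map_def Ck_map_inverse)

lemma smooth_map_divide [smooth_intros]:
  fixes f :: "'a::real_normed_vector \<Rightarrow> 'b::real_normed_field"
  shows "smooth_map f \<Longrightarrow> smooth_map g \<Longrightarrow> (\<And>x. g x \<noteq> 0) \<Longrightarrow> smooth_map (\<lambda>x. f x / g x)"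
  unfolding divide_inverse by (intro smooth_intros)

lemma smooth_map_sqrt [smooth_intros]:
  "smooth_map f \<Longrightarrow> (\<And>x. f x > 0) \<Longrightarrow> smooth_map (\<lambda>x. sqrt (f x))"
  by (simp add: smooth_map_def Ck_map_sqrt)

lemma smooth_map_exp [smooth_intros]:
  fixes f :: "'a::real_normed_vector \<Rightarrow> 'b::{real_normed_field,banach}"
  shows "smooth_map f \<Longrightarrow> smooth_map (\<lambda>x. exp (f x))"
  by (simp add: smooth_map_def Ck_map_exp)

subsection \<open>Partial derivatives\<close>

lemma pd_eqI: "(f has_derivative f') (at x) \<Longrightarrow> pd i f x = f' (axis i 1)"
  unfolding pd_def using frechet_derivative_at by metis

lemma vec2_eq_axis: "(v::real^2) = v$1 *\<^sub>R axis 1 1 + v$2 *\<^sub>R axis 2 1"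
  by (simp add: vec_eq_iff forall_2 axis_def)

lemma frechet_derivative_pd:
  assumes "f differentiable (at x)"
  shows "frechet_derivative f (at x) v = v$1 *\<^sub>R pd 1 f x + v$2 *\<^sub>R pd 2 f x"
proof -
  have l: "linear (frechet_derivative f (at x))"
    using assms linear_frechet_derivative by blast
  show ?thesis
    by (subst vec2_eq_axis) (simp add: linear_add[OF l] linear_scale[OF l] pd_def)
qed

lemma has_derivative_pd:
  assumes "f differentiable (at x)"
  shows "(f has_derivative (\<lambda>v. v$1 *\<^sub>R pd 1 f x + v$2 *\<^sub>R pd 2 f x)) (at x)"
proof -
  have "frechet_derivative f (at x) = (\<lambda>v. v$1 *\<^sub>R pd 1 f x + v$2 *\<^sub>R pd 2 f x)"
    using frechet_derivative_pd[OF assms] by (rule ext)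
  then show ?thesis
    using assms[unfolded frechet_derivative_works] by simp
qed

lemma pd_const [simp]: "pd i (\<lambda>x. c) = (\<lambda>x. 0)"
  by (auto simp: pd_def)

lemma pd_bounded_linear:
  assumes "bounded_linear h" "f differentiable (at x)"
  shows "pd i (\<lambda>x. h (f x)) x = h (pd i f x)"
  by (rule pd_eqI[OF bounded_linear.has_derivative[OF assms(1) assms(2)[unfolded frechet_derivative_works]], folded pd_def])

lemma pd_bounded_bilinear:
  assumes "bounded_bilinear h" "f differentiable (at x)" "g differentiable (at x)"
  shows "pd i (\<lambda>x. h (f x) (g x)) x = h (f x) (pd i g x) + h (pd i f x) (g x)"
  by (rule pd_eqI[OF bounded_bilinear.FDERIV[OF assms(1) assms(2,3)[unfolded frechet_derivative_works]], folded pd_def])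

lemma pd_add:
  assumes "f differentiable (at x)" "g differentiable (at x)"
  shows "pd i (\<lambda>x. f x + g x) x = pd i f x + pd i g x"
  by (rule pd_eqI[OF has_derivative_add[OF assms[unfolded frechet_derivative_works]], folded pd_def])

lemma pd_diff:
  assumes "f differentiable (at x)" "g differentiable (at x)"
  shows "pd i (\<lambda>x. f x - g x) x = pd i f x - pd i g x"
  by (rule pd_eqI[OF has_derivative_diff[OF assms[unfolded frechet_derivative_works]], folded pd_def])

lemmas pd_mult = pd_bounded_bilinear[OF bounded_bilinear_mult]
lemmas pd_scaleR = pd_bounded_bilinear[OF bounded_bilinear_scaleR]

lemma pd_sum:
  "(\<And>j. j \<in> S \<Longrightarrow> f j differentiable (at x)) \<Longrightarrow> pd i (\<lambda>x. \<Sum>j\<in>S. f j x) x = (\<Sum>j\<in>S. pd i (f j) x)"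
  by (induction S rule: infinite_finite_induct) (auto simp: pd_add)

lemma pd_exp:
  fixes f :: "real^2 \<Rightarrow> 'b::{real_normed_field,banach}"
  assumes "f differentiable (at x)"
  shows "pd i (\<lambda>x. exp (f x)) x = exp (f x) * pd i f x"
proof -
  have "(exp has_derivative (\<lambda>v. exp (f x) * v)) (at (f x))"
    using DERIV_exp[of "f x"] by (simp add: has_field_derivative_def)
  from has_derivative_compose[OF assms[unfolded frechet_derivative_works] this]
  show ?thesis unfolding pd_def[of i f] by (rule pd_eqI)
qed

lemma pd_vector_derivative:
  fixes f :: "real^2 \<Rightarrow> 'b::real_normed_vector"
  assumes "f differentiable (at (x + t *\<^sub>R axis i 1))"
  shows "((\<lambda>t. f (x + t *\<^sub>R axis i 1)) has_vector_derivative pd i f (x + t *\<^sub>R axis i 1)) (at t within S)"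
proof -
  have "((\<lambda>t. x + t *\<^sub>R axis i (1::real)) has_derivative (\<lambda>h. h *\<^sub>R axis i 1)) (at t within S)"
    by (auto intro!: derivative_eq_intros)
  from has_derivative_compose[OF this assms[unfolded frechet_derivative_works]]
  have "((\<lambda>t. f (x + t *\<^sub>R axis i 1)) has_derivative
      (\<lambda>h. frechet_derivative f (at (x + t *\<^sub>R axis i 1)) (h *\<^sub>R axis i 1))) (at t within S)" .
  then show ?thesis
    unfolding has_vector_derivative_def pd_def
    using linear_scale[OF linear_frechet_derivative[OF assms]] by simp
qed

lemma vector2_shift:
  "vector[a, b] + t *\<^sub>R axis 1 1 = (vector[a + t, b] :: real^2)"
  "vector[a, b] + t *\<^sub>R axis 2 1 = (vector[a, b + t] :: real^2)"
  by (auto simp: vec_eq_iff forall_2 axis_def)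

lemma pd_vector_derivative_2:
  fixes f :: "real^2 \<Rightarrow> 'b::real_normed_vector"
  assumes "\<And>x. f differentiable (at x)"
  shows "((\<lambda>t. f (vector[t, b])) has_vector_derivative pd 1 f (vector[t, b])) (at t within S)"
    "((\<lambda>t. f (vector[a, t])) has_vector_derivative pd 2 f (vector[a, t])) (at t within S)"
  using pd_vector_derivative[of f "vector[0,b]" t 1 S] pd_vector_derivative[of f "vector[a,0]" t 2 S] assms
  by (simp_all add: vector2_shift)

lemma continuous_on_vector2 [continuous_intros]:
  assumes "continuous_on S f" "continuous_on S g"
  shows "continuous_on S (\<lambda>x. vector[f x, g x] :: real^2)"
proof -
  have "(\<lambda>x. vector[f x, g x] :: real^2) = (\<lambda>x. f x *\<^sub>R axis 1 1 + g x *\<^sub>R axis 2 1)"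
    by (auto simp: vec_eq_iff forall_2 axis_def)
  then show ?thesis by (simp only:) (intro continuous_intros assms)
qed

text \<open>Write \<open>u\<close> as the integral of \<open>pd 2 u\<close> along vertical segments.
  Differentiating under the integral sign gives \<open>pd 1 u\<close> as an integral of
  \<open>pd 1 (pd 2 u)\<close>, and the fundamental theorem of calculus differentiates this in the
  second variable.\<close>

lemma pd_commute_12:
  fixes u :: "real^2 \<Rightarrow> 'b::banach"
  assumes u: "smooth_map u"
  shows "pd 1 (pd 2 u) x = pd 2 (pd 1 u) x"
proof -
  define a b where "a = x$1" "b = x$2"
  \<comment> \<open>A base level strictly below \<open>b\<close>, so that \<open>b\<close> is
    interior to \<open>{l..b+1}\<close> and one-sided derivatives become derivatives.\<close>
  define l where "l = b - 1"
  have x: "x = vector[a, b]" by (simp add: vec_eq_iff forall_2 a_b_def)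
  note s = smooth_map_pd smooth_map_differentiable
  have c: "continuous_on S (\<lambda>p. v (vector[f p, g p]))" if "smooth_map v" "continuous_on S f" "continuous_on S g"
    for v :: "real^2 \<Rightarrow> 'b" and S :: "'c::topological_space set" and f g
    by (rule continuous_on_compose2[OF smooth_map_continuous[OF that(1), of UNIV]])
      (auto intro!: continuous_intros that)
  have ftc: "v (vector[s, t]) = v (vector[s, l]) + integral (cbox l t) (\<lambda>r. pd 2 v (vector[s, r]))"
    if "smooth_map v" "l \<le> t" for v :: "real^2 \<Rightarrow> 'b" and s t
  proof -
    have "((\<lambda>r. pd 2 v (vector[s, r])) has_integral v (vector[s, t]) - v (vector[s, l])) {l..t}"
      by (rule fundamental_theorem_of_calculus[OF that(2)])
        (rule pd_vector_derivative_2[OF smooth_map_differentiable[OF that(1)]])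
    then show ?thesis by (simp add: integral_unique)
  qed
  have 1: "pd 1 u (vector[a, t]) = pd 1 u (vector[a, l]) + integral (cbox l t) (\<lambda>r. pd 1 (pd 2 u) (vector[a, r]))"
    if "l \<le> t" for t
  proof -
    have "((\<lambda>s. integral (cbox l t) (\<lambda>r. pd 2 u (vector[s, r]))) has_vector_derivative
       integral (cbox l t) (\<lambda>r. pd 1 (pd 2 u) (vector[a, r]))) (at a within UNIV)"
    proof (rule leibniz_rule_vector_derivative[where U = UNIV])
      show "((\<lambda>s. pd 2 u (vector[s, r])) has_vector_derivative pd 1 (pd 2 u) (vector[s, r])) (at s within UNIV)" for s r
        by (rule pd_vector_derivative_2) (intro s u)
      show "(\<lambda>r. pd 2 u (vector[s, r])) integrable_on cbox l t" for s
        by (intro integrable_continuous c s u continuous_intros)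
      show "continuous_on (UNIV \<times> cbox l t) (\<lambda>(s, r). pd 1 (pd 2 u) (vector[s, r]))"
        unfolding case_prod_beta by (intro c s u continuous_intros)
    qed auto
    then have "((\<lambda>s. u (vector[s, l]) + integral (cbox l t) (\<lambda>r. pd 2 u (vector[s, r]))) has_vector_derivative
       pd 1 u (vector[a, l]) + integral (cbox l t) (\<lambda>r. pd 1 (pd 2 u) (vector[a, r]))) (at a)"
      by (intro has_vector_derivative_add pd_vector_derivative_2 s u) auto
    then have "((\<lambda>s. u (vector[s, t])) has_vector_derivative
       pd 1 u (vector[a, l]) + integral (cbox l t) (\<lambda>r. pd 1 (pd 2 u) (vector[a, r]))) (at a)"
      unfolding ftc[OF u that, symmetric] .
    moreover have "((\<lambda>s. u (vector[s, t])) has_vector_derivative pd 1 u (vector[a, t])) (at a)"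
      by (rule pd_vector_derivative_2) (intro s u)
    ultimately show ?thesis
      by (rule vector_derivative_unique_at[rotated])
  qed
  have "((\<lambda>t. pd 1 u (vector[a, l]) + integral (cbox l t) (\<lambda>r. pd 1 (pd 2 u) (vector[a, r])))
      has_vector_derivative 0 + pd 1 (pd 2 u) (vector[a, b])) (at b within {l..b+1})"
    by (intro has_vector_derivative_add has_vector_derivative_const)
      (unfold cbox_interval, rule integral_has_vector_derivative, auto intro!: c s u continuous_intros simp: l_def)
  then have 2: "((\<lambda>t. pd 1 u (vector[a, t])) has_vector_derivative pd 1 (pd 2 u) (vector[a, b])) (at b within {l..b+1})"
    unfolding add_0
  proof (rule has_vector_derivative_transform[rotated 2])
    show "pd 1 u (vector[a, t]) = pd 1 u (vector[a, l]) + integral (cbox l t) (\<lambda>r. pd 1 (pd 2 u) (vector[a, r]))"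
      if "t \<in> {l..b+1}" for t
      by (rule 1) (use that in simp)
  qed (simp add: l_def)
  then have "((\<lambda>t. pd 1 u (vector[a, t])) has_vector_derivative pd 1 (pd 2 u) (vector[a, b])) (at b)"
    using at_within_Icc_at[of l b "b+1"] by (simp add: l_def)
  moreover have "((\<lambda>t. pd 1 u (vector[a, t])) has_vector_derivative pd 2 (pd 1 u) (vector[a, b])) (at b)"
    by (rule pd_vector_derivative_2) (intro s u)
  ultimately show ?thesis
    unfolding x by (rule vector_derivative_unique_at)
qed

lemma pd_commute:
  fixes u :: "real^2 \<Rightarrow> 'b::banach"
  assumes "smooth_map u"
  shows "pd i (pd j u) = pd j (pd i u)"
  using pd_commute_12[OF assms] exhaust_2[of i] exhaust_2[of j] by auto

subsection \<open>Smooth functions on the torus\<close>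

definition tsmooth :: "(real^2 \<Rightarrow> 'b::real_normed_vector) \<Rightarrow> bool" where
  "tsmooth u \<longleftrightarrow> smooth_map u \<and> periodic u"

lemma tsmooth_smooth: "tsmooth u \<Longrightarrow> smooth_map u"
  by (simp add: tsmooth_def)

lemma tsmooth_periodic: "tsmooth u \<Longrightarrow> periodic u"
  by (simp add: tsmooth_def)

lemma tsmooth_differentiable: "tsmooth u \<Longrightarrow> u differentiable (at x)"
  by (simp add: tsmooth_def smooth_map_differentiable)

lemma tsmooth_continuous: "tsmooth u \<Longrightarrow> continuous_on S u"
  by (simp add: tsmooth_def smooth_map_continuous)

named_theorems tsmooth_intros

lemma tsmooth_const [tsmooth_intros]: "tsmooth (\<lambda>x. c)"
  by (simp add: tsmooth_def periodic_def smooth_map_const)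

lemma tsmooth_add [tsmooth_intros]:
  "tsmooth u \<Longrightarrow> tsmooth v \<Longrightarrow> tsmooth (\<lambda>x. u x + v x)"
  by (simp add: tsmooth_def periodic_def smooth_map_add)

lemma tsmooth_diff [tsmooth_intros]:
  "tsmooth u \<Longrightarrow> tsmooth v \<Longrightarrow> tsmooth (\<lambda>x. u x - v x)"
  by (simp add: tsmooth_def periodic_def smooth_map_diff)

lemma tsmooth_mult [tsmooth_intros]:
  fixes u :: "real^2 \<Rightarrow> 'b::real_normed_algebra"
  shows "tsmooth u \<Longrightarrow> tsmooth v \<Longrightarrow> tsmooth (\<lambda>x. u x * v x)"
  by (simp add: tsmooth_def periodic_def smooth_map_mult)

lemma tsmooth_scaleR [tsmooth_intros]:
  "tsmooth u \<Longrightarrow> tsmooth v \<Longrightarrow> tsmooth (\<lambda>x. u x *\<^sub>R v x)"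
  by (simp add: tsmooth_def periodic_def smooth_map_scaleR)

lemma tsmooth_inner [tsmooth_intros]:
  "tsmooth u \<Longrightarrow> tsmooth v \<Longrightarrow> tsmooth (\<lambda>x. u x \<bullet> v x)"
  by (simp add: tsmooth_def periodic_def smooth_map_inner)

lemma tsmooth_minus [tsmooth_intros]:
  "tsmooth u \<Longrightarrow> tsmooth (\<lambda>x. - u x)"
  by (simp add: tsmooth_def periodic_def smooth_map_minus)

lemma tsmooth_Re [tsmooth_intros]:
  "tsmooth u \<Longrightarrow> tsmooth (\<lambda>x. Re (u x))"
  by (simp add: tsmooth_def periodic_def smooth_map_Re)

lemma tsmooth_Im [tsmooth_intros]:
  "tsmooth u \<Longrightarrow> tsmooth (\<lambda>x. Im (u x))"
  by (simp add: tsmooth_def periodic_def smooth_map_Im)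

lemma tsmooth_complex_of_real [tsmooth_intros]:
  "tsmooth u \<Longrightarrow> tsmooth (\<lambda>x. complex_of_real (u x))"
  by (simp add: tsmooth_def periodic_def smooth_map_complex_of_real)

lemma tsmooth_exp [tsmooth_intros]:
  fixes u :: "real^2 \<Rightarrow> 'b::{real_normed_field,banach}"
  shows "tsmooth u \<Longrightarrow> tsmooth (\<lambda>x. exp (u x))"
  by (simp add: tsmooth_def periodic_def smooth_map_exp)

lemma tsmooth_power2 [tsmooth_intros]:
  fixes u :: "real^2 \<Rightarrow> 'b::real_normed_field"
  shows "tsmooth u \<Longrightarrow> tsmooth (\<lambda>x. (u x)\<^sup>2)"
  by (simp add: tsmooth_def periodic_def smooth_map_power2)

lemma tsmooth_vec_nth [tsmooth_intros]:
  "tsmooth u \<Longrightarrow> tsmooth (\<lambda>x. u x $ i)"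
  by (simp add: tsmooth_def periodic_def smooth_map_vec_nth)

lemma tsmooth_inverse [tsmooth_intros]:
  fixes f :: "real^2 \<Rightarrow> 'b::real_normed_field"
  shows "tsmooth f \<Longrightarrow> (\<And>x. f x \<noteq> 0) \<Longrightarrow> tsmooth (\<lambda>x. inverse (f x))"
  by (simp add: tsmooth_def smooth_map_inverse periodic_def)

lemma tsmooth_divide [tsmooth_intros]:
  fixes f :: "real^2 \<Rightarrow> 'b::real_normed_field"
  shows "tsmooth f \<Longrightarrow> tsmooth g \<Longrightarrow> (\<And>x. g x \<noteq> 0) \<Longrightarrow> tsmooth (\<lambda>x. f x / g x)"
  by (simp add: tsmooth_def smooth_map_divide periodic_def)

lemma tsmooth_sqrt [tsmooth_intros]:
  "tsmooth f \<Longrightarrow> (\<And>x. f x > 0) \<Longrightarrow> tsmooth (\<lambda>x. sqrt (f x))"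
  by (simp add: tsmooth_def smooth_map_sqrt periodic_def)

lemma tsmooth_sum [tsmooth_intros]:
  "(\<And>i. i \<in> S \<Longrightarrow> tsmooth (f i)) \<Longrightarrow> tsmooth (\<lambda>x. \<Sum>i\<in>S. f i x)"
  by (simp add: tsmooth_def smooth_map_sum periodic_def)

lemma periodic_pd:
  assumes "periodic u" "\<And>x. u differentiable (at x)"
  shows "periodic (pd i u)"
  unfolding periodic_def
proof (intro allI)
  fix x :: "real^2" and j :: 2
  have "((\<lambda>y. y + axis j (1::real)) has_derivative (\<lambda>h. h)) (at x)"
    by (auto intro!: derivative_eq_intros)
  from has_derivative_compose[OF this assms(2)[of "x + axis j 1", unfolded frechet_derivative_works]]
  have "(u has_derivative frechet_derivative u (at (x + axis j 1))) (at x)"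
    using assms(1) by (simp add: periodic_def)
  from frechet_derivative_at[OF this]
  show "pd i u (x + axis j 1) = pd i u x"
    by (simp add: pd_def)
qed

lemma tsmooth_pd [tsmooth_intros]: "tsmooth u \<Longrightarrow> tsmooth (pd i u)"
  by (simp add: tsmooth_def periodic_pd smooth_map_pd smooth_map_differentiable)

lemma periodic_of_int:
  assumes "periodic u"
  shows "u (x + axis i (of_int k)) = u x"
proof -
  have nat: "u (x + axis i (of_nat n)) = u x" for n x
  proof (induction n)
    case (Suc n)
    have "x + axis i (of_nat (Suc n)) = (x + axis i (of_nat n)) + axis i 1"
      by (simp add: vec_eq_iff axis_def)
    then show ?case using Suc assms unfolding periodic_def by metis
  qed (simp add: axis_def vec_eq_iff zero_vec_def[symmetric])
  show ?thesis
  proof (cases "k \<ge> 0")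
    case True
    then show ?thesis using nat[of x "nat k"] by simp
  next
    case False
    then have "u (x + axis i (of_int k) + axis i (of_nat (nat (-k)))) = u (x + axis i (of_int k))"
      using nat by blast
    moreover have "x + axis i (of_int k) + axis i (real (nat (-k))) = x"
      using False by (simp add: vec_eq_iff axis_def)
    ultimately show ?thesis by simp
  qed
qed

abbreviation usquare :: "(real^2) set" where "usquare \<equiv> cbox 0 1"

lemma vector2_in_usquare: "vector[a,b] \<in> usquare \<longleftrightarrow> a \<in> {0..1} \<and> b \<in> {0..1}"
  by (auto simp: mem_box_cart forall_2)

lemma periodic_reduce:
  fixes x :: "real^2"
  obtains a b where "a \<in> {0..1}" "b \<in> {0..1}"
    "\<And>u :: real^2 \<Rightarrow> 'b. periodic u \<Longrightarrow> u x = u (vector[a, b])"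
proof
  fix u :: "real^2 \<Rightarrow> 'b" assume u: "periodic u"
  have x: "x = vector[frac (x$1), frac (x$2)] + axis 1 (of_int \<lfloor>x$1\<rfloor>) + axis 2 (of_int \<lfloor>x$2\<rfloor>)"
    by (simp add: vec_eq_iff forall_2 axis_def frac_def)
  show "u x = u (vector[frac (x$1), frac (x$2)])"
    by (subst x) (simp only: periodic_of_int[OF u])
qed (auto simp: frac_lt_1 less_imp_le)

lemma tsmooth_bounded:
  assumes "tsmooth u"
  obtains C where "C \<ge> 0" "\<And>x. norm (u x) \<le> C"
proof -
  have "compact (u ` usquare)"
    by (intro compact_continuous_image tsmooth_continuous assms compact_cbox)
  then obtain C where C: "\<forall>y\<in>u ` usquare. norm y \<le> C"
    using compact_imp_bounded bounded_iff by metis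
  have "norm (u x) \<le> C" for x
  proof -
    obtain a b where "a \<in> {0..1}" "b \<in> {0..1}" "u x = u (vector[a,b])"
      using periodic_reduce[of x] tsmooth_periodic[OF assms] by metis
    then show ?thesis using C vector2_in_usquare by (metis imageI)
  qed
  then show ?thesis using that norm_ge_zero order_trans by blast
qed

subsection \<open>Iterated derivatives and limits\<close>

text \<open>The head of the word is the derivative taken last, so \<open>w @ [i]\<close>
  differentiates in direction \<open>i\<close> first. Inductions from the right end of a word peel
  off the innermost derivative.\<close>

primrec pds :: "2 list \<Rightarrow> (real^2 \<Rightarrow> 'b::real_normed_vector) \<Rightarrow> real^2 \<Rightarrow> 'b" where
  "pds [] u = u"
| "pds (i # w) u = pd i (pds w u)"

lemma tsmooth_pds [tsmooth_intros]: "tsmooth u \<Longrightarrow> tsmooth (pds w u)"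
  by (induction w) (auto intro: tsmooth_pd)

lemma smooth_map_pds [smooth_intros]: "smooth_map u \<Longrightarrow> smooth_map (pds w u)"
  by (induction w) (auto intro: smooth_map_pd)

lemma pd_pds:
  fixes u :: "real^2 \<Rightarrow> 'b::banach"
  shows "smooth_map u \<Longrightarrow> pd i (pds w u) = pds w (pd i u)"
proof (induction w)
  case (Cons j w)
  have "pd i (pds (j # w) u) = pd j (pd i (pds w u))"
    using pd_commute[OF smooth_map_pds[OF Cons.prems]] by simp
  then show ?case using Cons by simp
qed simp

lemma pds_append: "pds (v @ w) u = pds v (pds w u)"
  by (induction v) auto

lemma pds_bounded_linear:
  assumes "bounded_linear h" "smooth_map u"
  shows "pds w (\<lambda>x. h (u x)) = (\<lambda>x. h (pds w u x))"
proof (induction w)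
  case (Cons i w)
  then show ?case
    using pd_bounded_linear[OF assms(1) smooth_map_differentiable[OF smooth_map_pds[OF assms(2)]]] by auto
qed simp

lemma pds_add:
  assumes "smooth_map u" "smooth_map v"
  shows "pds w (\<lambda>x. u x + v x) = (\<lambda>x. pds w u x + pds w v x)"
proof (induction w)
  case (Cons i w)
  show ?case
    by (rule ext, simp only: pds.simps Cons, rule pd_add)
      (intro smooth_map_differentiable smooth_map_pds assms)+
qed simp

lemma pds_diff:
  assumes "smooth_map u" "smooth_map v"
  shows "pds w (\<lambda>x. u x - v x) = (\<lambda>x. pds w u x - pds w v x)"
proof (induction w)
  case (Cons i w)
  show ?case
    by (rule ext, simp only: pds.simps Cons, rule pd_diff)
      (intro smooth_map_differentiable smooth_map_pds assms)+
qed simp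

lemma pds_const: "pds w (\<lambda>x. c) = (\<lambda>x. if w = [] then c else 0)"
  by (induction w) auto

lemma pds_sum:
  assumes "\<And>j. j \<in> S \<Longrightarrow> smooth_map (f j)"
  shows "pds w (\<lambda>x. \<Sum>j\<in>S. f j x) = (\<lambda>x. \<Sum>j\<in>S. pds w (f j) x)"
proof (induction w)
  case (Cons i w)
  show ?case
    by (rule ext, simp only: pds.simps Cons, rule pd_sum)
      (intro smooth_map_differentiable smooth_map_pds assms)
qed simp

text \<open>For limits: uniform limits of the derivatives form a family indexed by words, in which
  each member has its successors as partial derivatives. Induction on the order, for all words at
  once, shows that the whole family is smooth and consists of the derivatives of its first
  member.\<close>

lemma smooth_map_family:
  fixes F :: "2 list \<Rightarrow> real^2 \<Rightarrow> 'b::real_normed_vector"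
  assumes F: "\<And>w x. (F w has_derivative (\<lambda>v. v$1 *\<^sub>R F (1 # w) x + v$2 *\<^sub>R F (2 # w) x)) (at x)"
  shows "smooth_map (F w)" "pds w (F []) = F w"
proof -
  have "Ck_map k (F w)" for k w
  proof (induction k arbitrary: w)
    case 0
    show ?case
      unfolding Ck_map.simps
      by (intro continuous_at_imp_continuous_on ballI) (rule has_derivative_continuous, rule F)
  next
    case (Suc k)
    show ?case
    proof (rule Ck_map_SucI[OF F])
      show "Ck_map k (\<lambda>x. v$1 *\<^sub>R F (1 # w) x + v$2 *\<^sub>R F (2 # w) x)" for v
        by (intro Ck_map_add Ck_map_bounded_linear[OF bounded_linear_scaleR_right] Suc)
    qed
  qed
  then show "smooth_map (F w)" by (simp add: smooth_map_def)
  have "pd i (F w) = F (i # w)" for i w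
    using pd_eqI[OF F] exhaust_2[of i] by (auto simp: axis_def fun_eq_iff)
  then show "pds w (F []) = F w"
    by (induction w) auto
qed

text \<open>Completeness of the smooth functions on the torus under uniform convergence of every
  derivative.\<close>

lemma tsmooth_limit:
  fixes U :: "nat \<Rightarrow> real^2 \<Rightarrow> 'b::banach"
  assumes U: "\<And>n. tsmooth (U n)" and cau: "\<And>w. uniformly_Cauchy_on UNIV (\<lambda>n. pds w (U n))"
  obtains u where "tsmooth u" "\<And>w. uniform_limit UNIV (\<lambda>n. pds w (U n)) (pds w u) sequentially"
proof -
  have "\<exists>l. uniform_limit UNIV (\<lambda>n. pds w (U n)) l sequentially" for w
    using cau[of w] unfolding uniformly_convergent_eq_Cauchy[symmetric] uniformly_convergent_on_def .
  then obtain F where F: "\<And>w. uniform_limit UNIV (\<lambda>n. pds w (U n)) (F w) sequentially"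
    by metis
  have lim: "(\<lambda>n. pds w (U n) x) \<longlonglongrightarrow> F w x" for w x
    using tendsto_uniform_limitI[OF F] by simp
  have der: "(F w has_derivative (\<lambda>v. v$1 *\<^sub>R F (1 # w) x + v$2 *\<^sub>R F (2 # w) x)) (at x)" for w x
  proof -
    have "\<exists>g. \<forall>x\<in>UNIV. (\<lambda>n. pds w (U n) x) \<longlonglongrightarrow> g x \<and>
        (g has_derivative (\<lambda>v. v$1 *\<^sub>R F (1 # w) x + v$2 *\<^sub>R F (2 # w) x)) (at x within UNIV)"
    proof (rule has_derivative_sequence[where ?x0.0 = 0])
      show "(pds w (U n) has_derivative
          (\<lambda>v. v$1 *\<^sub>R pds (1 # w) (U n) x + v$2 *\<^sub>R pds (2 # w) (U n) x)) (at x within UNIV)" for n x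
        using has_derivative_pd[OF tsmooth_differentiable[OF tsmooth_pds[OF U]]] by simp
      show "(\<lambda>n. pds w (U n) 0) \<longlonglongrightarrow> F w 0" by (rule lim)
      fix e :: real assume "e > 0"
      then have "eventually (\<lambda>n. \<forall>x\<in>UNIV. dist (pds (1#w) (U n) x) (F (1#w) x) < e/2) sequentially"
        "eventually (\<lambda>n. \<forall>x\<in>UNIV. dist (pds (2#w) (U n) x) (F (2#w) x) < e/2) sequentially"
        using F[unfolded uniform_limit_iff] half_gt_zero by blast+
      then show "eventually (\<lambda>n. \<forall>x\<in>UNIV. \<forall>h::real^2. norm ((h$1 *\<^sub>R pds (1 # w) (U n) x + h$2 *\<^sub>R pds (2 # w) (U n) x)
         - (h$1 *\<^sub>R F (1 # w) x + h$2 *\<^sub>R F (2 # w) x)) \<le> e * norm h) sequentially"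
      proof eventually_elim
        case (elim n)
        show ?case
        proof (intro ballI allI)
          fix x :: "real^2" and h :: "real^2"
          define p q where "p = pds (1 # w) (U n) x - F (1 # w) x" and "q = pds (2 # w) (U n) x - F (2 # w) x"
          have pq: "norm p \<le> e/2" "norm q \<le> e/2"
            using elim unfolding p_def q_def dist_norm by (auto intro: less_imp_le)
          have "norm (h$1 *\<^sub>R p + h$2 *\<^sub>R q) \<le> \<bar>h$1\<bar> * norm p + \<bar>h$2\<bar> * norm q"
            by (rule order_trans[OF norm_triangle_ineq]) simp
          also have "\<dots> \<le> norm h * (e/2) + norm h * (e/2)"
            by (intro add_mono mult_mono pq component_le_norm_cart) auto
          finally show "norm ((h$1 *\<^sub>R pds (1 # w) (U n) x + h$2 *\<^sub>R pds (2 # w) (U n) x)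
         - (h$1 *\<^sub>R F (1 # w) x + h$2 *\<^sub>R F (2 # w) x)) \<le> e * norm h"
            unfolding p_def q_def by (simp add: algebra_simps)
        qed
      qed
    qed auto
    then obtain g where g: "\<And>x. (\<lambda>n. pds w (U n) x) \<longlonglongrightarrow> g x"
       "\<And>x. (g has_derivative (\<lambda>v. v$1 *\<^sub>R F (1 # w) x + v$2 *\<^sub>R F (2 # w) x)) (at x)" by auto
    have "g = F w" using LIMSEQ_unique[OF g(1) lim] by auto
    then show ?thesis using g(2) by simp
  qed
  show thesis
  proof
    have "F [] (x + axis i 1) = F [] x" for x i
    proof -
      have "(\<lambda>n. U n (x + axis i 1)) \<longlonglongrightarrow> F [] x"
        using lim[of "[]" x] tsmooth_periodic[OF U] by (simp add: periodic_def)
      then show ?thesis using lim[of "[]" "x + axis i 1"] LIMSEQ_unique by simp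
    qed
    then show "tsmooth (F [])"
      using smooth_map_family(1)[of F "[]", OF der] by (simp add: tsmooth_def periodic_def)
    show "uniform_limit UNIV (\<lambda>n. pds w (U n)) (pds w (F [])) sequentially" for w
      using F smooth_map_family(2)[of F w, OF der] by simp
  qed
qed

subsection \<open>Integration over the unit square\<close>

text \<open>Both measures agree on boxes. This carries Fubini's theorem over from pairs of reals to
  \<open>real^2\<close>.\<close>

lemma lborel_vector2: "(lborel :: (real^2) measure) = distr lborel borel (\<lambda>p. vector[fst p, snd p])"
proof (rule lborel_eqI)
  fix l u :: "real^2"
  assume le: "\<And>b. b \<in> Basis \<Longrightarrow> l \<bullet> b \<le> u \<bullet> b"
  have le2: "l$1 \<le> u$1" "l$2 \<le> u$2"
    using le[of "axis 1 1"] le[of "axis 2 1"] by (auto simp: inner_axis axis_in_Basis_iff)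
  have m: "(\<lambda>p. vector[fst p, snd p] :: real^2) \<in> borel_measurable lborel"
    by (simp add: borel_measurable_continuous_onI continuous_on_vector2 continuous_on_fst continuous_on_snd)
  have "(\<lambda>p. vector[fst p, snd p] :: real^2) -` box l u = box (l$1, l$2) (u$1, u$2)"
    by (auto simp: box_def Basis_vec_def Basis_prod_def inner_axis UNIV_2)
  then have "emeasure (distr lborel borel (\<lambda>p. vector[fst p, snd p])) (box l u)
      = emeasure lborel (box (l$1, l$2) (u$1, u$2))"
    by (subst emeasure_distr[OF m]) auto
  also have "\<dots> = ennreal ((u$1 - l$1) * (u$2 - l$2))"
    by (subst emeasure_lborel_box) (use le2 in \<open>auto simp: Basis_prod_def\<close>)
  also have "(u$1 - l$1) * (u$2 - l$2) = (\<Prod>b\<in>Basis. (u - l) \<bullet> b)"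
  proof -
    have B: "(Basis :: (real^2) set) = {axis 1 1, axis 2 1}"
      by (auto simp: Basis_vec_def UNIV_2)
    have "axis 1 1 \<noteq> (axis 2 1 :: real^2)" by (simp add: axis_eq_axis)
    then show ?thesis unfolding B by (simp add: inner_axis)
  qed
  finally show "emeasure (distr lborel borel (\<lambda>p. vector[fst p, snd p])) (box l u) = ennreal (\<Prod>b\<in>Basis. (u - l) \<bullet> b)" .
qed simp

lemma integral_usquare:
  fixes u :: "real^2 \<Rightarrow> 'b::euclidean_space"
  assumes u: "continuous_on UNIV u"
  shows "integral usquare u = integral {0..1} (\<lambda>a. integral {0..1} (\<lambda>b. u (vector[a,b])))"
proof -
  let ?T = "\<lambda>p. vector[fst p, snd p] :: real^2"
  have cT: "continuous_on S ?T" for S by (intro continuous_intros)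
  have m: "?T \<in> measurable lborel borel"
    using borel_measurable_continuous_onI[OF cT] by simp
  have mu: "(\<lambda>x. indicator usquare x *\<^sub>R u x) \<in> borel_measurable borel"
    using borel_measurable_continuous_onI[OF u] by measurable
  have cuT: "continuous_on S (\<lambda>p. u (?T p))" for S
    by (rule continuous_on_compose2[OF u cT]) auto
  have i1: "set_integrable lborel usquare u"
    unfolding set_integrable_def
    by (intro borel_integrable_compact continuous_on_subset[OF u] compact_cbox) auto
  have i2: "set_integrable lborel (cbox (0,0) (1,1)) (\<lambda>p. u (?T p))"
    unfolding set_integrable_def by (intro borel_integrable_compact cuT compact_cbox)
  have "integral usquare u = (LINT x:usquare|lborel. u x)"
    using set_borel_integral_eq_integral(2)[OF i1] by simp
  also have "\<dots> = (LINT p|lborel. indicator usquare (?T p) *\<^sub>R u (?T p))"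
    unfolding set_lebesgue_integral_def
    by (subst lborel_vector2, rule integral_distr[OF m mu])
  also have "\<dots> = (LINT p:cbox (0,0) (1,1)|lborel. u (?T p))"
    unfolding set_lebesgue_integral_def
    by (intro Bochner_Integration.integral_cong refl)
      (auto simp: indicator_def vector2_in_usquare cbox_Pair_eq)
  also have "\<dots> = integral (cbox (0,0) (1,1)) (\<lambda>p. u (?T p))"
    using set_borel_integral_eq_integral(2)[OF i2] by simp
  also have "\<dots> = integral {0..1} (\<lambda>a. integral {0..1} (\<lambda>b. u (vector[a,b])))"
    by (subst integral_prod_continuous[OF cuT]) simp
  finally show ?thesis .
qed

lemma integral_usquare':
  fixes u :: "real^2 \<Rightarrow> 'b::euclidean_space"
  assumes u: "continuous_on UNIV u"
  shows "integral usquare u = integral {0..1} (\<lambda>b. integral {0..1} (\<lambda>a. u (vector[a,b])))"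
proof -
  have "continuous_on (cbox (0, 0) (1, 1)) (\<lambda>(a, b). u (vector[a,b]))"
    unfolding case_prod_beta
    by (rule continuous_on_compose2[OF u]) (auto intro!: continuous_intros)
  from integral_swap_continuous[OF this] show ?thesis
    unfolding integral_usquare[OF u] by simp
qed

lemma integrable_usquare:
  fixes u :: "real^2 \<Rightarrow> 'b::euclidean_space"
  shows "tsmooth u \<Longrightarrow> u integrable_on usquare"
  by (intro integrable_continuous tsmooth_continuous)

text \<open>Integrate in direction \<open>i\<close> first: the inner integral is a difference of
  values at points that periodicity identifies.\<close>

lemma integral_pd:
  fixes u :: "real^2 \<Rightarrow> 'b::euclidean_space"
  assumes u: "tsmooth u"
  shows "integral usquare (pd i u) = 0"
proof -
  have p: "u (vector[a + 1, b]) = u (vector[a, b])" "u (vector[a, b + 1]) = u (vector[a, b])" for a b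
    using tsmooth_periodic[OF u] unfolding periodic_def vector2_shift(1)[of a b 1, symmetric] vector2_shift(2)[of a b 1, symmetric]
    by simp_all
  have 1: "integral {0..1} (\<lambda>a. pd 1 u (vector[a, b])) = 0" for b
    using fundamental_theorem_of_calculus[OF zero_le_one pd_vector_derivative_2(1)[OF tsmooth_differentiable[OF u]], of b] p(1)[of 0 b]
    by (simp add: integral_unique)
  have 2: "integral {0..1} (\<lambda>b. pd 2 u (vector[a, b])) = 0" for a
    using fundamental_theorem_of_calculus[OF zero_le_one pd_vector_derivative_2(2)[OF tsmooth_differentiable[OF u]], of a] p(2)[of a 0]
    by (simp add: integral_unique)
  note c = tsmooth_continuous[OF tsmooth_pd[OF u]]
  from exhaust_2[of i] show ?thesis
    using integral_usquare'[OF c, of 1] integral_usquare[OF c, of 2] 1 2 by auto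
qed

lemma integral_by_parts:
  fixes u v :: "real^2 \<Rightarrow> real"
  assumes "tsmooth u" "tsmooth v"
  shows "integral usquare (\<lambda>x. u x * pd i v x) = - integral usquare (\<lambda>x. pd i u x * v x)"
proof -
  have "integral usquare (pd i (\<lambda>x. u x * v x)) = 0"
    by (intro integral_pd tsmooth_intros assms)
  also have "pd i (\<lambda>x. u x * v x) = (\<lambda>x. u x * pd i v x + pd i u x * v x)"
    by (rule ext, rule pd_mult) (intro tsmooth_differentiable assms)+
  finally show ?thesis
    by (subst (asm) Henstock_Kurzweil_Integration.integral_add)
      (auto intro!: integrable_usquare tsmooth_intros assms)
qed

subsection \<open>A Sobolev inequality\<close>

definition L2sq :: "(real^2 \<Rightarrow> 'b::euclidean_space) \<Rightarrow> real" where
  "L2sq u = integral usquare (\<lambda>x. u x \<bullet> u x)"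

lemma L2sq_nonneg: "L2sq u \<ge> 0"
  unfolding L2sq_def
  by (cases "(\<lambda>x. u x \<bullet> u x) integrable_on usquare")
    (auto intro: Henstock_Kurzweil_Integration.integral_nonneg simp: not_integrable_integral)

lemma L2sq_mono:
  assumes "tsmooth u" "tsmooth v" "\<And>x. u x \<bullet> u x \<le> C * (v x \<bullet> v x)"
  shows "L2sq u \<le> C * L2sq v"
proof -
  have "integral usquare (\<lambda>x. u x \<bullet> u x) \<le> integral usquare (\<lambda>x. C * (v x \<bullet> v x))"
    by (intro integral_le integrable_usquare tsmooth_intros assms)
  then show ?thesis by (simp add: L2sq_def)
qed

lemma L2sq_mult:
  fixes m u :: "real^2 \<Rightarrow> complex"
  assumes "tsmooth m" "tsmooth u" "\<And>x. norm (m x) \<le> q"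
  shows "L2sq (\<lambda>x. m x * u x) \<le> q\<^sup>2 * L2sq u"
proof (rule L2sq_mono)
  fix x
  have "(norm (m x) * norm (u x))\<^sup>2 \<le> (q * norm (u x))\<^sup>2"
    using assms(3)[of x] by (intro power_mono mult_right_mono) auto
  then show "(m x * u x) \<bullet> (m x * u x) \<le> q\<^sup>2 * (u x \<bullet> u x)"
    by (simp add: power2_norm_eq_inner[symmetric] norm_mult power_mult_distrib)
qed (intro tsmooth_intros assms)+

text \<open>Young's inequality with a free parameter: the first factor has to come arbitrarily close
  to one where a contraction must survive a perturbation.\<close>

lemma L2sq_add:
  assumes u: "tsmooth u" and v: "tsmooth v" and e: "e > 0"
  shows "L2sq (\<lambda>x. u x + v x) \<le> (1 + e) * L2sq u + (1 + 1 / e) * L2sq v"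
proof -
  have pt: "(a + b) \<bullet> (a + b) \<le> (1 + e) * (a \<bullet> a) + (1 + 1 / e) * (b \<bullet> b)" for a b :: 'a
  proof -
    have "0 \<le> (sqrt e *\<^sub>R a - (1 / sqrt e) *\<^sub>R b) \<bullet> (sqrt e *\<^sub>R a - (1 / sqrt e) *\<^sub>R b)"
      by (rule inner_ge_zero)
    also have "\<dots> = e * (a \<bullet> a) - 2 * (a \<bullet> b) + (1 / e) * (b \<bullet> b)"
      using e by (simp add: inner_diff_left inner_diff_right inner_commute field_simps)
    finally show ?thesis
      by (simp add: inner_add_left inner_add_right inner_commute algebra_simps)
  qed
  have "L2sq (\<lambda>x. u x + v x) \<le> integral usquare (\<lambda>x. (1 + e) * (u x \<bullet> u x) + (1 + 1 / e) * (v x \<bullet> v x))"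
    unfolding L2sq_def by (intro integral_le integrable_usquare tsmooth_intros u v pt)
  also have "\<dots> = (1 + e) * L2sq u + (1 + 1 / e) * L2sq v"
    unfolding L2sq_def
    by (subst Henstock_Kurzweil_Integration.integral_add)
      (auto intro!: integrable_usquare tsmooth_intros u v)
  finally show ?thesis .
qed

lemma content_usquare: "measure lborel usquare = 1"
  using content_cbox_cart[of "0::real^2" 1] by (simp add: cbox_interval[symmetric] interval_eq_empty_cart)

lemma integral_usquare_const: "integral usquare (\<lambda>x. c) = (c::'b::euclidean_space)"
  by (simp add: content_usquare)

lemma L2sq_le_sup:
  assumes "tsmooth u" "\<And>x. norm (u x) \<le> C"
  shows "L2sq u \<le> C\<^sup>2"
proof -
  have "integral usquare (\<lambda>x. u x \<bullet> u x) \<le> integral usquare (\<lambda>x. C\<^sup>2)"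
  proof (intro integral_le integrable_usquare tsmooth_intros assms)
    show "u x \<bullet> u x \<le> C\<^sup>2" for x
      unfolding power2_norm_eq_inner[symmetric] by (intro power_mono assms(2) norm_ge_zero)
  qed
  then show ?thesis unfolding integral_usquare_const by (simp add: L2sq_def)
qed

text \<open>Pythagoras: the unit square has area one, so its integral is the mean, and subtracting
  the mean is an orthogonal projection.\<close>

lemma L2sq_diff_mean:
  assumes u: "tsmooth u"
  shows "L2sq (\<lambda>x. u x - integral usquare u) = L2sq u - (norm (integral usquare u))\<^sup>2"
proof -
  define c where "c = integral usquare u"
  have "L2sq (\<lambda>x. u x - c) = integral usquare (\<lambda>x. u x \<bullet> u x + (c \<bullet> c + (-2) * (u x \<bullet> c)))"
    unfolding L2sq_def by (rule arg_cong[where f = "integral usquare"])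
      (auto simp: algebra_simps inner_diff_left inner_diff_right inner_commute fun_eq_iff)
  also have "\<dots> = L2sq u + (integral usquare (\<lambda>x. c \<bullet> c) + integral usquare (\<lambda>x. (-2) * (u x \<bullet> c)))"
    unfolding L2sq_def
    by (subst Henstock_Kurzweil_Integration.integral_add, (intro integrable_usquare tsmooth_intros u)+)
      (subst Henstock_Kurzweil_Integration.integral_add, (intro integrable_usquare tsmooth_intros u)+, simp)
  also have "integral usquare (\<lambda>x. (-2) * (u x \<bullet> c)) = (-2) * integral usquare (\<lambda>x. u x \<bullet> c)"
    by (rule integral_mult_right)
  also have "integral usquare (\<lambda>x. u x \<bullet> c) = c \<bullet> c"
    using integral_linear[OF integrable_usquare[OF u] bounded_linear_inner_left[of c]]
    by (simp add: o_def c_def)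
  also have "integral usquare (\<lambda>x::real^2. c \<bullet> c) = c \<bullet> c" by (rule integral_usquare_const)
  finally show ?thesis by (simp add: c_def power2_norm_eq_inner)
qed

lemma norm_mean_le:
  assumes u: "tsmooth u"
  shows "(norm (integral usquare u))\<^sup>2 \<le> L2sq u"
  using L2sq_diff_mean[OF u] L2sq_nonneg[of "\<lambda>x. u x - integral usquare u"] by simp

text \<open>The oscillation of a function is at most the integral of the norm of its derivative.
  Comparing \<open>\<phi> t\<close> with every \<open>\<phi> s\<close> and averaging the squares
  over \<open>s\<close> gives the bound.\<close>

lemma sup_le_L2_interval:
  fixes \<phi> :: "real \<Rightarrow> 'b::euclidean_space"
  assumes der: "\<And>s. s \<in> {0..1} \<Longrightarrow> (\<phi> has_vector_derivative \<phi>' s) (at s within {0..1})"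
    and c': "continuous_on {0..1} \<phi>'" and t: "t \<in> {0..1}"
  shows "(norm (\<phi> t))\<^sup>2 \<le> 2 * integral {0..1} (\<lambda>s. (norm (\<phi> s))\<^sup>2) + 2 * integral {0..1} (\<lambda>s. (norm (\<phi>' s))\<^sup>2)"
proof -
  define M where "M = integral {0..1} (\<lambda>s. norm (\<phi>' s))"
  have c: "continuous_on {0..1} \<phi>"
    using der has_vector_derivative_continuous continuous_on_eq_continuous_within by blast
  have i': "(\<lambda>s. norm (\<phi>' s)) integrable_on {0..1}"
    by (intro integrable_continuous_real continuous_intros c')
  have i2: "(\<lambda>s. (norm (\<phi>' s))\<^sup>2) integrable_on {0..1}" "(\<lambda>s. (norm (\<phi> s))\<^sup>2) integrable_on {0..1}"
    by (intro integrable_continuous_real continuous_intros c c')+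
  have le: "norm (\<phi> b - \<phi> a) \<le> M" if "a \<le> b" "a \<in> {0..1}" "b \<in> {0..1}" for a b
  proof -
    have sub: "{a..b} \<subseteq> {0..1}" using that by auto
    have "(\<phi>' has_integral (\<phi> b - \<phi> a)) {a..b}"
      by (rule fundamental_theorem_of_calculus[OF that(1)])
        (use sub in \<open>auto intro: has_vector_derivative_within_subset[OF der]\<close>)
    then have "\<phi> b - \<phi> a = integral {a..b} \<phi>'" by (simp add: integral_unique)
    also have "norm \<dots> \<le> integral {a..b} (\<lambda>s. norm (\<phi>' s))"
      by (rule Henstock_Kurzweil_Integration.integral_norm_bound_integral)
        (use sub c' in \<open>auto intro!: integrable_continuous_real continuous_intros intro: continuous_on_subset\<close>)
    also have "\<dots> \<le> M"
      unfolding M_def by (rule integral_subset_le[OF sub _ i'])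
        (use sub c' in \<open>auto intro!: integrable_continuous_real continuous_intros intro: continuous_on_subset\<close>)
    finally show ?thesis .
  qed
  \<comment> \<open>The Cauchy-Schwarz inequality, obtained from the nonnegative variance of the
    norm of the derivative.\<close>
  have M2: "M\<^sup>2 \<le> integral {0..1} (\<lambda>s. (norm (\<phi>' s))\<^sup>2)"
  proof -
    have "0 \<le> integral {0..1} (\<lambda>s. (norm (\<phi>' s) - M)\<^sup>2)"
      by (rule Henstock_Kurzweil_Integration.integral_nonneg)
        (auto intro!: integrable_continuous_real continuous_intros c')
    also have "(\<lambda>s. (norm (\<phi>' s) - M)\<^sup>2) = (\<lambda>s. (norm (\<phi>' s))\<^sup>2 + (M\<^sup>2 - norm (\<phi>' s) * (2 * M)))"
      by (auto simp: power2_diff algebra_simps)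
    also have "integral {0..1} \<dots> = integral {0..1} (\<lambda>s. (norm (\<phi>' s))\<^sup>2) + (M\<^sup>2 - M * (2 * M))"
    proof -
      have j: "(\<lambda>s. norm (\<phi>' s) * (2 * M)) integrable_on {0..1}"
        by (intro integrable_on_mult_left i')
      have "integral {0..1} (\<lambda>s. M\<^sup>2 - norm (\<phi>' s) * (2 * M)) = M\<^sup>2 - M * (2 * M)"
        by (subst Henstock_Kurzweil_Integration.integral_diff[OF _ j])
          (auto simp: integral_mult_left M_def)
      then show ?thesis
        by (subst Henstock_Kurzweil_Integration.integral_add[OF i2(1)])
          (auto intro!: Henstock_Kurzweil_Integration.integrable_diff j)
    qed
    finally show ?thesis by (simp add: power2_eq_square algebra_simps)
  qed
  have pt: "(norm (\<phi> t))\<^sup>2 \<le> 2 * (norm (\<phi> s))\<^sup>2 + 2 * M\<^sup>2" if "s \<in> {0..1}" for s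
  proof -
    have "norm (\<phi> t - \<phi> s) \<le> M"
      using le[of s t] le[of t s] that t by (cases "s \<le> t") (auto simp: norm_minus_commute)
    then have "norm (\<phi> t) \<le> norm (\<phi> s) + M"
      using norm_triangle_sub[of "\<phi> t" "\<phi> s"] by linarith
    then have "(norm (\<phi> t))\<^sup>2 \<le> (norm (\<phi> s) + M)\<^sup>2"
      by (intro power_mono) auto
    also have "\<dots> \<le> 2 * (norm (\<phi> s))\<^sup>2 + 2 * M\<^sup>2"
      using sum_squares_bound[of "norm (\<phi> s)" M] by (simp add: power2_sum)
    finally show ?thesis .
  qed
  have "(norm (\<phi> t))\<^sup>2 = integral {0..1::real} (\<lambda>s. (norm (\<phi> t))\<^sup>2)" by simp
  also have "\<dots> \<le> integral {0..1} (\<lambda>s. 2 * (norm (\<phi> s))\<^sup>2 + 2 * M\<^sup>2)"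
    by (rule integral_le) (auto intro!: integrable_continuous_real continuous_intros c pt)
  also have "\<dots> = 2 * integral {0..1} (\<lambda>s. (norm (\<phi> s))\<^sup>2) + 2 * M\<^sup>2"
    by (subst Henstock_Kurzweil_Integration.integral_add) (auto intro!: integrable_continuous_real continuous_intros c)
  finally show ?thesis using M2 by linarith
qed

text \<open>The one-dimensional estimate is used twice, on the horizontal line through the point and
  then on the vertical lines meeting it. This produces the mixed derivative and the constant
  \<open>4 = 2 * 2\<close>.\<close>

lemma sup_le_L2:
  fixes u :: "real^2 \<Rightarrow> 'b::euclidean_space"
  assumes u: "tsmooth u"
  shows "(norm (u x))\<^sup>2 \<le> 4 * (L2sq u + L2sq (pd 1 u) + L2sq (pd 2 u) + L2sq (pd 2 (pd 1 u)))"
proof -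
  obtain a b where ab: "a \<in> {0..1}" "b \<in> {0..1}" "u x = u (vector[a,b])"
    using periodic_reduce[of x] tsmooth_periodic[OF u] by metis
  have c: "continuous_on S (\<lambda>p. v (vector[f p, g p]))" if "tsmooth v" "continuous_on S f" "continuous_on S g"
    for v :: "real^2 \<Rightarrow> 'b" and S :: "'c::topological_space set" and f g
    by (rule continuous_on_compose2[OF tsmooth_continuous[OF that(1), of UNIV]])
      (auto intro!: continuous_intros that)
  define A where "A = (\<lambda>(v :: real^2 \<Rightarrow> 'b) t. integral {0..1} (\<lambda>s. (norm (v (vector[t,s])))\<^sup>2))"
  have cA: "continuous_on {0..1} (A v)" if "tsmooth v" for v
    unfolding A_def cbox_interval[symmetric]
    by (rule integral_continuous_on_param) (unfold case_prod_beta, intro continuous_intros c that)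
  have iA: "(A v) integrable_on {0..1}" if "tsmooth v" for v
    by (intro integrable_continuous_real cA that)
  have LA: "integral {0..1} (A v) = L2sq v" if "tsmooth v" for v
    unfolding A_def L2sq_def
    by (subst integral_usquare) (auto intro!: tsmooth_continuous tsmooth_intros that simp: power2_norm_eq_inner)
  have 1: "integral {0..1} (\<lambda>t. (norm (v (vector[t,b])))\<^sup>2) \<le> 2 * L2sq v + 2 * L2sq (pd 2 v)" if v: "tsmooth v" for v :: "real^2 \<Rightarrow> 'b"
  proof -
    have "(norm (v (vector[t,b])))\<^sup>2 \<le> 2 * A v t + 2 * A (pd 2 v) t" for t
      unfolding A_def
      by (rule sup_le_L2_interval[OF pd_vector_derivative_2(2)[OF tsmooth_differentiable[OF v]] _ ab(2)])
        (intro c tsmooth_pd v continuous_intros)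
    then have "integral {0..1} (\<lambda>t. (norm (v (vector[t,b])))\<^sup>2) \<le> integral {0..1} (\<lambda>t. 2 * A v t + 2 * A (pd 2 v) t)"
      by (intro integral_le integrable_continuous_real continuous_intros c v cA tsmooth_pd)
    also have "\<dots> = 2 * L2sq v + 2 * L2sq (pd 2 v)"
      by (subst Henstock_Kurzweil_Integration.integral_add)
        (auto intro!: integrable_on_mult_right iA v tsmooth_pd simp: LA v tsmooth_pd)
    finally show ?thesis .
  qed
  have "(norm (u x))\<^sup>2 \<le> 2 * integral {0..1} (\<lambda>t. (norm (u (vector[t,b])))\<^sup>2) + 2 * integral {0..1} (\<lambda>t. (norm (pd 1 u (vector[t,b])))\<^sup>2)"
    unfolding ab(3)
    by (rule sup_le_L2_interval[OF pd_vector_derivative_2(1)[OF tsmooth_differentiable[OF u]] _ ab(1)])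
        (intro c tsmooth_pd u continuous_intros)
  then show ?thesis using 1[OF u] 1[OF tsmooth_pd[OF u], of 1] by (argo | (simp add: algebra_simps; fail))
qed

lemma lipschitz_pd:
  fixes u :: "real^2 \<Rightarrow> 'b::real_normed_vector"
  assumes u: "\<And>x. u differentiable (at x)" and M: "\<And>i x. norm (pd i u x) \<le> M"
  shows "norm (u x - u y) \<le> 2 * M * norm (x - y)"
proof (rule differentiable_bound[OF convex_UNIV])
  fix z
  show "(u has_derivative (\<lambda>v. v$1 *\<^sub>R pd 1 u z + v$2 *\<^sub>R pd 2 u z)) (at z within UNIV)"
    using has_derivative_pd[OF u] by simp
  show "onorm (\<lambda>v::real^2. v$1 *\<^sub>R pd 1 u z + v$2 *\<^sub>R pd 2 u z) \<le> 2 * M"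
  proof (rule onorm_le)
    fix v :: "real^2"
    have "norm (v$1 *\<^sub>R pd 1 u z + v$2 *\<^sub>R pd 2 u z) \<le> \<bar>v$1\<bar> * norm (pd 1 u z) + \<bar>v$2\<bar> * norm (pd 2 u z)"
      by (rule order_trans[OF norm_triangle_ineq]) simp
    also have "\<dots> \<le> norm v * M + norm v * M"
      by (intro add_mono mult_mono M component_le_norm_cart) auto
    finally show "norm (v$1 *\<^sub>R pd 1 u z + v$2 *\<^sub>R pd 2 u z) \<le> 2 * M * norm v"
      by (simp add: algebra_simps)
  qed
qed auto

subsection \<open>The flat Cauchy-Riemann operators\<close>

definition dbar :: "(real^2 \<Rightarrow> complex) \<Rightarrow> real^2 \<Rightarrow> complex" where
  "dbar u x = (pd 1 u x + \<i> * pd 2 u x) / 2"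

definition del :: "(real^2 \<Rightarrow> complex) \<Rightarrow> real^2 \<Rightarrow> complex" where
  "del u x = (pd 1 u x - \<i> * pd 2 u x) / 2"

lemma tsmooth_dbar [tsmooth_intros]: "tsmooth u \<Longrightarrow> tsmooth (dbar u)"
  unfolding dbar_def[abs_def] by (intro tsmooth_intros) auto

lemma tsmooth_del [tsmooth_intros]: "tsmooth u \<Longrightarrow> tsmooth (del u)"
  unfolding del_def[abs_def] by (intro tsmooth_intros) auto

lemma pds_mult_const:
  fixes u :: "real^2 \<Rightarrow> complex"
  assumes "smooth_map u"
  shows "pds w (\<lambda>x. c * u x) = (\<lambda>x. c * pds w u x)"
  by (rule pds_bounded_linear[OF bounded_linear_mult_right assms])

lemma pds_dbar:
  assumes u: "smooth_map u"
  shows "pds w (dbar u) = dbar (pds w u)"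
proof -
  have "dbar u = (\<lambda>x. (1/2) * pd 1 u x + (\<i>/2) * pd 2 u x)"
    by (auto simp: dbar_def add_divide_distrib)
  then have "pds w (dbar u) = (\<lambda>x. (1/2) * pds w (pd 1 u) x + (\<i>/2) * pds w (pd 2 u) x)"
    by (simp only: pds_add smooth_map_mult smooth_map_const smooth_map_pd u pds_mult_const)
  then show ?thesis
    by (auto simp: dbar_def[abs_def] pd_pds[OF u] add_divide_distrib)
qed

lemma pds_del:
  assumes u: "smooth_map u"
  shows "pds w (del u) = del (pds w u)"
proof -
  have "del u = (\<lambda>x. (1/2) * pd 1 u x + (-\<i>/2) * pd 2 u x)"
    by (auto simp: del_def diff_divide_distrib)
  then have "pds w (del u) = (\<lambda>x. (1/2) * pds w (pd 1 u) x + (-\<i>/2) * pds w (pd 2 u) x)"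
    by (simp only: pds_add smooth_map_mult smooth_map_const smooth_map_pd u pds_mult_const)
  then show ?thesis
    by (auto simp: del_def[abs_def] pd_pds[OF u] diff_divide_distrib)
qed

text \<open>The pointwise difference of both sides is a Jacobian determinant, hence a divergence.\<close>

lemma L2sq_del:
  assumes v: "tsmooth v"
  shows "L2sq (del v) = L2sq (dbar v)"
proof -
  define a b where "a = (\<lambda>x. Re (v x))" and "b = (\<lambda>x. Im (v x))"
  have ab: "tsmooth a" "tsmooth b" unfolding a_def b_def by (intro tsmooth_intros v)+
  have pv: "pd i v x = Complex (pd i a x) (pd i b x)" for i x
    unfolding a_def b_def
    by (simp add: complex_eq_iff pd_bounded_linear[OF bounded_linear_Re tsmooth_differentiable[OF v]]
       pd_bounded_linear[OF bounded_linear_Im tsmooth_differentiable[OF v]])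
  have pw: "del v x \<bullet> del v x - dbar v x \<bullet> dbar v x = pd 1 (\<lambda>x. a x * pd 2 b x) x - pd 2 (\<lambda>x. a x * pd 1 b x) x" for x
  proof -
    have "pd 1 (\<lambda>x. a x * pd 2 b x) x - pd 2 (\<lambda>x. a x * pd 1 b x) x = pd 1 a x * pd 2 b x - pd 2 a x * pd 1 b x"
      by (subst (1 2) pd_mult) (auto intro!: tsmooth_differentiable tsmooth_intros ab
          simp: pd_commute_12[OF tsmooth_smooth[OF ab(2)]])
    then show ?thesis
      by (simp add: del_def dbar_def pv inner_complex_def field_simps)
  qed
  have "L2sq (del v) - L2sq (dbar v) = integral usquare (\<lambda>x. del v x \<bullet> del v x - dbar v x \<bullet> dbar v x)"
    unfolding L2sq_def
    by (rule Henstock_Kurzweil_Integration.integral_diff[symmetric]) (intro integrable_usquare tsmooth_intros v)+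
  also have "\<dots> = integral usquare (pd 1 (\<lambda>x. a x * pd 2 b x)) - integral usquare (pd 2 (\<lambda>x. a x * pd 1 b x))"
    unfolding pw
    by (rule Henstock_Kurzweil_Integration.integral_diff) (intro integrable_usquare tsmooth_intros ab)+
  also have "\<dots> = 0"
    by (simp add: integral_pd tsmooth_mult tsmooth_pd ab)
  finally show ?thesis by simp
qed

text \<open>Up to a factor of modulus one, the partial derivatives are the sum and the difference of
  \<open>del v\<close> and \<open>dbar v\<close>, which have equal norms. Thus \<open>dbar\<close>
  alone controls the full gradient.\<close>

lemma L2sq_pd_le:
  assumes v: "tsmooth v"
  shows "L2sq (pd i v) \<le> 4 * L2sq (dbar v)"
proof -
  have 1: "L2sq (\<lambda>x. del v x + dbar v x) \<le> 4 * L2sq (dbar v)"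
    using L2sq_add[OF tsmooth_del[OF v] tsmooth_dbar[OF v], of 1] L2sq_del[OF v] by simp
  have 2: "L2sq (\<lambda>x. del v x + (- dbar v x)) \<le> 4 * L2sq (dbar v)"
    using L2sq_add[OF tsmooth_del[OF v] tsmooth_minus[OF tsmooth_dbar[OF v]], of 1] L2sq_del[OF v]
    by (simp add: L2sq_def)
  have "pd 1 v = (\<lambda>x. del v x + dbar v x)"
    by (auto simp: del_def dbar_def field_simps)
  moreover have "L2sq (pd 2 v) = L2sq (\<lambda>x. del v x + (- dbar v x))"
    by (auto simp: L2sq_def del_def dbar_def inner_complex_def field_simps)
  ultimately show ?thesis using exhaust_2[of i] 1 2 by auto
qed

text \<open>Constant-coefficient operators commute with \<open>dbar\<close>, so the Sobolev
  inequality only meets derivatives of \<open>dbar u\<close>. The words are those of the four terms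
  in \<open>sup_le_L2\<close>; \<open>64\<close> is its constant 4, times four terms, times the 4 of
  \<open>L2sq_pd_le\<close>.\<close>

lemma dbar_control_pd:
  assumes u: "tsmooth u" and e: "\<And>v. v \<in> {w, 1 # w, 2 # w, 2 # 1 # w} \<Longrightarrow> L2sq (pds v (dbar u)) \<le> e"
  shows "(norm (pds w (pd i u) x))\<^sup>2 \<le> 64 * e"
proof -
  have "L2sq (pds v (pd i u)) \<le> 4 * e" if "v \<in> {w, 1 # w, 2 # w, 2 # 1 # w}" for v
    using L2sq_pd_le[of "pds v u" i, OF tsmooth_pds[OF u]] e[OF that]
    by (simp add: pds_dbar tsmooth_smooth u pd_pds)
  from this[of w] this[of "1 # w"] this[of "2 # w"] this[of "2 # 1 # w"]
  show ?thesis
    using sup_le_L2[of "pds w (pd i u)" x, OF tsmooth_pds[OF tsmooth_pd[OF u]]] by simp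
qed

text \<open>The elliptic estimate. The finite set of words depends on \<open>w\<close> alone, not on
  the function. Constants are in the kernel of \<open>dbar\<close>, which is why the value at the
  origin is prescribed. For the empty word the gradient bound \<open>8 * sqrt e\<close> is
  integrated from the origin over a distance of at most 2, with the factor 2 of
  \<open>lipschitz_pd\<close>: this gives \<open>32 * sqrt e\<close>, whence 1024, which exceeds the
  64 of the other words.\<close>

lemma dbar_control:
  obtains V where "finite V"
    "\<And>u e x. tsmooth u \<Longrightarrow> u 0 = 0 \<Longrightarrow> (\<And>v. v \<in> V \<Longrightarrow> L2sq (pds v (dbar u)) \<le> e)
      \<Longrightarrow> (norm (pds w u x))\<^sup>2 \<le> 1024 * e"
proof (cases w rule: rev_cases)
  case Nil
  show thesis
  proof (rule that[of "{[], [1], [2], [2, 1]}"])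
    fix u and e :: real and x
    assume u: "tsmooth u" "u 0 = 0" and e: "\<And>v. v \<in> {[], [1], [2], [2, 1]} \<Longrightarrow> L2sq (pds v (dbar u)) \<le> e"
    have e0: "e \<ge> 0" using e[of "[]"] L2sq_nonneg[of "dbar u"] by auto
    have M: "norm (pd i u y) \<le> 8 * sqrt e" for i y
    proof -
      have "(norm (pd i u y))\<^sup>2 \<le> 64 * e"
        using dbar_control_pd[OF u(1), of "[]" e i y] e by simp
      then show ?thesis
        using real_le_rsqrt[of "norm (pd i u y)" "64 * e"] by (simp add: real_sqrt_mult)
    qed
    obtain a b where ab: "a \<in> {0..1}" "b \<in> {0..1}" "u x = u (vector[a,b])"
      using periodic_reduce[of x] tsmooth_periodic[OF u(1)] by metis
    have "norm (u (vector[a,b]) - u 0) \<le> 2 * (8 * sqrt e) * norm (vector[a,b] - 0 :: real^2)"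
      by (rule lipschitz_pd[OF tsmooth_differentiable[OF u(1)] M])
    also have "\<dots> \<le> 2 * (8 * sqrt e) * 2"
      using norm_le_l1_cart[of "vector[a,b] :: real^2"] ab e0 by (intro mult_left_mono) (auto simp: sum_2)
    finally have "norm (u x) \<le> 32 * sqrt e" using ab u by simp
    then have "(norm (u x))\<^sup>2 \<le> (32 * sqrt e)\<^sup>2" by (intro power_mono) auto
    then show "(norm (pds w u x))\<^sup>2 \<le> 1024 * e" using e0 Nil by (simp add: power_mult_distrib)
  qed auto
next
  case (snoc w' i)
  show thesis
  proof (rule that[of "{w', 1 # w', 2 # w', 2 # 1 # w'}"])
    fix u and e :: real and x
    assume u: "tsmooth u" "u 0 = 0"
      and e: "\<And>v. v \<in> {w', 1 # w', 2 # w', 2 # 1 # w'} \<Longrightarrow> L2sq (pds v (dbar u)) \<le> e"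
    have "e \<ge> 0" using e[of "w'"] L2sq_nonneg[of "pds w' (dbar u)"] by auto
    then show "(norm (pds w u x))\<^sup>2 \<le> 1024 * e"
      using dbar_control_pd[of u w' e i x, OF u(1) e] snoc by (simp add: pds_append)
  qed auto
qed

subsection \<open>Trigonometric polynomials\<close>

definition ee :: "int \<Rightarrow> int \<Rightarrow> real^2 \<Rightarrow> complex" where
  "ee a b x = cis (2 * pi * (of_int a * x$1 + of_int b * x$2))"

lemma ee_0 [simp]: "ee 0 0 x = 1" "ee a b 0 = 1"
  by (simp_all add: ee_def)

lemma ee_diff: "ee a b (x - y) = ee a b x * ee (- a) (- b) y"
  by (simp add: ee_def cis_mult algebra_simps)

lemma ee_has_derivative:
  "(ee a b has_derivative (\<lambda>v. (2 * pi * \<i> * (of_int a * v$1 + of_int b * v$2)) * ee a b x)) (at x)"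
proof -
  have 1: "((\<lambda>x. \<i> * complex_of_real (2 * pi * (of_int a * x$1 + of_int b * x$2))) has_derivative
      (\<lambda>v. \<i> * complex_of_real (2 * pi * (of_int a * v$1 + of_int b * v$2)))) (at x)" for x :: "real^2"
    by (intro bounded_linear_imp_has_derivative)
      (auto intro!: bounded_linear_intros bounded_linear_vec_nth
        intro: bounded_linear_compose[OF bounded_linear_mult_right] bounded_linear_compose[OF bounded_linear_of_real])
  have 2: "(exp has_derivative (\<lambda>v. exp z * v)) (at z)" for z :: complex
    using DERIV_exp[of z] by (simp add: has_field_derivative_def)
  have "ee a b = (\<lambda>x. exp (\<i> * complex_of_real (2 * pi * (of_int a * x$1 + of_int b * x$2))))"
    by (auto simp: ee_def cis_conv_exp fun_eq_iff)
  then show ?thesis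
    using has_derivative_compose[OF 1[of x] 2] by (simp add: algebra_simps)
qed

lemma pd_ee: "pd 1 (ee a b) x = 2 * pi * \<i> * of_int a * ee a b x" "pd 2 (ee a b) x = 2 * pi * \<i> * of_int b * ee a b x"
  by (simp_all add: pd_eqI[OF ee_has_derivative] axis_def)

lemma tsmooth_ee [tsmooth_intros]: "tsmooth (ee a b)"
proof -
  have "Ck_map k (\<lambda>x. c * ee a b x)" for k c
  proof (induction k arbitrary: c)
    case 0
    have "continuous_on UNIV (ee a b)"
      by (intro continuous_at_imp_continuous_on ballI) (rule has_derivative_continuous[OF ee_has_derivative])
    then show ?case by (auto intro!: continuous_intros)
  next
    case (Suc k)
    show ?case
    proof (rule Ck_map_SucI)
      show "((\<lambda>x. c * ee a b x) has_derivative (\<lambda>v. (c * (2 * pi * \<i> * (of_int a * v$1 + of_int b * v$2))) * ee a b x)) (at x)" for x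
        using bounded_linear.has_derivative[OF bounded_linear_mult_right ee_has_derivative, of c] by (simp add: mult.assoc)
    qed (rule Suc)
  qed
  from this[of _ 1] have "smooth_map (ee a b)" by (simp add: smooth_map_def)
  moreover have "periodic (ee a b)"
  proof -
    have "ee a b (x + axis i 1) = ee a b x * cis (2 * pi * (if i = 1 then of_int a else of_int b))" for x i
      using exhaust_2[of i] by (auto simp: ee_def cis_mult axis_def algebra_simps)
    moreover have "cis (2 * pi * of_int n) = 1" for n
      by (simp add: cis_multiple_2pi)
    ultimately show ?thesis by (simp add: periodic_def)
  qed
  ultimately show ?thesis by (simp add: tsmooth_def)
qed

lemma integral_cmult:
  fixes c :: complex
  assumes "f integrable_on S"
  shows "integral S (\<lambda>x. c * f x) = c * integral S f"
  using integral_linear[OF assms bounded_linear_mult_right[of c]] by (simp add: o_def)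

lemma integral_ee: "integral usquare (ee a b) = (if a = 0 \<and> b = 0 then 1 else 0)"
proof (cases "a = 0 \<and> b = 0")
  case True
  then have "ee a b = (\<lambda>x. 1)" by auto
  then show ?thesis using True integral_usquare_const[of "1::complex"] by simp
next
  case False
  have "2 * pi * \<i> * of_int a * integral usquare (ee a b) = 0" "2 * pi * \<i> * of_int b * integral usquare (ee a b) = 0"
    using integral_pd[OF tsmooth_ee, of 1 a b] integral_pd[OF tsmooth_ee, of 2 a b]
    by (simp_all add: pd_ee[abs_def] integral_cmult integrable_usquare tsmooth_ee)
  then show ?thesis using False by auto
qed

lemma cos_power_even:
  "complex_of_real (cos t ^ (2 * m)) =
    (\<Sum>k\<le>2*m. of_nat (2 * m choose k) / 4 ^ m * cis (2 * (of_int (int k - int m) * t)))"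
proof -
  have "complex_of_real (cos t) = (cis t + cis (- t)) / 2"
    by (simp add: complex_eq_iff)
  then have "complex_of_real (cos t ^ (2 * m)) = (cis t + cis (- t)) ^ (2 * m) / 4 ^ m"
  proof -
    have "(2::complex) ^ (2 * m) = 4 ^ m" by (simp add: power_mult)
    then show ?thesis
      unfolding of_real_power \<open>complex_of_real (cos t) = _\<close> power_divide by simp
  qed
  also have "\<dots> = (\<Sum>k\<le>2*m. of_nat (2 * m choose k) / 4 ^ m * (cis t ^ k * cis (- t) ^ (2 * m - k)))"
    by (simp add: binomial_ring sum_divide_distrib mult.assoc)
  also have "\<dots> = (\<Sum>k\<le>2*m. of_nat (2 * m choose k) / 4 ^ m * cis (2 * (of_int (int k - int m) * t)))"
    by (intro sum.cong refl arg_cong2[where f = "(*)"])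
      (auto simp: Complex.DeMoivre cis_mult of_nat_diff algebra_simps)
  finally show ?thesis .
qed

text \<open>The constant Fourier coefficient of an even power of the cosine, hence its mean over a
  period.\<close>

definition cbin :: "nat \<Rightarrow> real" where "cbin m = of_nat (2 * m choose m) / 4 ^ m"

lemma cbin_pos: "cbin m > 0"
  by (simp add: cbin_def zero_less_binomial)

text \<open>The Wallis recursion. The deficit \<open>1 / (2 * m + 2)\<close> is the mean of the
  squared sine against the normalised kernel, and so measures how far the kernel is
  concentrated.\<close>

lemma cbin_Suc: "cbin (Suc m) = cbin m * (1 - 1 / (2 * m + 2))"
proof -
  have a: "Suc m * (2 * Suc m choose Suc m) = (2 * m + 2) * (Suc (2 * m) choose m)"
    using Suc_times_binomial[of m "Suc (2 * m)"] by simp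
  have b: "Suc m * (Suc (2 * m) choose m) = Suc (2 * m) * (2 * m choose m)"
    using binomial_absorb_comp[of "Suc (2 * m)" m] by simp
  have c: "A = 2 * B" if "real (Suc m) * A = (2 * real m + 2) * B" for A B
  proof -
    have "real (Suc m) * A = real (Suc m) * (2 * B)" using that by (simp add: algebra_simps)
    then show ?thesis by (simp del: of_nat_Suc)
  qed
  have 1: "real (2 * Suc m choose Suc m) = 2 * real (Suc (2 * m) choose m)"
    using arg_cong[OF a, of real] by (intro c) (simp only: of_nat_mult of_nat_add of_nat_numeral)
  have d: "A = (2 * real m + 1) * B / (real m + 1)" if "real (Suc m) * A = real (Suc (2 * m)) * B" for A B
    using that by (simp add: field_simps)
  have 2: "real (Suc (2 * m) choose m) = (2 * real m + 1) * real (2 * m choose m) / (real m + 1)"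
    using arg_cong[OF b, of real] by (intro d) (simp only: of_nat_mult)
  have 3: "2 * ((2 * M + 1) * B / (M + 1)) / (4 * P) = B / P * (1 - 1 / (2 * M + 2))" if "M \<ge> 0" "P > 0" for M B P :: real
  proof -
    have "1 - 1 / (2 * M + 2) = (2 * M + 1) / (2 * (M + 1))" using that by (simp add: field_simps)
    then show ?thesis using that by simp
  qed
  show ?thesis unfolding cbin_def 1 2 using 3[of "real m" "4 ^ m" "real (2 * m choose m)"] by simp
qed

text \<open>The kernel of de la Vallee Poussin: a nonnegative trigonometric polynomial, of period
  one because the powers are even. Two exponents are kept since its second moments raise only one of
  them.\<close>

definition kern :: "nat \<Rightarrow> nat \<Rightarrow> real^2 \<Rightarrow> real" where
  "kern m n z = cos (pi * z$1) ^ (2 * m) * cos (pi * z$2) ^ (2 * n)"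

lemma kern_nonneg: "kern m n z \<ge> 0"
  by (simp add: kern_def power_mult)

lemma kern_ee:
  "complex_of_real (kern m n z) = (\<Sum>(k,l)\<in>{..2*m}\<times>{..2*n}.
     complex_of_real (of_nat (2 * m choose k) * of_nat (2 * n choose l) / (4 ^ m * 4 ^ n)) * ee (int k - int m) (int l - int n) z)"
  unfolding kern_def of_real_mult cos_power_even sum_product sum.cartesian_product
  by (intro sum.cong refl) (auto simp: ee_def cis_mult[symmetric] algebra_simps cis_mult)

lemma continuous_kern: "continuous_on UNIV (\<lambda>y. kern m n (x - y))"
  unfolding kern_def by (intro continuous_intros)

lemma integral_kern_complex:
  "integral usquare (\<lambda>y. complex_of_real (kern m n (x - y))) = cbin m * cbin n"
proof -
  have "integral usquare (\<lambda>y. complex_of_real (kern m n (x - y))) =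
    (\<Sum>(k,l)\<in>{..2*m}\<times>{..2*n}. complex_of_real (of_nat (2 * m choose k) * of_nat (2 * n choose l) / (4 ^ m * 4 ^ n)) *
       ee (int k - int m) (int l - int n) x * integral usquare (ee (- (int k - int m)) (- (int l - int n))))"
    unfolding kern_ee ee_diff
    by (subst Henstock_Kurzweil_Integration.integral_sum)
      (auto simp: case_prod_unfold mult.assoc[symmetric] integral_cmult
       intro!: sum.cong integrable_usquare tsmooth_intros)
  also have "\<dots> = (\<Sum>p\<in>{..2*m}\<times>{..2*n}. if p = (m, n) then complex_of_real (cbin m * cbin n) else 0)"
    by (intro sum.cong refl) (auto simp: integral_ee cbin_def split: if_splits)
  also have "\<dots> = cbin m * cbin n"
    by (subst sum.delta) auto
  finally show ?thesis .
qed

lemma integral_kern: "integral usquare (\<lambda>y. kern m n (x - y)) = cbin m * cbin n"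
proof -
  have "(\<lambda>y. kern m n (x - y)) integrable_on usquare"
    by (rule integrable_continuous, rule continuous_on_subset[OF continuous_kern]) auto
  from integral_linear[OF this bounded_linear_of_real[where 'a = complex]]
  show ?thesis
    using integral_kern_complex[of m n x]
    by (simp add: o_def del: of_real_mult add: of_real_mult[symmetric])
qed

text \<open>A weak form of Jordan's inequality. Up to \<open>1/3\<close> the mean value theorem
  applies with cosine at least \<open>1/2\<close>; beyond it the sine already exceeds
  \<open>1/2\<close>.\<close>

lemma abs_le_abs_sin:
  assumes "\<bar>t\<bar> \<le> 1/2"
  shows "\<bar>t\<bar> \<le> \<bar>sin (pi * t)\<bar>"
proof -
  have pos: "t \<le> sin (pi * t)" if t: "0 \<le> t" "t \<le> 1/2" for t
  proof (cases "t \<le> 1/3")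
    case True
    show ?thesis
    proof (cases "t = 0")
      case False
      then have tp: "0 < pi * t" using t by simp
      obtain z where z: "0 < z" "z < pi * t" "sin (pi * t) - sin 0 = (pi * t - 0) * cos z"
        using MVT2[OF tp, of sin cos] by (auto intro: DERIV_sin)
      have "pi * t \<le> pi * (1/3)" using True by (intro mult_left_mono) auto
      then have "z \<le> pi / 3" using z(2) by linarith
      then have "cos (pi/3) \<le> cos z"
        using z t by (intro cos_monotone_0_pi_le) auto
      then have "1/2 \<le> cos z" by (simp add: cos_60)
      then have "pi * t * (1/2) \<le> pi * t * cos z" using t by (intro mult_left_mono) auto
      moreover have "2 * t \<le> pi * t" using pi_ge_two t by (intro mult_right_mono) auto
      moreover have "sin (pi * t) = pi * t * cos z" using z(3) by simp
      ultimately show ?thesis by linarith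
    qed simp
  next
    case False
    have "sin (pi/3) \<le> sin (pi * t)"
      using False t by (intro sin_monotone_2pi_le) (auto simp: field_simps)
    moreover have "1 \<le> sqrt 3" by simp
    ultimately have "1/2 \<le> sin (pi * t)" unfolding sin_60 by linarith
    then show ?thesis using t by simp
  qed
  from pos[of t] pos[of "- t"] assms show ?thesis by (cases "t \<ge> 0") auto
qed

text \<open>Replaces the distance in a Lipschitz bound by squared sines, which are trigonometric
  polynomials and integrate exactly against the kernel. The summand \<open>2 * e\<close> pays for
  passing from absolute values to squares.\<close>

lemma periodic_osc:
  assumes p: "periodic h" and L: "\<And>x y. norm (h x - h y) \<le> L * norm (x - y)" and e: "e > 0" and L0: "L \<ge> 0"
  shows "norm (h y - h x) \<le> 2 * e + L\<^sup>2 / e * ((sin (pi * (x - y)$1))\<^sup>2 + (sin (pi * (x - y)$2))\<^sup>2)"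
proof -
  \<comment> \<open>Rounding selects the lattice translate of \<open>y\<close> whose coordinates
    differ from those of \<open>x\<close> by at most one half, where the sine dominates.\<close>
  define n1 n2 where "n1 = round (x$1 - y$1)" and "n2 = round (x$2 - y$2)"
  define z where "z = y + axis 1 (of_int n1) + axis 2 (of_int n2)"
  have z: "h z = h y" unfolding z_def by (simp only: periodic_of_int[OF p])
  have zc: "(x - z)$1 = x$1 - y$1 - of_int n1" "(x - z)$2 = x$2 - y$2 - of_int n2"
    by (auto simp: z_def axis_def)
  have t: "\<bar>(x - z)$1\<bar> \<le> 1/2" "\<bar>(x - z)$2\<bar> \<le> 1/2"
    unfolding zc n1_def n2_def
    using of_int_round_abs_le[of "x$1 - y$1"] of_int_round_abs_le[of "x$2 - y$2"] by (auto simp: abs_minus_commute)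
  have per: "(sin (pi * (s - of_int n)))\<^sup>2 = (sin (pi * s))\<^sup>2" for s n
    by (simp add: right_diff_distrib sin_diff power_mult_distrib)
  have sq: "L * \<bar>s\<bar> \<le> e + L\<^sup>2 / e * s\<^sup>2" for s
  proof -
    have "0 \<le> (L * \<bar>s\<bar> - e)\<^sup>2" by simp
    then have "2 * (L * \<bar>s\<bar>) * e \<le> (L * \<bar>s\<bar>)\<^sup>2 + e\<^sup>2" by (simp add: power2_diff algebra_simps)
    moreover have "0 \<le> (L * \<bar>s\<bar>) * e" using L0 e by simp
    ultimately have "(L * \<bar>s\<bar>) * e \<le> L\<^sup>2 * s\<^sup>2 + e * e" by (simp add: power_mult_distrib power2_eq_square[of e])
    then show ?thesis using e by (simp add: field_simps)
  qed
  have "norm (h y - h x) \<le> L * norm (x - z)"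
    using L[of x z] by (simp add: z norm_minus_commute)
  also have "\<dots> \<le> L * (\<bar>(x - z)$1\<bar> + \<bar>(x - z)$2\<bar>)"
    using norm_le_l1_cart[of "x - z"] L0 by (intro mult_left_mono) (auto simp: sum_2)
  also have "\<dots> \<le> L * \<bar>sin (pi * (x - z)$1)\<bar> + L * \<bar>sin (pi * (x - z)$2)\<bar>"
    using abs_le_abs_sin[OF t(1)] abs_le_abs_sin[OF t(2)] L0 by (simp add: distrib_left add_mono mult_left_mono)
  also have "\<dots> \<le> (e + L\<^sup>2 / e * (sin (pi * (x - z)$1))\<^sup>2) + (e + L\<^sup>2 / e * (sin (pi * (x - z)$2))\<^sup>2)"
    by (intro add_mono sq)
  finally show ?thesis
    unfolding zc per by (simp add: algebra_simps)
qed

section \<open>Fourier coefficients and approximation by convolution with the kernel\<close>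

definition fc :: "(real^2 \<Rightarrow> complex) \<Rightarrow> int \<Rightarrow> int \<Rightarrow> complex" where
  "fc h a b = integral usquare (\<lambda>y. h y * ee (- a) (- b) y)"

text \<open>The index is the frequency shifted by \<open>m\<close>, to fit natural numbers. The
  normalisation gives frequency zero the weight one.\<close>

definition kco :: "nat \<Rightarrow> nat \<times> nat \<Rightarrow> complex" where
  "kco m p = complex_of_real (of_nat (2 * m choose fst p) * of_nat (2 * m choose snd p) / (4 ^ m * 4 ^ m) / (cbin m * cbin m))"

text \<open>The convolution with the normalised kernel, written as a trigonometric polynomial so
  that differential operators act, and can be inverted, term by term.\<close>

definition trig_approx :: "nat \<Rightarrow> (real^2 \<Rightarrow> complex) \<Rightarrow> real^2 \<Rightarrow> complex" where
  "trig_approx m h x = (\<Sum>p\<in>{..2*m}\<times>{..2*m}.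
     kco m p * fc h (int (fst p) - int m) (int (snd p) - int m) * ee (int (fst p) - int m) (int (snd p) - int m) x)"

lemma fc_pd:
  assumes h: "tsmooth h"
  shows "fc (pd 1 h) a b = 2 * pi * \<i> * of_int a * fc h a b" "fc (pd 2 h) a b = 2 * pi * \<i> * of_int b * fc h a b"
proof -
  have 0: "fc (pd i h) a b = - integral usquare (\<lambda>y. h y * pd i (ee (- a) (- b)) y)" for i
  proof -
    have "0 = integral usquare (pd i (\<lambda>y. h y * ee (- a) (- b) y))"
      by (rule integral_pd[symmetric]) (intro tsmooth_intros h)
    also have "pd i (\<lambda>y. h y * ee (- a) (- b) y) = (\<lambda>y. pd i h y * ee (- a) (- b) y + h y * pd i (ee (- a) (- b)) y)"
      by (rule ext, subst pd_mult) (auto intro!: tsmooth_differentiable h tsmooth_ee)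
    also have "integral usquare \<dots> = fc (pd i h) a b + integral usquare (\<lambda>y. h y * pd i (ee (- a) (- b)) y)"
      unfolding fc_def
      by (rule Henstock_Kurzweil_Integration.integral_add) (intro integrable_usquare tsmooth_intros h)+
    finally show ?thesis by (simp add: eq_neg_iff_add_eq_0)
  qed
  have "integral usquare (\<lambda>y. h y * (c * ee (- a) (- b) y)) = c * fc h a b" for c
    unfolding fc_def
    by (subst integral_cmult[symmetric]) (auto intro!: integrable_usquare tsmooth_intros h simp: mult.left_commute)
  from this[of "- (2 * pi * \<i> * of_int a)"] this[of "- (2 * pi * \<i> * of_int b)"]
  show "fc (pd 1 h) a b = 2 * pi * \<i> * of_int a * fc h a b" "fc (pd 2 h) a b = 2 * pi * \<i> * of_int b * fc h a b"
    unfolding 0 pd_ee by (simp_all add: mult.assoc)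
qed

lemma tsmooth_trig_approx [tsmooth_intros]: "tsmooth (trig_approx m h)"
  unfolding trig_approx_def[abs_def] by (intro tsmooth_intros)

text \<open>On each frequency, differentiating the character and differentiating \<open>h\<close>
  inside the coefficient give the same factor. Convergence for \<open>h\<close> therefore extends to
  all its derivatives.\<close>

lemma pd_trig_approx:
  assumes h: "tsmooth h"
  shows "pd i (trig_approx m h) = trig_approx m (pd i h)"
proof
  fix x
  have "pd i (trig_approx m h) x = (\<Sum>p\<in>{..2*m}\<times>{..2*m}. (kco m p * fc h (int (fst p) - int m) (int (snd p) - int m)) *
      pd i (ee (int (fst p) - int m) (int (snd p) - int m)) x)"
    unfolding trig_approx_def[abs_def]
    by (subst pd_sum) (auto intro!: sum.cong tsmooth_differentiable tsmooth_intros pd_bounded_linear[OF bounded_linear_mult_right])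
  then show "pd i (trig_approx m h) x = trig_approx m (pd i h) x"
    using exhaust_2[of i] unfolding trig_approx_def
    by (auto simp: pd_ee fc_pd[OF h] mult_ac intro!: sum.cong)
qed

lemma pds_trig_approx: "tsmooth h \<Longrightarrow> pds w (trig_approx m h) = trig_approx m (pds w h)"
  by (induction w) (auto simp: pd_trig_approx tsmooth_pds)

lemma trig_approx_integral:
  assumes h: "tsmooth h"
  shows "trig_approx m h x = integral usquare (\<lambda>y. h y * complex_of_real (kern m m (x - y) / (cbin m * cbin m)))"
proof -
  have k: "h y * complex_of_real (kern m m (x - y) / (cbin m * cbin m)) =
    (\<Sum>p\<in>{..2*m}\<times>{..2*m}. kco m p * ee (int (fst p) - int m) (int (snd p) - int m) x *
       (h y * ee (- (int (fst p) - int m)) (- (int (snd p) - int m)) y))" for y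
    unfolding of_real_divide kern_ee ee_diff
    by (auto simp: kco_def sum_distrib_left sum_distrib_right sum_divide_distrib case_prod_unfold mult_ac intro!: sum.cong)
  let ?e = "\<lambda>p. ee (int (fst p) - int m) (int (snd p) - int m)"
  let ?f = "\<lambda>p. ee (- (int (fst p) - int m)) (- (int (snd p) - int m))"
  have "integral usquare (\<lambda>y. h y * complex_of_real (kern m m (x - y) / (cbin m * cbin m)))
    = integral usquare (\<lambda>y. \<Sum>p\<in>{..2*m}\<times>{..2*m}. kco m p * ?e p x * (h y * ?f p y))"
    by (rule arg_cong[where f = "integral usquare"], rule ext, rule k)
  also have "\<dots> = (\<Sum>p\<in>{..2*m}\<times>{..2*m}. integral usquare (\<lambda>y. kco m p * ?e p x * (h y * ?f p y)))"
    by (rule Henstock_Kurzweil_Integration.integral_sum) (auto intro!: integrable_usquare tsmooth_intros h)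
  also have "\<dots> = (\<Sum>p\<in>{..2*m}\<times>{..2*m}. kco m p * ?e p x * integral usquare (\<lambda>y. h y * ?f p y))"
    by (intro sum.cong refl integral_cmult integrable_usquare tsmooth_intros h)
  also have "\<dots> = trig_approx m h x"
    unfolding trig_approx_def fc_def by (intro sum.cong refl) (simp only: mult_ac)
  finally show ?thesis by (rule sym)
qed

text \<open>An average of \<open>h y - h x\<close> against a nonnegative kernel of mass one is
  bounded by the average of \<open>periodic_osc\<close>. As in Chebyshev's inequality, only the
  second moments of the kernel enter.\<close>

lemma trig_approx_error:
  assumes h: "tsmooth h" and L: "\<And>x y. norm (h x - h y) \<le> L * norm (x - y)" and e: "e > 0" and L0: "L \<ge> 0"
  shows "norm (trig_approx m h x - h x) \<le> 2 * e + L\<^sup>2 / e / (m + 1)"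
proof -
  define c where "c = cbin m * cbin m"
  have c: "c > 0" by (simp add: c_def cbin_pos)
  have ck: "continuous_on usquare (\<lambda>y. kern m n (x - y))" for m n
    by (rule continuous_on_subset[OF continuous_kern]) simp
  have ckc: "continuous_on usquare (\<lambda>y. complex_of_real (kern m m (x - y) / c))"
    by (intro continuous_on_of_real continuous_on_divide ck continuous_on_const) (use c in simp)
  note ch = tsmooth_continuous[OF h]
  have one: "integral usquare (\<lambda>y. h x * complex_of_real (kern m m (x - y) / c)) = h x"
  proof -
    have i: "(\<lambda>y. complex_of_real (kern m m (x - y))) integrable_on usquare"
      by (intro integrable_continuous continuous_intros ck)
    have "integral usquare (\<lambda>y. h x * complex_of_real (kern m m (x - y) / c)) =
      integral usquare (\<lambda>y. h x / c * complex_of_real (kern m m (x - y)))" by simp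
    also have "\<dots> = h x"
      unfolding integral_cmult[OF i] integral_kern_complex using cbin_pos[of m] by (simp add: c_def)
    finally show ?thesis .
  qed
  have "trig_approx m h x - h x = integral usquare (\<lambda>y. h y * complex_of_real (kern m m (x - y) / c))
      - integral usquare (\<lambda>y. h x * complex_of_real (kern m m (x - y) / c))"
    using one trig_approx_integral[OF h, of m x] by (simp add: c_def)
  also have "\<dots> = integral usquare (\<lambda>y. h y * complex_of_real (kern m m (x - y) / c) - h x * complex_of_real (kern m m (x - y) / c))"
    by (rule Henstock_Kurzweil_Integration.integral_diff[symmetric])
      (intro integrable_continuous continuous_on_mult continuous_on_const ckc ch)+
  \<comment> \<open>Replacing each squared sine by one minus a squared cosine turns the majorant
    into a combination of kernels, whose integrals are known.\<close>
  also have "norm \<dots> \<le> integral usquare (\<lambda>y. ((2 * e + 2 * (L\<^sup>2 / e)) / c) * kern m m (x - y)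
     - (L\<^sup>2 / e / c) * (kern (Suc m) m (x - y) + kern m (Suc m) (x - y)))"
  proof (rule Henstock_Kurzweil_Integration.integral_norm_bound_integral)
    fix y
    define s where "s = (sin (pi * (x - y)$1))\<^sup>2 + (sin (pi * (x - y)$2))\<^sup>2"
    have "norm (h y * complex_of_real (kern m m (x - y) / c) - h x * complex_of_real (kern m m (x - y) / c))
      = norm (h y - h x) * (kern m m (x - y) / c)"
      unfolding left_diff_distrib[symmetric] norm_mult norm_of_real using c kern_nonneg[of m m "x - y"] by simp
    also have "\<dots> \<le> (2 * e + L\<^sup>2 / e * s) * (kern m m (x - y) / c)"
      unfolding s_def using c kern_nonneg[of m m "x - y"]
      by (intro mult_right_mono periodic_osc[OF tsmooth_periodic[OF h] L e L0]) auto
    also have "s * kern m m (x - y) = 2 * kern m m (x - y) - (kern (Suc m) m (x - y) + kern m (Suc m) (x - y))"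
    proof -
      have "s = 2 - (cos (pi * (x - y)$1))\<^sup>2 - (cos (pi * (x - y)$2))\<^sup>2"
        by (simp add: s_def sin_squared_eq)
      moreover have "kern (Suc m) m (x - y) = (cos (pi * (x - y)$1))\<^sup>2 * kern m m (x - y)"
        "kern m (Suc m) (x - y) = (cos (pi * (x - y)$2))\<^sup>2 * kern m m (x - y)"
        by (simp_all add: kern_def power2_eq_square)
      ultimately show ?thesis by algebra
    qed
    then have "(2 * e + L\<^sup>2 / e * s) * (kern m m (x - y) / c) = ((2 * e + 2 * (L\<^sup>2 / e)) / c) * kern m m (x - y)
     - (L\<^sup>2 / e / c) * (kern (Suc m) m (x - y) + kern m (Suc m) (x - y))"
    proof -
      assume sk: "s * kern m m (x - y) = 2 * kern m m (x - y) - (kern (Suc m) m (x - y) + kern m (Suc m) (x - y))"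
      have "(2 * e + L\<^sup>2 / e * s) * (kern m m (x - y) / c) = 2 * e / c * kern m m (x - y) + L\<^sup>2 / e / c * (s * kern m m (x - y))"
        using c e by (simp add: field_simps)
      then show ?thesis
        unfolding sk by (simp add: add_divide_distrib distrib_right right_diff_distrib)
    qed
    finally show "norm (h y * complex_of_real (kern m m (x - y) / c) - h x * complex_of_real (kern m m (x - y) / c))
      \<le> ((2 * e + 2 * (L\<^sup>2 / e)) / c) * kern m m (x - y)
     - (L\<^sup>2 / e / c) * (kern (Suc m) m (x - y) + kern m (Suc m) (x - y))" .
  qed (intro integrable_continuous continuous_on_add continuous_on_diff continuous_on_mult continuous_on_const ck ckc ch)+
  also have "\<dots> = ((2 * e + 2 * (L\<^sup>2 / e)) / c) * c
     - (L\<^sup>2 / e / c) * (cbin (Suc m) * cbin m + cbin m * cbin (Suc m))"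
  proof -
    have i: "(\<lambda>y. kern m n (x - y)) integrable_on usquare" for m n
      by (intro integrable_continuous ck)
    have "integral usquare (\<lambda>y. a * kern m m (x - y) - b * (kern (Suc m) m (x - y) + kern m (Suc m) (x - y)))
       = a * c - b * (cbin (Suc m) * cbin m + cbin m * cbin (Suc m))" for a b
      by (simp add: Henstock_Kurzweil_Integration.integral_diff Henstock_Kurzweil_Integration.integral_add
        i integrable_on_mult_right Henstock_Kurzweil_Integration.integrable_add integral_kern c_def)
    then show ?thesis .
  qed
  \<comment> \<open>Each of the two coordinates contributes a second moment
    \<open>1 / (2 * m + 2)\<close>.\<close>
  also have "\<dots> = 2 * e + L\<^sup>2 / e / (m + 1)"
  proof -
    define r where "r = 1 / (2 * real m + 2)"
    have r: "2 * r = 1 / (real m + 1)" by (simp add: r_def field_simps)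
    have 1: "cbin (Suc m) * cbin m = c * (1 - r)" "cbin m * cbin (Suc m) = c * (1 - r)"
      unfolding cbin_Suc c_def r_def by simp_all
    have "(2 * e + 2 * B) / c * c - B / c * (c * (1 - r) + c * (1 - r)) = 2 * e + B * (2 * r)" for B
      using c by (simp add: field_simps)
    from this[of "L\<^sup>2 / e"] show ?thesis unfolding 1 r by (simp only: of_nat_add of_nat_1 times_divide_eq_right mult_1_right)
  qed
  finally show ?thesis .
qed

lemma trig_approx_uniform:
  assumes h: "tsmooth h"
  shows "uniform_limit UNIV (\<lambda>m. trig_approx m h) h sequentially"
proof (rule uniform_limitI)
  fix r :: real assume r: "r > 0"
  obtain C1 where C1: "C1 \<ge> 0" "\<And>x. norm (pd 1 h x) \<le> C1" using tsmooth_bounded[OF tsmooth_pd[OF h]] by metis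
  obtain C2 where C2: "C2 \<ge> 0" "\<And>x. norm (pd 2 h x) \<le> C2" using tsmooth_bounded[OF tsmooth_pd[OF h]] by metis
  define L where "L = 2 * (C1 + C2)"
  have "norm (pd i h x) \<le> C1 + C2" for i x
    using C1 C2 exhaust_2[of i] by (auto intro: add_increasing add_increasing2)
  from lipschitz_pd[OF tsmooth_differentiable[OF h] this]
  have L: "norm (h x - h y) \<le> L * norm (x - y)" for x y unfolding L_def .
  have L0: "L \<ge> 0" using C1 C2 by (simp add: L_def)
  have "(\<lambda>m. 2 * (r/4) + L\<^sup>2 / (r/4) / (real m + 1)) \<longlonglongrightarrow> 2 * (r/4) + 0"
    by (intro tendsto_intros real_tendsto_divide_at_top[OF tendsto_const]
      filterlim_at_top_mono[OF filterlim_real_sequentially]) auto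
  then have "eventually (\<lambda>m. 2 * (r/4) + L\<^sup>2 / (r/4) / (real m + 1) < r) sequentially"
    by (rule order_tendstoD(2)) (use r in simp)
  then show "eventually (\<lambda>m. \<forall>x\<in>UNIV. dist (trig_approx m h x) (h x) < r) sequentially"
  proof eventually_elim
    case (elim m)
    show ?case
    proof (intro ballI)
      fix x
      have "norm (trig_approx m h x - h x) \<le> 2 * (r/4) + L\<^sup>2 / (r/4) / (real m + 1)"
        using trig_approx_error[OF h L, of "r/4" m x] r L0 by (simp add: add.commute)
      then show "dist (trig_approx m h x) (h x) < r"
        using elim unfolding dist_norm by linarith
    qed
  qed
qed

subsection \<open>Solving the flat Cauchy-Riemann equation\<close>

text \<open>Division by the symbol of \<open>dbar\<close>, which vanishes at frequency zero only;
  that frequency is left out. Subtracting 1 from each character makes the solution vanish at the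
  origin, as \<open>dbar_control\<close> demands.\<close>

definition trig_solution :: "nat \<Rightarrow> (real^2 \<Rightarrow> complex) \<Rightarrow> real^2 \<Rightarrow> complex" where
  "trig_solution m h x = (\<Sum>p\<in>{..2*m}\<times>{..2*m} - {(m, m)}.
     kco m p * fc h (int (fst p) - int m) (int (snd p) - int m)
       / (pi * \<i> * Complex (of_int (int (fst p) - int m)) (of_int (int (snd p) - int m)))
     * (ee (int (fst p) - int m) (int (snd p) - int m) x - 1))"

lemma tsmooth_trig_solution [tsmooth_intros]: "tsmooth (trig_solution m h)"
  unfolding trig_solution_def[abs_def] by (intro tsmooth_intros)

lemma dbar_sum:
  assumes "\<And>p. p \<in> S \<Longrightarrow> tsmooth (f p)"
  shows "dbar (\<lambda>x. \<Sum>p\<in>S. f p x) x = (\<Sum>p\<in>S. dbar (f p) x)"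
  unfolding dbar_def
  by (simp add: pd_sum tsmooth_differentiable assms sum.distrib sum_distrib_left flip: sum_divide_distrib)

lemma dbar_ee: "dbar (\<lambda>x. c * (ee a b x - 1)) x = c * (pi * \<i> * Complex (of_int a) (of_int b)) * ee a b x"
proof -
  have "pd i (\<lambda>x. c * (ee a b x - 1)) x = c * pd i (ee a b) x" for i
  proof -
    have "pd i (\<lambda>x. c * (ee a b x - 1)) x = c * pd i (\<lambda>x. ee a b x - 1) x"
      by (rule pd_bounded_linear[OF bounded_linear_mult_right]) (intro tsmooth_differentiable tsmooth_intros)
    then show ?thesis by (simp add: pd_diff tsmooth_differentiable tsmooth_ee tsmooth_const)
  qed
  then show ?thesis
    by (simp add: dbar_def pd_ee Complex_eq field_simps)
qed

lemma dbar_trig_solution: "dbar (trig_solution m h) x = trig_approx m h x - integral usquare h"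
proof -
  have "dbar (trig_solution m h) x = (\<Sum>p\<in>{..2*m}\<times>{..2*m} - {(m, m)}.
     kco m p * fc h (int (fst p) - int m) (int (snd p) - int m) * ee (int (fst p) - int m) (int (snd p) - int m) x)"
    unfolding trig_solution_def[abs_def]
  proof (subst dbar_sum, goal_cases)
    case 2
    show ?case
    proof (intro sum.cong refl)
      fix p assume p: "p \<in> {..2*m}\<times>{..2*m} - {(m, m)}"
      then have "Complex (of_int (int (fst p) - int m)) (of_int (int (snd p) - int m)) \<noteq> 0"
        by (cases p) (auto simp: complex_eq_iff)
      then show "dbar (\<lambda>x. kco m p * fc h (int (fst p) - int m) (int (snd p) - int m)
       / (pi * \<i> * Complex (of_int (int (fst p) - int m)) (of_int (int (snd p) - int m)))
        * (ee (int (fst p) - int m) (int (snd p) - int m) x - 1)) x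
        = kco m p * fc h (int (fst p) - int m) (int (snd p) - int m) * ee (int (fst p) - int m) (int (snd p) - int m) x"
        unfolding dbar_ee by simp
    qed
  qed (intro tsmooth_intros)
  also have "\<dots> = trig_approx m h x - kco m (m, m) * fc h 0 0"
    unfolding trig_approx_def by (subst sum_diff1) auto
  also have "kco m (m, m) = 1"
    using cbin_pos[of m] by (simp add: kco_def cbin_def)
  finally show ?thesis by (simp add: fc_def)
qed

lemma dbar_diff:
  assumes "tsmooth u" "tsmooth v"
  shows "dbar (\<lambda>x. u x - v x) = (\<lambda>x. dbar u x - dbar v x)"
  by (auto simp: dbar_def[abs_def] pd_diff tsmooth_differentiable assms field_simps)

lemma uniformly_Cauchy_onI_sq:
  assumes "\<And>e::real. e > 0 \<Longrightarrow> \<exists>M. \<forall>m\<ge>M. \<forall>n\<ge>M. \<forall>x. (norm (U m x - U n x))\<^sup>2 \<le> e"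
  shows "uniformly_Cauchy_on UNIV U"
proof (rule uniformly_Cauchy_onI)
  fix e :: real assume e: "e > 0"
  then obtain M where "\<forall>m\<ge>M. \<forall>n\<ge>M. \<forall>x. (norm (U m x - U n x))\<^sup>2 \<le> (e/2)\<^sup>2"
    using assms[of "(e/2)\<^sup>2"] by auto
  then have "\<forall>m\<ge>M. \<forall>n\<ge>M. \<forall>x. norm (U m x - U n x) \<le> e/2"
    using e by (auto intro: power2_le_imp_le)
  then show "\<exists>M. \<forall>x\<in>UNIV. \<forall>m\<ge>M. \<forall>n\<ge>M. dist (U m x) (U n x) < e"
    using e unfolding dist_norm by (metis half_gt_zero_iff le_less_trans field_sum_of_halves less_add_same_cancel1)
qed

text \<open>The equation is solved exactly for the trigonometric approximations of \<open>h\<close>.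
  These converge with all derivatives, so \<open>dbar_control\<close> makes the solutions Cauchy in
  every derivative.\<close>

lemma dbar_solvable:
  assumes h: "tsmooth h"
  obtains u where "tsmooth u" "u 0 = 0" "\<And>x. dbar u x = h x - integral usquare h"
proof -
  let ?U = "\<lambda>m. trig_solution m h"
  have U0: "?U m 0 = 0" for m by (simp add: trig_solution_def)
  have cau: "uniformly_Cauchy_on UNIV (\<lambda>m. pds w (?U m))" for w
  proof (rule uniformly_Cauchy_onI_sq)
    fix e :: real assume e: "e > 0"
    obtain V where V: "finite V" "\<And>u e x. tsmooth u \<Longrightarrow> u 0 = 0 \<Longrightarrow> (\<And>v. v \<in> V \<Longrightarrow> L2sq (pds v (dbar u)) \<le> e)
      \<Longrightarrow> (norm (pds w u x))\<^sup>2 \<le> 1024 * e" using dbar_control[of w] by metis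
    \<comment> \<open>Chosen so that the constant 1024 of \<open>dbar_control\<close> turns
      \<open>r\<close> squared into \<open>e\<close>.\<close>
    define r where "r = sqrt (e / 1024)"
    have r: "r > 0" "r\<^sup>2 = e / 1024" using e by (auto simp: r_def)
    have "\<forall>v\<in>V. eventually (\<lambda>m. \<forall>x\<in>UNIV. dist (trig_approx m (pds v h) x) (pds v h x) < r/2) sequentially"
      using trig_approx_uniform[OF tsmooth_pds[OF h]] r(1) unfolding uniform_limit_iff by (meson half_gt_zero)
    then have "eventually (\<lambda>m. \<forall>v\<in>V. \<forall>x\<in>UNIV. dist (trig_approx m (pds v h) x) (pds v h x) < r/2) sequentially"
      using V(1) by (simp add: eventually_ball_finite)
    then obtain M where M: "\<And>m v x. m \<ge> M \<Longrightarrow> v \<in> V \<Longrightarrow> dist (trig_approx m (pds v h) x) (pds v h x) < r/2"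
      unfolding eventually_sequentially by auto
    show "\<exists>M. \<forall>m\<ge>M. \<forall>n\<ge>M. \<forall>x. (norm (pds w (?U m) x - pds w (?U n) x))\<^sup>2 \<le> e"
    proof (intro exI allI impI)
      fix m n x assume mn: "m \<ge> M" "n \<ge> M"
      have "(norm (pds w (\<lambda>x. ?U m x - ?U n x) x))\<^sup>2 \<le> 1024 * r\<^sup>2"
      proof (rule V(2))
        show "tsmooth (\<lambda>x. ?U m x - ?U n x)" by (intro tsmooth_intros)
        show "?U m 0 - ?U n 0 = 0" by (simp add: U0)
        fix v assume v: "v \<in> V"
        have "dbar (\<lambda>x. ?U m x - ?U n x) = (\<lambda>x. trig_approx m h x - trig_approx n h x)"
          by (auto simp: dbar_diff tsmooth_trig_solution dbar_trig_solution)
        then have "pds v (dbar (\<lambda>x. ?U m x - ?U n x)) = (\<lambda>x. trig_approx m (pds v h) x - trig_approx n (pds v h) x)"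
          by (simp add: pds_diff tsmooth_smooth tsmooth_trig_approx pds_trig_approx h)
        moreover have "norm (trig_approx m (pds v h) x - trig_approx n (pds v h) x) \<le> r" for x
          using M[OF mn(1) v, of x] M[OF mn(2) v, of x] dist_triangle_half_l unfolding dist_norm[symmetric]
          by (metis less_imp_le)
        ultimately show "L2sq (pds v (dbar (\<lambda>x. ?U m x - ?U n x))) \<le> r\<^sup>2"
          by (simp add: L2sq_le_sup tsmooth_diff tsmooth_trig_approx)
      qed
      then show "(norm (pds w (?U m) x - pds w (?U n) x))\<^sup>2 \<le> e"
        by (simp add: r pds_diff tsmooth_smooth tsmooth_trig_solution)
    qed
  qed
  obtain u where u: "tsmooth u" "\<And>w. uniform_limit UNIV (\<lambda>m. pds w (?U m)) (pds w u) sequentially"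
    using tsmooth_limit[of ?U, OF tsmooth_trig_solution cau] by metis
  have lim: "(\<lambda>m. pds w (?U m) x) \<longlonglongrightarrow> pds w u x" for w x
    using tendsto_uniform_limitI[OF u(2)] by simp
  show thesis
  proof
    show "tsmooth u" by (rule u)
    show "u 0 = 0" using lim[of "[]" 0] by (simp add: U0 LIMSEQ_const_iff)
    fix x
    have "(\<lambda>m. dbar (?U m) x) \<longlonglongrightarrow> dbar u x"
      using lim[of "[1]" x] lim[of "[2]" x] unfolding dbar_def by (auto intro!: tendsto_intros)
    moreover have "(\<lambda>m. dbar (?U m) x) \<longlonglongrightarrow> h x - integral usquare h"
      unfolding dbar_trig_solution
      using tendsto_uniform_limitI[OF trig_approx_uniform[OF h], of x] by (intro tendsto_intros) auto
    ultimately show "dbar u x = h x - integral usquare h" by (rule LIMSEQ_unique)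
  qed
qed

subsection \<open>The Beltrami equation on the torus\<close>

definition dbar_inv :: "(real^2 \<Rightarrow> complex) \<Rightarrow> real^2 \<Rightarrow> complex" where
  "dbar_inv h = (SOME u. tsmooth u \<and> u 0 = 0 \<and> (\<forall>x. dbar u x = h x - integral usquare h))"

lemma dbar_inv:
  assumes "tsmooth h"
  shows "tsmooth (dbar_inv h)" "dbar_inv h 0 = 0" "dbar (dbar_inv h) = (\<lambda>x. h x - integral usquare h)"
proof -
  have "\<exists>u. tsmooth u \<and> u 0 = 0 \<and> (\<forall>x. dbar u x = h x - integral usquare h)"
    using dbar_solvable[OF assms] by metis
  from someI_ex[OF this, folded dbar_inv_def]
  show "tsmooth (dbar_inv h)" "dbar_inv h 0 = 0" "dbar (dbar_inv h) = (\<lambda>x. h x - integral usquare h)"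
    by auto
qed

text \<open>Removing the mean is a projection, and derivatives of positive order do not see
  it.\<close>

lemma L2sq_pds_dbar_inv:
  assumes h: "tsmooth h"
  shows "L2sq (pds w (dbar (dbar_inv h))) \<le> L2sq (pds w h)"
proof (cases "w = []")
  case True
  then show ?thesis using L2sq_diff_mean[OF h] by (simp add: dbar_inv[OF h])
next
  case False
  have "pds w (\<lambda>x. h x - integral usquare h) = pds w h"
    using False by (simp add: pds_diff tsmooth_smooth h smooth_map_const pds_const)
  then show ?thesis by (simp add: dbar_inv[OF h])
qed

text \<open>One rate \<open>\<theta>\<close> for all orders, with a constant that may depend on the
  word. The inequality for the length is strict, so order 0 is vacuous and starts an
  induction.\<close>

definition decays :: "real \<Rightarrow> nat \<Rightarrow> (nat \<Rightarrow> real^2 \<Rightarrow> complex) \<Rightarrow> bool" where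
  "decays \<theta> k g \<longleftrightarrow> (\<forall>w. length w < k \<longrightarrow> (\<exists>C. \<forall>n. L2sq (pds w (g n)) \<le> C * \<theta> ^ n))"

lemma decays_pd: "decays \<theta> (Suc k) g \<Longrightarrow> decays \<theta> k (\<lambda>n. pd i (g n))"
  unfolding decays_def
proof (intro allI impI)
  fix w :: "2 list"
  assume "\<forall>w. length w < Suc k \<longrightarrow> (\<exists>C. \<forall>n. L2sq (pds w (g n)) \<le> C * \<theta> ^ n)" "length w < k"
  from this(1)[rule_format, of "w @ [i]"] this(2)
  show "\<exists>C. \<forall>n. L2sq (pds w (pd i (g n))) \<le> C * \<theta> ^ n"
    by (simp add: pds_append)
qed

lemma decay_add:
  assumes "\<And>n. tsmooth (u n)" "\<And>n. tsmooth (v n)"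
    and "\<exists>C. \<forall>n. L2sq (u n) \<le> C * \<theta> ^ n" "\<exists>C. \<forall>n. L2sq (v n) \<le> C * \<theta> ^ n"
  shows "\<exists>C. \<forall>n. L2sq (\<lambda>x. u n x + v n x) \<le> C * (\<theta>::real) ^ n"
proof -
  obtain C D where C: "\<And>n. L2sq (u n) \<le> C * \<theta> ^ n" and D: "\<And>n. L2sq (v n) \<le> D * \<theta> ^ n"
    using assms(3,4) by metis
  have "L2sq (\<lambda>x. u n x + v n x) \<le> (2 * C + 2 * D) * \<theta> ^ n" for n
    using L2sq_add[OF assms(1)[of n] assms(2)[of n], of 1] C[of n] D[of n] by (simp add: distrib_right)
  then show ?thesis by blast
qed

lemma decays_mult:
  assumes "\<And>n. tsmooth (g n)" "tsmooth m" "decays \<theta> k g"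
  shows "decays \<theta> k (\<lambda>n x. m x * g n x)"
  using assms
proof (induction k arbitrary: m g)
  case 0
  then show ?case by (simp add: decays_def)
next
  case (Suc k)
  have dk: "decays \<theta> k g" using Suc.prems(3) by (simp add: decays_def)
  show ?case unfolding decays_def
  proof (intro allI impI)
    fix w :: "2 list" assume w: "length w < Suc k"
    show "\<exists>C. \<forall>n. L2sq (pds w (\<lambda>x. m x * g n x)) \<le> C * \<theta> ^ n"
    proof (cases w rule: rev_cases)
      case Nil
      obtain B where B: "\<And>x. norm (m x) \<le> B" using tsmooth_bounded[OF Suc.prems(2)] by metis
      obtain C where C: "\<And>n. L2sq (g n) \<le> C * \<theta> ^ n"
        using Suc.prems(3) unfolding decays_def by (metis length_0_conv pds.simps(1) zero_less_Suc)
      have "L2sq (\<lambda>x. m x * g n x) \<le> (B\<^sup>2 * C) * \<theta> ^ n" for n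
      proof -
        have "L2sq (\<lambda>x. m x * g n x) \<le> B\<^sup>2 * L2sq (g n)"
          by (rule L2sq_mult[OF Suc.prems(2) Suc.prems(1) B])
        also have "\<dots> \<le> B\<^sup>2 * (C * \<theta> ^ n)" by (intro mult_left_mono C) auto
        finally show ?thesis by (simp add: mult.assoc)
      qed
      then show ?thesis using Nil by auto
    next
      case (snoc w' i)
      have e: "pds w (\<lambda>x. m x * g n x) = (\<lambda>x. pds w' (\<lambda>x. m x * pd i (g n) x) x + pds w' (\<lambda>x. pd i m x * g n x) x)" for n
      proof -
        have "pd i (\<lambda>x. m x * g n x) = (\<lambda>x. m x * pd i (g n) x + pd i m x * g n x)"
          by (rule ext, rule pd_mult) (intro tsmooth_differentiable Suc.prems)+
        then show ?thesis
          unfolding snoc pds_append by (simp add: pds_add tsmooth_smooth tsmooth_mult tsmooth_pd Suc.prems)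
      qed
      have "decays \<theta> k (\<lambda>n x. m x * pd i (g n) x)" "decays \<theta> k (\<lambda>n x. pd i m x * g n x)"
        by (intro Suc.IH tsmooth_pd Suc.prems decays_pd dk)+
      then show ?thesis unfolding e
        using w snoc by (intro decay_add tsmooth_intros Suc.prems) (auto simp: decays_def)
    qed
  qed
qed

text \<open>The commutator with a multiplication involves derivatives of lower order only.\<close>

lemma decay_commutator:
  assumes "\<And>n. tsmooth (g n)" "tsmooth m" "decays \<theta> (length w) g"
  shows "\<exists>C. \<forall>n. L2sq (\<lambda>x. pds w (\<lambda>x. m x * g n x) x - m x * pds w (g n) x) \<le> C * \<theta> ^ n"
  using assms
proof (induction w arbitrary: g rule: rev_induct)
  case Nil
  then show ?case by (auto simp: L2sq_def intro!: exI[of _ 0])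
next
  case (snoc i w)
  have e: "(\<lambda>x. pds (w @ [i]) (\<lambda>x. m x * g n x) x - m x * pds (w @ [i]) (g n) x)
    = (\<lambda>x. pds w (\<lambda>x. pd i m x * g n x) x + (pds w (\<lambda>x. m x * pd i (g n) x) x - m x * pds w (pd i (g n)) x))" for n
  proof -
    have "pd i (\<lambda>x. m x * g n x) = (\<lambda>x. m x * pd i (g n) x + pd i m x * g n x)"
      by (rule ext, rule pd_mult) (intro tsmooth_differentiable snoc.prems)+
    then show ?thesis
      unfolding pds_append
      by (simp add: pds_add tsmooth_smooth tsmooth_mult tsmooth_pd snoc.prems algebra_simps)
  qed
  have "decays \<theta> (Suc (length w)) (\<lambda>n x. pd i m x * g n x)"
    using snoc.prems by (intro decays_mult tsmooth_pd) auto
  then have 1: "\<exists>C. \<forall>n. L2sq (pds w (\<lambda>x. pd i m x * g n x)) \<le> C * \<theta> ^ n"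
    by (auto simp: decays_def)
  have 2: "\<exists>C. \<forall>n. L2sq (\<lambda>x. pds w (\<lambda>x. m x * pd i (g n) x) x - m x * pds w (pd i (g n)) x) \<le> C * \<theta> ^ n"
    using snoc.prems by (intro snoc.IH tsmooth_pd decays_pd) auto
  show ?case unfolding e
    by (rule decay_add[OF _ _ 1 2]) (intro tsmooth_intros snoc.prems)+
qed

text \<open>The forcing term decays at a slower rate than the contraction, so the solution follows
  the forcing term.\<close>

lemma geometric_recursion:
  fixes a :: "nat \<Rightarrow> real"
  assumes "\<And>n. a (Suc n) \<le> p * a n + C * \<theta> ^ n" "0 \<le> p" "p < \<theta>"
  shows "\<exists>D. \<forall>n. a n \<le> D * \<theta> ^ n"
proof -
  \<comment> \<open>The second entry is the fixed point of the recursion for the constants,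
    \<open>p * D + C = D * \<theta>\<close>.\<close>
  define D where "D = max (a 0) (C / (\<theta> - p))"
  have D: "p * D + C \<le> D * \<theta>"
  proof -
    have "C / (\<theta> - p) \<le> D" by (simp add: D_def)
    then have "C \<le> D * (\<theta> - p)" using assms(3) by (simp add: field_simps)
    then show ?thesis by (simp add: algebra_simps)
  qed
  have "a n \<le> D * \<theta> ^ n" for n
  proof (induction n)
    case 0
    then show ?case by (simp add: D_def)
  next
    case (Suc n)
    have "a (Suc n) \<le> p * (D * \<theta> ^ n) + C * \<theta> ^ n"
      using assms(1)[of n] mult_left_mono[OF Suc assms(2)] by linarith
    also have "\<dots> = (p * D + C) * \<theta> ^ n" by (simp add: algebra_simps)
    also have "\<dots> \<le> (D * \<theta>) * \<theta> ^ n"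
      using assms(2,3) by (intro mult_right_mono D) auto
    finally show ?case by (simp add: mult.assoc)
  qed
  then show ?thesis by blast
qed

text \<open>If \<open>exp s\<close> solves the Beltrami equation, then
  \<open>dbar s = \<mu> * del s + del \<mu>\<close>. With \<open>g\<close> for \<open>dbar s\<close>
  and the Beurling transform \<open>del\<close> after \<open>dbar_inv\<close>, this reads, up to
  means, as a fixed point equation for \<open>g\<close>. These functions are the terms of its
  Neumann series.\<close>

primrec bseq :: "(real^2 \<Rightarrow> complex) \<Rightarrow> nat \<Rightarrow> real^2 \<Rightarrow> complex" where
  "bseq \<mu> 0 = del \<mu>"
| "bseq \<mu> (Suc n) = (\<lambda>x. \<mu> x * del (dbar_inv (bseq \<mu> n)) x)"

lemma tsmooth_bseq [tsmooth_intros]: "tsmooth \<mu> \<Longrightarrow> tsmooth (bseq \<mu> n)"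
  by (induction n) (auto intro!: tsmooth_intros dbar_inv)

text \<open>Induction on the order. At the top order the derivative falls on the Beurling transform,
  which does not increase the norm, and multiplication by \<open>\<mu>\<close> contributes the
  factor \<open>q\<close>. What remains is a commutator of lower order, which decays by induction
  and acts as a forcing term. Hence the rate is the same at every order.\<close>

lemma decays_bseq:
  assumes m: "tsmooth \<mu>" and q: "\<And>x. norm (\<mu> x) \<le> q" and "q < 1"
  obtains \<theta> where "0 < \<theta>" "\<theta> < 1" "\<And>k. decays \<theta> k (bseq \<mu>)"
proof -
  have q0: "q \<ge> 0" using q[of 0] norm_ge_zero order_trans by blast
  have q2: "q\<^sup>2 < 1" using q0 \<open>q < 1\<close> by (simp add: power_less_one_iff)
  \<comment> \<open>With this value \<open>\<theta>\<close> equals \<open>1 - e\<close>, below one,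
    and yet exceeds the contraction factor \<open>p\<close>, since \<open>q\<close> is below
    one.\<close>
  define e where "e = (1 - q\<^sup>2) / 3"
  define \<theta> where "\<theta> = q\<^sup>2 + 2 * e"
  define p where "p = (1 + e) * q\<^sup>2"
  have e: "e > 0" using q2 by (simp add: e_def)
  have "e * q\<^sup>2 < e * 2" using q2 e by (intro mult_strict_left_mono) auto
  then have p: "0 \<le> p" "p < \<theta>" using e by (auto simp: p_def \<theta>_def algebra_simps)
  have "\<theta> = 1 - e" by (simp add: \<theta>_def e_def field_simps)
  then have th: "\<theta> < 1" using e by simp
  have th0: "0 < \<theta>" using e by (simp add: \<theta>_def add_nonneg_pos)
  let ?g = "bseq \<mu>"
  let ?s = "\<lambda>n. dbar_inv (?g n)"
  have g: "tsmooth (?g n)" for n by (rule tsmooth_bseq[OF m])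
  have s: "tsmooth (?s n)" for n by (rule dbar_inv(1)[OF g])
  have le: "L2sq (pds w (del (?s n))) \<le> L2sq (pds w (?g n))" for w n
    using L2sq_pds_dbar_inv[OF g, of w n] L2sq_del[OF tsmooth_pds[OF s], of w n]
    by (simp add: pds_del pds_dbar tsmooth_smooth s)
  have "decays \<theta> k ?g" for k
  proof (induction k)
    case 0
    then show ?case by (simp add: decays_def)
  next
    case (Suc k)
    have dv: "decays \<theta> k (\<lambda>n. del (?s n))"
      using Suc le order_trans unfolding decays_def by meson
    show ?case unfolding decays_def
    proof (intro allI impI)
      fix w :: "2 list" assume "length w < Suc k"
      show "\<exists>C. \<forall>n. L2sq (pds w (?g n)) \<le> C * \<theta> ^ n"
      proof (cases "length w < k")
        case True
        then show ?thesis using Suc by (simp add: decays_def)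
      next
        case False
        then have w: "length w = k" using \<open>length w < Suc k\<close> by simp
        obtain C where C: "\<And>n. L2sq (\<lambda>x. pds w (\<lambda>x. \<mu> x * del (?s n) x) x - \<mu> x * pds w (del (?s n)) x) \<le> C * \<theta> ^ n"
          using decay_commutator[of "\<lambda>n. del (?s n)" \<mu> \<theta> w] dv w m s tsmooth_del by metis
        show ?thesis
        proof (rule geometric_recursion[OF _ p])
          fix n
          have "pds w (?g (Suc n)) = (\<lambda>x. \<mu> x * pds w (del (?s n)) x
              + (pds w (\<lambda>x. \<mu> x * del (?s n) x) x - \<mu> x * pds w (del (?s n)) x))"
            by simp
          then have "L2sq (pds w (?g (Suc n))) \<le> (1 + e) * L2sq (\<lambda>x. \<mu> x * pds w (del (?s n)) x)
              + (1 + 1 / e) * L2sq (\<lambda>x. pds w (\<lambda>x. \<mu> x * del (?s n) x) x - \<mu> x * pds w (del (?s n)) x)"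
            by (simp only:) (intro L2sq_add e tsmooth_intros m s)
          also have "\<dots> \<le> (1 + e) * (q\<^sup>2 * L2sq (pds w (?g n))) + (1 + 1 / e) * (C * \<theta> ^ n)"
          proof (intro add_mono mult_left_mono C)
            have "L2sq (\<lambda>x. \<mu> x * pds w (del (?s n)) x) \<le> q\<^sup>2 * L2sq (pds w (del (?s n)))"
              by (intro L2sq_mult tsmooth_intros m s q)
            also have "\<dots> \<le> q\<^sup>2 * L2sq (pds w (?g n))" by (intro mult_left_mono le) auto
            finally show "L2sq (\<lambda>x. \<mu> x * pds w (del (?s n)) x) \<le> q\<^sup>2 * L2sq (pds w (?g n))" .
          qed (use e in auto)
          finally show "L2sq (pds w (?g (Suc n))) \<le> p * L2sq (pds w (?g n)) + ((1 + 1 / e) * C) * \<theta> ^ n"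
            by (simp only: p_def mult.assoc)
        qed
      qed
    qed
  qed
  then show thesis using that th th0 by blast
qed

text \<open>Passes from squared \<open>L2\<close> norms to pointwise bounds by
  \<open>dbar_control\<close>; the ratio is the square root of \<open>\<theta>\<close> for that
  reason.\<close>

lemma bseq_bounds:
  assumes m: "tsmooth \<mu>" and q: "\<And>x. norm (\<mu> x) \<le> q" and "q < 1"
  obtains r where "0 < r" "r < 1"
    "\<And>w. \<exists>B\<ge>0. \<forall>n x. norm (pds w (dbar_inv (bseq \<mu> n)) x) \<le> B * r ^ n"
    "\<exists>B\<ge>0. \<forall>n. norm (integral usquare (bseq \<mu> n)) \<le> B * r ^ n"
proof -
  obtain \<theta> where th: "0 < \<theta>" "\<theta> < 1" and d: "\<And>k. decays \<theta> k (bseq \<mu>)"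
    using decays_bseq[OF m q \<open>q < 1\<close>] by metis
  define r where "r = sqrt \<theta>"
  have r: "0 < r" "r < 1" using th by (auto simp: r_def)
  have rn: "sqrt (\<theta> ^ n) = r ^ n" for n by (simp add: r_def real_sqrt_power)
  have sq: "norm z \<le> sqrt C * r ^ n" if "(norm z)\<^sup>2 \<le> C * \<theta> ^ n" "C \<ge> 0" for z :: complex and C n
  proof -
    have "norm z \<le> sqrt (C * \<theta> ^ n)" using that(1) by (rule real_le_rsqrt)
    also have "\<dots> = sqrt C * r ^ n" by (simp add: real_sqrt_mult rn)
    finally show ?thesis .
  qed
  have C: "\<exists>C\<ge>0. \<forall>n. L2sq (pds w (bseq \<mu> n)) \<le> C * \<theta> ^ n" for w
  proof -
    obtain C where "\<And>n. L2sq (pds w (bseq \<mu> n)) \<le> C * \<theta> ^ n"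
      using d[of "Suc (length w)"] unfolding decays_def by (metis lessI)
    moreover from this[of 0] have "C \<ge> 0" using L2sq_nonneg[of "pds w (bseq \<mu> 0)"] by simp
    ultimately show ?thesis by blast
  qed
  have g: "tsmooth (bseq \<mu> n)" for n by (rule tsmooth_bseq[OF m])
  show thesis
  proof
    show "0 < r" "r < 1" by (rule r)+
    show "\<exists>B\<ge>0. \<forall>n x. norm (pds w (dbar_inv (bseq \<mu> n)) x) \<le> B * r ^ n" for w
    proof -
      obtain V where V: "finite V" "\<And>u e x. tsmooth u \<Longrightarrow> u 0 = 0 \<Longrightarrow> (\<And>v. v \<in> V \<Longrightarrow> L2sq (pds v (dbar u)) \<le> e)
        \<Longrightarrow> (norm (pds w u x))\<^sup>2 \<le> 1024 * e" using dbar_control[of w] by metis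
      obtain Cv where Cv: "\<And>v. Cv v \<ge> 0" "\<And>v n. L2sq (pds v (bseq \<mu> n)) \<le> Cv v * \<theta> ^ n"
        using C by metis
      define D where "D = sum Cv V"
      have D: "D \<ge> 0" unfolding D_def by (intro sum_nonneg Cv)
      have "(norm (pds w (dbar_inv (bseq \<mu> n)) x))\<^sup>2 \<le> 1024 * (D * \<theta> ^ n)" for n x
      proof (rule V(2))
        fix v assume v: "v \<in> V"
        have "L2sq (pds v (dbar (dbar_inv (bseq \<mu> n)))) \<le> Cv v * \<theta> ^ n"
          using L2sq_pds_dbar_inv[OF g] Cv(2) order_trans by blast
        also have "\<dots> \<le> D * \<theta> ^ n"
          unfolding D_def using th v V(1) Cv(1) by (intro mult_right_mono member_le_sum) auto
        finally show "L2sq (pds v (dbar (dbar_inv (bseq \<mu> n)))) \<le> D * \<theta> ^ n" .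
      qed (auto intro: dbar_inv g)
      then have "norm (pds w (dbar_inv (bseq \<mu> n)) x) \<le> sqrt (1024 * D) * r ^ n" for n x
        by (intro sq) (use D in \<open>auto simp: mult.assoc\<close>)
      then show ?thesis using D by (intro exI[of _ "sqrt (1024 * D)"]) auto
    qed
    obtain C where "C \<ge> 0" "\<And>n. L2sq (bseq \<mu> n) \<le> C * \<theta> ^ n" using C[of "[]"] by auto
    then have "norm (integral usquare (bseq \<mu> n)) \<le> sqrt C * r ^ n" for n
      using norm_mean_le[OF g] order_trans by (intro sq) blast+
    then show "\<exists>B\<ge>0. \<forall>n. norm (integral usquare (bseq \<mu> n)) \<le> B * r ^ n"
      using \<open>C \<ge> 0\<close> by (intro exI[of _ "sqrt C"]) auto
  qed
qed

lemma integral_eq_0_imp: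
  fixes f :: "real^2 \<Rightarrow> real"
  assumes "tsmooth f" "\<And>x. f x \<ge> 0" "integral usquare f = 0"
  shows "f x = 0"
proof -
  obtain a b where ab: "a \<in> {0..1}" "b \<in> {0..1}" "f x = f (vector[a,b])"
    using periodic_reduce[of x] tsmooth_periodic[OF assms(1)] by metis
  have "(1/2) *\<^sub>R 1 \<in> box 0 (1::real^2)" by (simp add: mem_box_cart)
  then have "box 0 (1::real^2) \<noteq> {}" by blast
  then have "\<forall>x\<in>usquare. f x = 0"
    using integral_cbox_eq_0_iff[OF tsmooth_continuous[OF assms(1)]] assms(2,3) by blast
  then show ?thesis using ab vector2_in_usquare by metis
qed

lemma dbar_exp: "tsmooth s \<Longrightarrow> dbar (\<lambda>x. exp (s x)) x = exp (s x) * dbar s x"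
  by (simp add: dbar_def pd_exp tsmooth_differentiable algebra_simps)

lemma del_exp: "tsmooth s \<Longrightarrow> del (\<lambda>x. exp (s x)) x = exp (s x) * del s x"
  by (simp add: del_def pd_exp tsmooth_differentiable algebra_simps)

lemma del_mult: "tsmooth u \<Longrightarrow> tsmooth v \<Longrightarrow> del (\<lambda>x. u x * v x) x = u x * del v x + del u x * v x"
  by (simp add: del_def pd_mult tsmooth_differentiable field_simps)

lemma norm_dbar_le: "norm (dbar u x) \<le> norm (pd 1 u x) + norm (pd 2 u x)"
proof -
  have "norm (pd 1 u x + \<i> * pd 2 u x) \<le> norm (pd 1 u x) + norm (pd 2 u x)"
    using norm_triangle_ineq[of "pd 1 u x" "\<i> * pd 2 u x"] by (simp add: norm_mult)
  then show ?thesis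
    using norm_ge_zero[of "pd 1 u x"] norm_ge_zero[of "pd 2 u x"]
    unfolding dbar_def norm_divide norm_numeral by linarith
qed

lemma dbar_cmult:
  assumes "tsmooth u" shows "dbar (\<lambda>x. c * u x) x = c * dbar u x"
proof -
  have "pd i (\<lambda>x. c * u x) x = c * pd i u x" for i
    by (rule pd_bounded_linear[OF bounded_linear_mult_right tsmooth_differentiable[OF assms]])
  then show ?thesis by (simp add: dbar_def algebra_simps)
qed

lemma del_cmult:
  assumes "tsmooth u" shows "del (\<lambda>x. c * u x) x = c * del u x"
proof -
  have "pd i (\<lambda>x. c * u x) x = c * pd i u x" for i
    by (rule pd_bounded_linear[OF bounded_linear_mult_right tsmooth_differentiable[OF assms]])
  then show ?thesis by (simp add: del_def algebra_simps)
qed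

lemma del_sum:
  assumes "\<And>p. p \<in> S \<Longrightarrow> tsmooth (f p)"
  shows "del (\<lambda>x. \<Sum>p\<in>S. f p x) x = (\<Sum>p\<in>S. del (f p) x)"
  unfolding del_def
  by (simp add: pd_sum tsmooth_differentiable assms sum_subtractf sum_distrib_left flip: sum_divide_distrib)

lemma integral_dbar: "tsmooth u \<Longrightarrow> integral usquare (dbar u) = 0"
proof -
  assume u: "tsmooth u"
  have "dbar u = (\<lambda>x. (1/2) * pd 1 u x + (\<i>/2) * pd 2 u x)"
    by (auto simp: dbar_def add_divide_distrib)
  then show ?thesis
    by (simp only: Henstock_Kurzweil_Integration.integral_add integral_cmult integral_pd integrable_usquare
       tsmooth_mult tsmooth_const tsmooth_pd u) simp
qed

lemma integral_del: "tsmooth u \<Longrightarrow> integral usquare (del u) = 0"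
proof -
  assume u: "tsmooth u"
  have "del u = (\<lambda>x. (1/2) * pd 1 u x + (-\<i>/2) * pd 2 u x)"
    by (auto simp: del_def diff_divide_distrib)
  then show ?thesis
    by (simp only: Henstock_Kurzweil_Integration.integral_add integral_cmult integral_pd integrable_usquare
       tsmooth_mult tsmooth_const tsmooth_pd u) simp
qed

text \<open>
  With \<open>s = \<Sum> t ^ (n + 1) s\<^sub>n\<close> the function \<open>exp s\<close> solves the equation for \<open>t \<mu>\<close> up to a constant
  \<open>c(t)\<close>, a power series in \<open>t\<close>. Integrating over the torus gives \<open>c(t) \<integral> exp s = 0\<close>; the integral
  does not vanish for small \<open>t\<close>, so all the coefficients of \<open>c\<close> vanish.
\<close>

theorem beltrami_torus:
  assumes m: "tsmooth \<mu>" and q: "\<And>x. norm (\<mu> x) \<le> q" and "q < 1"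
  obtains \<omega> where "tsmooth \<omega>" "\<And>x. \<omega> x \<noteq> 0" "\<And>x. dbar \<omega> x = del (\<lambda>x. \<mu> x * \<omega> x) x"
proof -
  let ?g = "bseq \<mu>"
  define s where "s n = dbar_inv (?g n)" for n
  define c where "c n = integral usquare (?g n)" for n
  obtain r where r: "0 < r" "r < 1" and sB: "\<And>w. \<exists>B\<ge>0. \<forall>n x. norm (pds w (s n) x) \<le> B * r ^ n"
    and cB: "\<exists>B\<ge>0. \<forall>n. norm (c n) \<le> B * r ^ n"
    using bseq_bounds[OF m q \<open>q < 1\<close>] unfolding s_def c_def by metis
  have g: "tsmooth (?g n)" for n by (rule tsmooth_bseq[OF m])
  have s: "tsmooth (s n)" for n unfolding s_def by (rule dbar_inv(1)[OF g])
  have ds: "dbar (s n) x = ?g n x - c n" for n x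
    unfolding s_def c_def using dbar_inv(3)[OF g] by metis
  obtain B0 where B0: "B0 \<ge> 0" "\<And>n x. norm (s n x) \<le> B0 * r ^ n"
    using sB[of "[]"] by auto
  define K where "K = B0 / (1 - r)"
  have sumr: "summable (\<lambda>n. B * r ^ n)" for B
    using r by (intro summable_mult summable_geometric) auto
  define C where "C t = (\<Sum>n. of_real t ^ Suc n * c n)" for t :: real
  have csum: "summable (\<lambda>n. z ^ Suc n * c n)" if z: "norm z \<le> 1" for z :: complex
  proof -
    obtain B where B: "B \<ge> 0" "\<And>n. norm (c n) \<le> B * r ^ n" using cB by auto
    show ?thesis
    proof (rule summable_comparison_test'[OF sumr[of B]])
      fix n
      have "norm (z ^ Suc n * c n) \<le> 1 * (B * r ^ n)"
        unfolding norm_mult norm_power using z B by (intro mult_mono power_le_one) auto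
      then show "norm (z ^ Suc n * c n) \<le> B * r ^ n" by simp
    qed
  qed
  \<comment> \<open>The series is controlled up to \<open>\<bar>t\<bar> = 1\<close>, the value
    finally needed, while the bound proportional to \<open>\<bar>t\<bar>\<close> makes the exponent
    small for small \<open>t\<close>.\<close>
  have sol: "\<exists>S. tsmooth S \<and> (\<forall>x. dbar S x - t * \<mu> x * del S x = t * del \<mu> x - C t) \<and>
      (\<forall>x. norm (S x) \<le> \<bar>t\<bar> * K)"
    if t: "\<bar>t\<bar> \<le> 1" for t :: real
  proof -
    let ?U = "\<lambda>N x. \<Sum>n<N. complex_of_real t ^ Suc n * s n x"
    have U: "tsmooth (?U N)" for N by (intro tsmooth_intros s)
    have pU: "pds w (?U N) = (\<lambda>x. \<Sum>n<N. complex_of_real t ^ Suc n * pds w (s n) x)" for w N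
      by (subst pds_sum) (auto simp: pds_mult_const tsmooth_smooth s intro!: smooth_intros tsmooth_smooth[OF s])
    have cau: "uniformly_Cauchy_on UNIV (\<lambda>N. pds w (?U N))" for w
    proof -
      obtain B where B: "B \<ge> 0" "\<And>n x. norm (pds w (s n) x) \<le> B * r ^ n" using sB by metis
      have "uniform_limit UNIV (\<lambda>N x. \<Sum>n<N. complex_of_real t ^ Suc n * pds w (s n) x)
          (\<lambda>x. \<Sum>n. complex_of_real t ^ Suc n * pds w (s n) x) sequentially"
      proof (rule Weierstrass_m_test[OF _ sumr[of B]])
        fix n x
        have "norm (complex_of_real t ^ Suc n * pds w (s n) x) \<le> 1 * (B * r ^ n)"
          unfolding norm_mult norm_power norm_of_real using t B by (intro mult_mono power_le_one) auto
        then show "norm (complex_of_real t ^ Suc n * pds w (s n) x) \<le> B * r ^ n" by simp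
      qed
      then show ?thesis
        unfolding pU uniformly_convergent_eq_Cauchy[symmetric] uniformly_convergent_on_def by blast
    qed
    obtain S where S: "tsmooth S" "\<And>w. uniform_limit UNIV (\<lambda>N. pds w (?U N)) (pds w S) sequentially"
      by (rule tsmooth_limit[of ?U, OF U cau], rule that)
    have lim: "(\<lambda>N. pds w (?U N) x) \<longlonglongrightarrow> pds w S x" for w x
      using tendsto_uniform_limitI[OF S(2)] by simp
    have eq: "dbar S x - t * \<mu> x * del S x = t * del \<mu> x - C t" for x
    proof -
      have dU: "dbar (?U N) x = (\<Sum>n<N. complex_of_real t ^ Suc n * (?g n x - c n))" for N
      proof -
        have "dbar (?U N) x = (\<Sum>n<N. dbar (\<lambda>x. complex_of_real t ^ Suc n * s n x) x)"
          by (rule dbar_sum) (intro tsmooth_intros s)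
        then show ?thesis by (simp only: dbar_cmult s ds)
      qed
      have eU: "t * \<mu> x * del (?U N) x = (\<Sum>n<N. complex_of_real t ^ Suc (Suc n) * ?g (Suc n) x)" for N
      proof -
        have "del (?U N) x = (\<Sum>n<N. del (\<lambda>x. complex_of_real t ^ Suc n * s n x) x)"
          by (rule del_sum) (intro tsmooth_intros s)
        also have "\<dots> = (\<Sum>n<N. complex_of_real t ^ Suc n * del (s n) x)"
          by (simp only: del_cmult s)
        finally show ?thesis by (simp add: sum_distrib_left s_def mult_ac)
      qed
      \<comment> \<open>The sums telescope: \<open>\<mu>\<close> times \<open>del (s n)\<close> is
        the next \<open>bseq\<close> term, and \<open>dbar (s n)\<close> is the current one minus
        its mean \<open>c n\<close>.\<close>
      have tel: "dbar (?U N) x - t * \<mu> x * del (?U N) x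
          = t * del \<mu> x - complex_of_real t ^ Suc N * ?g N x - (\<Sum>n<N. complex_of_real t ^ Suc n * c n)" for N
        unfolding dU eU by (induction N) (auto simp: algebra_simps)
      have "(\<lambda>N. dbar (?U N) x - t * \<mu> x * del (?U N) x) \<longlonglongrightarrow> dbar S x - t * \<mu> x * del S x"
        using lim[of "[1]" x] lim[of "[2]" x] unfolding dbar_def del_def by (auto intro!: tendsto_intros)
      moreover have "(\<lambda>N. dbar (?U N) x - t * \<mu> x * del (?U N) x) \<longlonglongrightarrow> t * del \<mu> x - 0 - C t"
        unfolding tel
      proof (intro tendsto_diff tendsto_const)
        obtain B1 where B1: "\<And>n x. norm (pds [1] (s n) x) \<le> B1 * r ^ n" using sB[of "[1]"] by auto
        obtain B2 where B2: "\<And>n x. norm (pds [2] (s n) x) \<le> B2 * r ^ n" using sB[of "[2]"] by auto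
        obtain B3 where B3: "\<And>n. norm (c n) \<le> B3 * r ^ n" using cB by auto
        have gb: "norm (complex_of_real t ^ Suc N * ?g N x) \<le> (B1 + B2 + B3) * r ^ N" for N
        proof -
          have "?g N x = dbar (s N) x + c N"
            by (simp add: ds)
          then have "norm (?g N x) \<le> norm (dbar (s N) x) + norm (c N)"
            by (metis norm_triangle_ineq)
          also have "\<dots> \<le> (norm (pd 1 (s N) x) + norm (pd 2 (s N) x)) + norm (c N)"
            by (intro add_mono norm_dbar_le order_refl)
          also have "\<dots> \<le> (B1 * r ^ N + B2 * r ^ N) + B3 * r ^ N"
            using B1[of N x] B2[of N x] B3[of N] by (intro add_mono) auto
          finally have "norm (?g N x) \<le> (B1 + B2 + B3) * r ^ N"
            by (simp add: algebra_simps)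
          moreover have "norm (complex_of_real t ^ Suc N * ?g N x) \<le> 1 * norm (?g N x)"
            unfolding norm_mult norm_power norm_of_real using t by (intro mult_right_mono power_le_one) auto
          ultimately show ?thesis by simp
        qed
        show "(\<lambda>N. complex_of_real t ^ Suc N * ?g N x) \<longlonglongrightarrow> 0"
          by (rule Lim_null_comparison[OF always_eventually[OF allI[OF gb]]])
            (use r in \<open>auto intro!: tendsto_mult_right_zero LIMSEQ_realpow_zero\<close>)
        show "(\<lambda>N. \<Sum>n<N. complex_of_real t ^ Suc n * c n) \<longlonglongrightarrow> C t"
          unfolding C_def by (rule summable_LIMSEQ[OF csum]) (use t in auto)
      qed
      ultimately show ?thesis using LIMSEQ_unique by fastforce
    qed
    have l0: "(\<lambda>N. ?U N x) \<longlonglongrightarrow> S x" for x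
      using lim[of "[]" x] by (simp only: pds.simps)
    have "norm (S x) \<le> \<bar>t\<bar> * K" for x
    proof (rule Lim_bounded[OF tendsto_norm[OF l0], of 0])
      show "\<forall>N\<ge>0. norm (?U N x) \<le> \<bar>t\<bar> * K"
      proof (intro allI impI)
        fix N
        have "norm (?U N x) \<le> (\<Sum>n<N. \<bar>t\<bar> * (B0 * r ^ n))"
        proof (rule order_trans[OF norm_sum sum_mono])
          fix n
          have "norm (complex_of_real t ^ Suc n * s n x) = \<bar>t\<bar> * (\<bar>t\<bar> ^ n * norm (s n x))"
            by (simp add: norm_mult norm_power mult.assoc)
          also have "\<dots> \<le> \<bar>t\<bar> * (1 * (B0 * r ^ n))"
            using t B0 by (intro mult_left_mono mult_mono power_le_one) auto
          finally show "norm (complex_of_real t ^ Suc n * s n x) \<le> \<bar>t\<bar> * (B0 * r ^ n)" by simp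
        qed
        also have "\<dots> = \<bar>t\<bar> * (\<Sum>n<N. B0 * r ^ n)" by (simp add: sum_distrib_left)
        also have "\<dots> \<le> \<bar>t\<bar> * (\<Sum>n. B0 * r ^ n)"
          using B0 r by (intro mult_left_mono sum_le_suminf sumr) auto
        also have "(\<Sum>n. B0 * r ^ n) = K"
          using r by (simp add: K_def suminf_mult suminf_geometric summable_geometric)
        finally show "norm (?U N x) \<le> \<bar>t\<bar> * K" .
      qed
    qed
    then show ?thesis using S(1) eq by blast
  qed
  have zero: "C t * integral usquare (\<lambda>x. exp (S x)) = 0"
    and eqn: "dbar (\<lambda>x. exp (S x)) x - del (\<lambda>x. t * \<mu> x * exp (S x)) x = - C t * exp (S x)"
    if S: "tsmooth S" "\<And>x. dbar S x - t * \<mu> x * del S x = t * del \<mu> x - C t" for S x and t :: real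
  proof -
    have tm: "tsmooth (\<lambda>x. t * \<mu> x)" by (intro tsmooth_intros m)
    have dm: "del (\<lambda>x. t * \<mu> x) x = t * del \<mu> x" for x
      by (simp add: del_mult tsmooth_const m) (simp add: del_def)
    show *: "dbar (\<lambda>x. exp (S x)) x - del (\<lambda>x. t * \<mu> x * exp (S x)) x = - C t * exp (S x)" for x
    proof -
      have "dbar (\<lambda>x. exp (S x)) x - del (\<lambda>x. t * \<mu> x * exp (S x)) x
          = exp (S x) * ((dbar S x - t * \<mu> x * del S x) - t * del \<mu> x)"
        unfolding del_mult[OF tm tsmooth_exp[OF S(1)]] dm dbar_exp[OF S(1)] del_exp[OF S(1)]
        by (simp add: algebra_simps)
      then show ?thesis unfolding S(2) by simp
    qed
    have "C t * integral usquare (\<lambda>x. exp (S x)) = - integral usquare (\<lambda>x. - C t * exp (S x))"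
      by (subst integral_cmult) (auto intro!: integrable_usquare tsmooth_intros S)
    also have "(\<lambda>x. - C t * exp (S x)) = (\<lambda>x. dbar (\<lambda>x. exp (S x)) x - del (\<lambda>x. t * \<mu> x * exp (S x)) x)"
      using * by auto
    also have "integral usquare \<dots> = integral usquare (dbar (\<lambda>x. exp (S x))) - integral usquare (del (\<lambda>x. t * \<mu> x * exp (S x)))"
      by (rule Henstock_Kurzweil_Integration.integral_diff) (intro integrable_usquare tsmooth_intros S m)+
    also have "\<dots> = 0"
      by (simp add: integral_dbar integral_del tsmooth_exp S tsmooth_mult tm)
    finally show "C t * integral usquare (\<lambda>x. exp (S x)) = 0" by simp
  qed
  \<comment> \<open>For such \<open>t\<close> the exponent has modulus at most one, which is less
    than \<open>pi / 2\<close>. The exponential then has positive real part and nonzero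
    integral.\<close>
  define \<delta> where "\<delta> = 1 / (1 + \<bar>K\<bar>)"
  have d: "0 < \<delta>" "\<delta> \<le> 1" by (auto simp: \<delta>_def)
  have small: "C t = 0" if t: "\<bar>t\<bar> \<le> \<delta>" for t
  proof -
    obtain S where S: "tsmooth S" "\<And>x. dbar S x - t * \<mu> x * del S x = t * del \<mu> x - C t" "\<And>x. norm (S x) \<le> \<bar>t\<bar> * K"
      using sol[of t] t d by auto
    have n1: "norm (S x) \<le> 1" for x
    proof -
      have "\<bar>t\<bar> * K \<le> \<bar>t\<bar> * (1 + \<bar>K\<bar>)" by (intro mult_left_mono) auto
      also have "\<dots> \<le> \<delta> * (1 + \<bar>K\<bar>)" using t by (intro mult_right_mono) auto
      also have "\<dots> = 1" by (simp add: \<delta>_def)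
      finally show ?thesis using S(3)[of x] by simp
    qed
    have pos: "Re (exp (S x)) > 0" for x
    proof -
      have "\<bar>Im (S x)\<bar> < pi / 2"
        using abs_Im_le_cmod[of "S x"] n1[of x] pi_gt3 by linarith
      then have "cos (Im (S x)) > 0" by (intro cos_gt_zero_pi) auto
      then show ?thesis by (simp add: Re_exp)
    qed
    have i: "(\<lambda>x. exp (S x)) integrable_on usquare" by (intro integrable_usquare tsmooth_intros S)
    have "integral usquare (\<lambda>x. exp (S x)) \<noteq> 0"
    proof
      assume "integral usquare (\<lambda>x. exp (S x)) = 0"
      then have "integral usquare (\<lambda>x. Re (exp (S x))) = 0"
        using integral_linear[OF i bounded_linear_Re] by (simp add: o_def)
      then have "Re (exp (S 0)) = 0"
        by (intro integral_eq_0_imp[of "\<lambda>x. Re (exp (S x))" 0] tsmooth_intros S less_imp_le pos)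
      then show False using pos[of 0] by simp
    qed
    then show ?thesis using zero[OF S(1,2)] by simp
  qed
  \<comment> \<open>The identity theorem for power series: once the lower coefficients vanish,
    divide by \<open>t ^ Suc k\<close> and let \<open>t\<close> tend to zero along
    \<open>\<delta> / (j + 1)\<close>.\<close>
  have c0: "c k = 0" for k
  proof (induction k rule: less_induct)
    case (less k)
    obtain B where B: "B \<ge> 0" "\<And>n. norm (c n) \<le> B * r ^ n" using cB by auto
    define f where "f z = (\<Sum>n. c (n + k) * z ^ n)" for z
    have fsum: "summable (\<lambda>n. c (n + k) * z ^ n)" if z: "norm z \<le> 1" for z
    proof (rule summable_comparison_test'[OF sumr[of "B * r ^ k"]])
      fix n
      have "norm (c (n + k) * z ^ n) \<le> (B * r ^ (n + k)) * 1"
        unfolding norm_mult norm_power using z B r by (intro mult_mono power_le_one) auto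
      then show "norm (c (n + k) * z ^ n) \<le> B * r ^ k * r ^ n" by (simp add: power_add mult_ac)
    qed
    have lim: "(f \<longlongrightarrow> c k) (at 0)"
      using powser_limit_0[of 1 "\<lambda>n. c (n + k)" f] fsum unfolding f_def by (simp add: summable_sums)
    have f0: "f (of_real t) = 0" if t: "0 < t" "t \<le> \<delta>" for t
    proof -
      have "0 = (\<Sum>n. complex_of_real t ^ Suc n * c n)"
        using small[of t] t by (simp add: C_def)
      also have "\<dots> = (\<Sum>n. complex_of_real t ^ Suc (n + k) * c (n + k)) + (\<Sum>n<k. complex_of_real t ^ Suc n * c n)"
        by (rule suminf_split_initial_segment[OF csum]) (use t d in auto)
      also have "(\<Sum>n<k. complex_of_real t ^ Suc n * c n) = 0"
        using less by simp
      also have "(\<Sum>n. complex_of_real t ^ Suc (n + k) * c (n + k)) = (\<Sum>n. complex_of_real t ^ Suc k * (c (n + k) * complex_of_real t ^ n))"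
        by (simp add: power_add mult_ac)
      also have "\<dots> = complex_of_real t ^ Suc k * f (of_real t)"
        unfolding f_def by (rule suminf_mult[OF fsum]) (use t d in auto)
      finally show ?thesis using t by simp
    qed
    define z where "z j = complex_of_real (\<delta> / (real j + 1))" for j
    have zn: "z j \<noteq> 0" for j
    proof -
      have "real j + 1 \<noteq> 0" by linarith
      then show ?thesis unfolding z_def of_real_eq_0_iff using d by simp
    qed
    have "z \<longlonglongrightarrow> complex_of_real 0"
      unfolding z_def
      by (intro tendsto_of_real real_tendsto_divide_at_top[OF tendsto_const]
        filterlim_at_top_mono[OF filterlim_real_sequentially]) auto
    then have "filterlim z (at 0) sequentially"
      unfolding filterlim_at using zn by simp
    from filterlim_compose[OF lim this] have "(\<lambda>j. f (z j)) \<longlonglongrightarrow> c k" .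
    moreover have "f (z j) = 0" for j
      unfolding z_def using d by (intro f0) (auto simp: field_simps)
    ultimately show ?case by (simp add: LIMSEQ_const_iff)
  qed
  have C1: "C 1 = 0" by (simp add: C_def c0)
  obtain S where S: "tsmooth S" "\<And>x. dbar S x - (1::real) * \<mu> x * del S x = (1::real) * del \<mu> x - C 1"
    using sol[of 1] by auto
  show thesis
  proof
    show "tsmooth (\<lambda>x. exp (S x))" by (intro tsmooth_intros S)
    show "dbar (\<lambda>x. exp (S x)) x = del (\<lambda>x. \<mu> x * exp (S x)) x" for x
      using eqn[OF S, of x] by (simp add: C1)
  qed simp
qed

subsection \<open>Parallel frames\<close>

text \<open>
  Two closed one-forms \<open>\<alpha>\<close>, \<open>\<beta>\<close>, linearly independent everywhere, and the dual frame, whose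
  fields are denoted by the derivations \<open>D1\<close> and \<open>D2\<close>.
\<close>

locale torus_frame =
  fixes \<alpha>1 \<alpha>2 \<beta>1 \<beta>2 :: "real^2 \<Rightarrow> real"
  assumes ts [tsmooth_intros]: "tsmooth \<alpha>1" "tsmooth \<alpha>2" "tsmooth \<beta>1" "tsmooth \<beta>2"
    and closed_\<alpha>: "pd 2 \<alpha>1 x = pd 1 \<alpha>2 x"
    and closed_\<beta>: "pd 2 \<beta>1 x = pd 1 \<beta>2 x"
    and pos: "\<alpha>1 x * \<beta>2 x - \<alpha>2 x * \<beta>1 x > 0"
begin

text \<open>The density of the area form of the coframe. Integrals weighted by it are the invariant
  ones.\<close>

definition Kd :: "real^2 \<Rightarrow> real" where "Kd x = \<alpha>1 x * \<beta>2 x - \<alpha>2 x * \<beta>1 x"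

definition D1 :: "(real^2 \<Rightarrow> 'b::real_normed_vector) \<Rightarrow> real^2 \<Rightarrow> 'b" where
  "D1 u x = (\<beta>2 x / Kd x) *\<^sub>R pd 1 u x - (\<beta>1 x / Kd x) *\<^sub>R pd 2 u x"

definition D2 :: "(real^2 \<Rightarrow> 'b::real_normed_vector) \<Rightarrow> real^2 \<Rightarrow> 'b" where
  "D2 u x = (\<alpha>1 x / Kd x) *\<^sub>R pd 2 u x - (\<alpha>2 x / Kd x) *\<^sub>R pd 1 u x"

lemma Kd_pos: "Kd x > 0"
  using pos by (simp add: Kd_def)

lemma tsmooth_Kd [tsmooth_intros]: "tsmooth Kd"
  unfolding Kd_def[abs_def] by (intro tsmooth_intros)

lemma Kd_nz: "Kd x \<noteq> 0" using Kd_pos[of x] by simp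

lemma tsmooth_D1 [tsmooth_intros]: "tsmooth u \<Longrightarrow> tsmooth (D1 u)"
  unfolding D1_def[abs_def] by (intro tsmooth_intros Kd_nz)

lemma tsmooth_D2 [tsmooth_intros]: "tsmooth u \<Longrightarrow> tsmooth (D2 u)"
  unfolding D2_def[abs_def] by (intro tsmooth_intros Kd_nz)

lemma pd_D: "pd 1 u x = \<alpha>1 x *\<^sub>R D1 u x + \<beta>1 x *\<^sub>R D2 u x"
  "pd 2 u x = \<alpha>2 x *\<^sub>R D1 u x + \<beta>2 x *\<^sub>R D2 u x"
proof -
  have "\<alpha>1 x *\<^sub>R D1 u x + \<beta>1 x *\<^sub>R D2 u x
      = (\<alpha>1 x * (\<beta>2 x / Kd x) - \<beta>1 x * (\<alpha>2 x / Kd x)) *\<^sub>R pd 1 u x"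
    by (simp add: D1_def D2_def algebra_simps)
  also have "\<alpha>1 x * (\<beta>2 x / Kd x) - \<beta>1 x * (\<alpha>2 x / Kd x) = Kd x / Kd x"
    by (simp add: Kd_def diff_divide_distrib[symmetric] mult.commute)
  finally show "pd 1 u x = \<alpha>1 x *\<^sub>R D1 u x + \<beta>1 x *\<^sub>R D2 u x"
    using Kd_pos[of x] by simp
  have "\<alpha>2 x *\<^sub>R D1 u x + \<beta>2 x *\<^sub>R D2 u x
      = (\<beta>2 x * (\<alpha>1 x / Kd x) - \<alpha>2 x * (\<beta>1 x / Kd x)) *\<^sub>R pd 2 u x"
    by (simp add: D1_def D2_def algebra_simps)
  also have "\<beta>2 x * (\<alpha>1 x / Kd x) - \<alpha>2 x * (\<beta>1 x / Kd x) = Kd x / Kd x"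
    by (simp add: Kd_def diff_divide_distrib[symmetric] mult.commute)
  finally show "pd 2 u x = \<alpha>2 x *\<^sub>R D1 u x + \<beta>2 x *\<^sub>R D2 u x"
    using Kd_pos[of x] by simp
qed

lemma D_bounded_linear:
  assumes "bounded_linear h" "u differentiable (at x)"
  shows "D1 (\<lambda>x. h (u x)) x = h (D1 u x)" "D2 (\<lambda>x. h (u x)) x = h (D2 u x)"
proof -
  interpret h: bounded_linear h by fact
  show "D1 (\<lambda>x. h (u x)) x = h (D1 u x)" "D2 (\<lambda>x. h (u x)) x = h (D2 u x)"
    by (simp_all add: D1_def D2_def pd_bounded_linear[OF assms] h.diff h.scaleR)
qed

lemma D_bounded_bilinear:
  assumes "bounded_bilinear h" "u differentiable (at x)" "v differentiable (at x)"
  shows "D1 (\<lambda>x. h (u x) (v x)) x = h (u x) (D1 v x) + h (D1 u x) (v x)"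
    "D2 (\<lambda>x. h (u x) (v x)) x = h (u x) (D2 v x) + h (D2 u x) (v x)"
proof -
  interpret h: bounded_bilinear h by fact
  show "D1 (\<lambda>x. h (u x) (v x)) x = h (u x) (D1 v x) + h (D1 u x) (v x)"
    "D2 (\<lambda>x. h (u x) (v x)) x = h (u x) (D2 v x) + h (D2 u x) (v x)"
    by (simp_all add: D1_def D2_def pd_bounded_bilinear[OF assms] h.diff_left h.diff_right
        h.scaleR_left h.scaleR_right algebra_simps)
qed

lemma D_inner:
  assumes "tsmooth u" "tsmooth v"
  shows "D1 (\<lambda>x. u x \<bullet> v x) x = u x \<bullet> D1 v x + D1 u x \<bullet> v x"
    "D2 (\<lambda>x. u x \<bullet> v x) x = u x \<bullet> D2 v x + D2 u x \<bullet> v x"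
  by (rule D_bounded_bilinear[OF bounded_bilinear_inner tsmooth_differentiable tsmooth_differentiable]; fact)+

lemma D_scaleR:
  assumes "tsmooth u" "tsmooth v"
  shows "D1 (\<lambda>x. u x *\<^sub>R v x) x = u x *\<^sub>R D1 v x + D1 u x *\<^sub>R v x"
    "D2 (\<lambda>x. u x *\<^sub>R v x) x = u x *\<^sub>R D2 v x + D2 u x *\<^sub>R v x"
  by (rule D_bounded_bilinear[OF bounded_bilinear_scaleR tsmooth_differentiable tsmooth_differentiable]; fact)+

lemma D_mult:
  fixes u v :: "real^2 \<Rightarrow> real"
  assumes "tsmooth u" "tsmooth v"
  shows "D1 (\<lambda>x. u x * v x) x = u x * D1 v x + D1 u x * v x"
    "D2 (\<lambda>x. u x * v x) x = u x * D2 v x + D2 u x * v x"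
  by (rule D_bounded_bilinear[OF bounded_bilinear_mult tsmooth_differentiable tsmooth_differentiable]; fact)+

lemma D_add:
  assumes "tsmooth u" "tsmooth v"
  shows "D1 (\<lambda>x. u x + v x) x = D1 u x + D1 v x" "D2 (\<lambda>x. u x + v x) x = D2 u x + D2 v x"
  by (simp_all add: D1_def D2_def pd_add tsmooth_differentiable assms algebra_simps)

lemma D_diff:
  assumes "tsmooth u" "tsmooth v"
  shows "D1 (\<lambda>x. u x - v x) x = D1 u x - D1 v x" "D2 (\<lambda>x. u x - v x) x = D2 u x - D2 v x"
  by (simp_all add: D1_def D2_def pd_diff tsmooth_differentiable assms algebra_simps)

lemma D_const [simp]: "D1 (\<lambda>x. c) = (\<lambda>x. 0)" "D2 (\<lambda>x. c) = (\<lambda>x. 0)"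
  by (auto simp: D1_def D2_def)

text \<open>Closedness of the coframe makes both fields divergence free with respect to the area
  form of density \<open>Kd\<close>, so the integrand is a flat divergence.\<close>

lemma integral_D:
  fixes u :: "real^2 \<Rightarrow> real"
  assumes u: "tsmooth u"
  shows "integral usquare (\<lambda>x. Kd x * D1 u x) = 0" "integral usquare (\<lambda>x. Kd x * D2 u x) = 0"
proof -
  note td = tsmooth_differentiable[OF ts(1)] tsmooth_differentiable[OF ts(2)] tsmooth_differentiable[OF ts(3)]
    tsmooth_differentiable[OF ts(4)] tsmooth_differentiable[OF u]
  have "(\<lambda>x. Kd x * D1 u x) = (\<lambda>x. pd 1 (\<lambda>x. \<beta>2 x * u x) x - pd 2 (\<lambda>x. \<beta>1 x * u x) x)"
    using Kd_nz by (auto simp: D1_def pd_mult td closed_\<beta> field_simps fun_eq_iff)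
  then show "integral usquare (\<lambda>x. Kd x * D1 u x) = 0"
    by (simp add: Henstock_Kurzweil_Integration.integral_diff integrable_usquare tsmooth_pd tsmooth_mult ts u integral_pd)
  have "(\<lambda>x. Kd x * D2 u x) = (\<lambda>x. pd 2 (\<lambda>x. \<alpha>1 x * u x) x - pd 1 (\<lambda>x. \<alpha>2 x * u x) x)"
    using Kd_nz by (auto simp: D2_def pd_mult td closed_\<alpha> field_simps fun_eq_iff)
  then show "integral usquare (\<lambda>x. Kd x * D2 u x) = 0"
    by (simp add: Henstock_Kurzweil_Integration.integral_diff integrable_usquare tsmooth_pd tsmooth_mult ts u integral_pd)
qed

text \<open>The bracket of a dual frame is governed by the exterior derivatives of the coframe.
  Concretely, in the equality of mixed partial derivatives the closedness relations cancel the
  first-order terms and leave \<open>Kd\<close> times the commutator.\<close>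

lemma D_commute:
  fixes u :: "real^2 \<Rightarrow> 'b::banach"
  assumes u: "tsmooth u"
  shows "D1 (D2 u) x = D2 (D1 u) x"
proof -
  note td = tsmooth_differentiable[OF ts(1)] tsmooth_differentiable[OF ts(2)] tsmooth_differentiable[OF ts(3)]
    tsmooth_differentiable[OF ts(4)] tsmooth_differentiable[OF tsmooth_D1[OF u]] tsmooth_differentiable[OF tsmooth_D2[OF u]]
  have p: "pd 1 u = (\<lambda>x. \<alpha>1 x *\<^sub>R D1 u x + \<beta>1 x *\<^sub>R D2 u x)" "pd 2 u = (\<lambda>x. \<alpha>2 x *\<^sub>R D1 u x + \<beta>2 x *\<^sub>R D2 u x)"
    using pd_D[of u] by auto
  have "pd 2 (pd 1 u) x = pd 2 \<alpha>1 x *\<^sub>R D1 u x + \<alpha>1 x *\<^sub>R pd 2 (D1 u) x + pd 2 \<beta>1 x *\<^sub>R D2 u x + \<beta>1 x *\<^sub>R pd 2 (D2 u) x"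
    unfolding p(1)
    by (subst pd_add) (auto simp: pd_scaleR td algebra_simps intro!: tsmooth_differentiable tsmooth_intros u)
  moreover have "pd 1 (pd 2 u) x = pd 1 \<alpha>2 x *\<^sub>R D1 u x + \<alpha>2 x *\<^sub>R pd 1 (D1 u) x + pd 1 \<beta>2 x *\<^sub>R D2 u x + \<beta>2 x *\<^sub>R pd 1 (D2 u) x"
    unfolding p(2)
    by (subst pd_add) (auto simp: pd_scaleR td algebra_simps intro!: tsmooth_differentiable tsmooth_intros u)
  ultimately have "\<alpha>1 x *\<^sub>R pd 2 (D1 u) x + \<beta>1 x *\<^sub>R pd 2 (D2 u) x = \<alpha>2 x *\<^sub>R pd 1 (D1 u) x + \<beta>2 x *\<^sub>R pd 1 (D2 u) x"
    using pd_commute_12[OF tsmooth_smooth[OF u], of x] by (simp add: closed_\<alpha> closed_\<beta>)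
  then have "Kd x *\<^sub>R D2 (D1 u) x = Kd x *\<^sub>R D1 (D2 u) x"
    unfolding pd_D[of "D1 u"] pd_D[of "D2 u"]
    by (simp add: Kd_def algebra_simps)
  then show ?thesis using Kd_nz[of x] by simp
qed

end

subsection \<open>Isothermal frames\<close>

lemma vec2_quadratic:
  fixes A :: "real^2^2"
  shows "v \<bullet> (A *v v) = v$1 * (A$1$1 * v$1 + A$1$2 * v$2) + v$2 * (A$2$1 * v$1 + A$2$2 * v$2)"
  by (simp add: inner_vec_def matrix_vector_mult_def sum_2)

lemma riemannian_metric_entries:
  assumes g: "riemannian_metric g"
  shows "tsmooth (\<lambda>x. g x $ i $ j)" "g x $ 2 $ 1 = g x $ 1 $ 2" "g x $ 1 $ 1 > 0" "g x $ 2 $ 2 > 0" "det (g x) > 0"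
proof -
  have "tsmooth g" using g by (simp add: riemannian_metric_def tsmooth_def)
  then show "tsmooth (\<lambda>x. g x $ i $ j)" by (intro tsmooth_intros)
  have t: "transpose (g x) = g x" using g by (simp add: riemannian_metric_def)
  show s: "g x $ 2 $ 1 = g x $ 1 $ 2"
    using arg_cong[OF t, of "\<lambda>m. m $ 1 $ 2"] by (simp add: transpose_def)
  have p: "v \<bullet> (g x *v v) > 0" if "v \<noteq> 0" for v using g that by (simp add: riemannian_metric_def)
  show E: "g x $ 1 $ 1 > 0"
    using p[of "axis 1 1"] unfolding vec2_quadratic axis_eq_0_iff by (simp add: axis_def)
  show "g x $ 2 $ 2 > 0"
    using p[of "axis 2 1"] unfolding vec2_quadratic axis_eq_0_iff by (simp add: axis_def)
  \<comment> \<open>Orthogonal to the first basis vector in the metric. Its squared length is the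
    first entry of the metric times the determinant.\<close>
  define v where "v = (vector[- g x $ 1 $ 2, g x $ 1 $ 1] :: real^2)"
  have "v \<noteq> 0" using E by (simp add: v_def vec_eq_iff forall_2)
  from p[OF this] have "g x $ 1 $ 1 * (g x $ 1 $ 1 * g x $ 2 $ 2 - (g x $ 1 $ 2)\<^sup>2) > 0"
    unfolding vec2_quadratic by (simp add: v_def s algebra_simps power2_eq_square)
  then show "det (g x) > 0"
    using E by (simp add: det_2 s zero_less_mult_iff power2_eq_square)
qed

text \<open>
  The metric with entries \<open>E\<close>, \<open>F\<close>, \<open>G\<close> and area density \<open>d\<close> is a multiple of \<open>|dz + m dz\<^sup>*|\<^sup>2\<close>, where
  \<open>z\<^sup>*\<close> is the conjugate of \<open>z = x + i y\<close>; moreover \<open>w (dz + m dz\<^sup>*) = P dx + R dy\<close>.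
\<close>

lemma isothermal_algebra:
  fixes E F G S d :: real and w m :: complex
  assumes S: "S = E + G + 2 * d" "S > 0" and d: "d\<^sup>2 = E * G - F\<^sup>2"
    and m: "m = Complex ((E - G) / S) (2 * F / S)"
  defines "P \<equiv> w * (1 + m)" and "R \<equiv> \<i> * w * (1 - m)"
  shows "S * ((Re P)\<^sup>2 + (Im P)\<^sup>2) = 4 * (norm w)\<^sup>2 * E"
    "S * ((Re R)\<^sup>2 + (Im R)\<^sup>2) = 4 * (norm w)\<^sup>2 * G"
    "S * (Re P * Re R + Im P * Im R) = 4 * (norm w)\<^sup>2 * F"
    "S * (Re P * Im R - Re R * Im P) = 4 * (norm w)\<^sup>2 * d"
    "S * (1 - (norm m)\<^sup>2) = 4 * d"
proof -
  have mS: "S * Re m = E - G" "S * Im m = 2 * F" using S m by auto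
  have 0: "E * G = d\<^sup>2 + F\<^sup>2" using d by simp
  have c: "a = b" if "S * a = S * b" for a b :: real using that S by simp
  have S2: "S * (S * ((1 + Re m)\<^sup>2 + (Im m)\<^sup>2)) = S * (4 * E)"
  proof -
    have "S * (S * ((1 + Re m)\<^sup>2 + (Im m)\<^sup>2)) = (S + S * Re m)\<^sup>2 + (S * Im m)\<^sup>2" by (simp add: algebra_simps power2_eq_square)
    also have "\<dots> = S * (4 * E)" unfolding mS unfolding S(1) using 0 by (simp add: algebra_simps power2_eq_square)
    finally show ?thesis .
  qed
  have S3: "S * (S * ((1 - Re m)\<^sup>2 + (Im m)\<^sup>2)) = S * (4 * G)"
  proof -
    have "S * (S * ((1 - Re m)\<^sup>2 + (Im m)\<^sup>2)) = (S - S * Re m)\<^sup>2 + (S * Im m)\<^sup>2" by (simp add: algebra_simps power2_eq_square)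
    also have "\<dots> = S * (4 * G)" unfolding mS unfolding S(1) using 0 by (simp add: algebra_simps power2_eq_square)
    finally show ?thesis .
  qed
  have S4: "S * (S * (1 - ((Re m)\<^sup>2 + (Im m)\<^sup>2))) = S * (4 * d)"
  proof -
    have "S * (S * (1 - ((Re m)\<^sup>2 + (Im m)\<^sup>2))) = S\<^sup>2 - (S * Re m)\<^sup>2 - (S * Im m)\<^sup>2" by (simp add: algebra_simps power2_eq_square)
    also have "\<dots> = S * (4 * d)" unfolding mS unfolding S(1) using 0 by (simp add: algebra_simps power2_eq_square)
    finally show ?thesis .
  qed
  have nw: "(norm w)\<^sup>2 = (Re w)\<^sup>2 + (Im w)\<^sup>2" by (simp add: cmod_power2)
  have "S * ((Re P)\<^sup>2 + (Im P)\<^sup>2) = (norm w)\<^sup>2 * (S * ((1 + Re m)\<^sup>2 + (Im m)\<^sup>2))"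
    unfolding nw P_def by (simp add: algebra_simps power2_eq_square)
  then show "S * ((Re P)\<^sup>2 + (Im P)\<^sup>2) = 4 * (norm w)\<^sup>2 * E" unfolding c[OF S2] by simp
  have "S * ((Re R)\<^sup>2 + (Im R)\<^sup>2) = (norm w)\<^sup>2 * (S * ((1 - Re m)\<^sup>2 + (Im m)\<^sup>2))"
    unfolding nw R_def by (simp add: algebra_simps power2_eq_square)
  then show "S * ((Re R)\<^sup>2 + (Im R)\<^sup>2) = 4 * (norm w)\<^sup>2 * G" unfolding c[OF S3] by simp
  have "S * (Re P * Re R + Im P * Im R) = (norm w)\<^sup>2 * (2 * (S * Im m))"
    unfolding nw P_def R_def by (simp add: algebra_simps power2_eq_square)
  then show "S * (Re P * Re R + Im P * Im R) = 4 * (norm w)\<^sup>2 * F" unfolding mS by simp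
  have "S * (Re P * Im R - Re R * Im P) = (norm w)\<^sup>2 * (S * (1 - ((Re m)\<^sup>2 + (Im m)\<^sup>2)))"
    unfolding nw P_def R_def by (simp add: algebra_simps power2_eq_square)
  then show "S * (Re P * Im R - Re R * Im P) = 4 * (norm w)\<^sup>2 * d" unfolding c[OF S4] by simp
  show "S * (1 - (norm m)\<^sup>2) = 4 * d" unfolding cmod_power2 using c[OF S4] by simp
qed

text \<open>The metric is \<open>\<sigma>\<close> times the sum of the squares of the one-forms
  \<open>\<alpha>\<close> and \<open>\<beta>\<close>, in coordinates. No regularity of
  \<open>\<sigma>\<close> is demanded.\<close>

definition isothermal :: "(real^2 \<Rightarrow> real^2^2) \<Rightarrow> (real^2 \<Rightarrow> real) \<Rightarrow> (real^2 \<Rightarrow> real) \<Rightarrow>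
    (real^2 \<Rightarrow> real) \<Rightarrow> (real^2 \<Rightarrow> real) \<Rightarrow> (real^2 \<Rightarrow> real) \<Rightarrow> bool" where
  "isothermal g \<sigma> \<alpha>1 \<alpha>2 \<beta>1 \<beta>2 \<longleftrightarrow> (\<forall>x. \<sigma> x > 0 \<and> g x $ 1 $ 1 = \<sigma> x * ((\<alpha>1 x)\<^sup>2 + (\<beta>1 x)\<^sup>2) \<and>
     g x $ 1 $ 2 = \<sigma> x * (\<alpha>1 x * \<alpha>2 x + \<beta>1 x * \<beta>2 x) \<and> g x $ 2 $ 1 = \<sigma> x * (\<alpha>1 x * \<alpha>2 x + \<beta>1 x * \<beta>2 x) \<and>
     g x $ 2 $ 2 = \<sigma> x * ((\<alpha>2 x)\<^sup>2 + (\<beta>2 x)\<^sup>2))"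

theorem isothermal_exists:
  assumes g: "riemannian_metric g"
  obtains \<sigma> \<alpha>1 \<alpha>2 \<beta>1 \<beta>2 where "torus_frame \<alpha>1 \<alpha>2 \<beta>1 \<beta>2" "isothermal g \<sigma> \<alpha>1 \<alpha>2 \<beta>1 \<beta>2"
proof -
  define E F G d S where "E x = g x $ 1 $ 1" and "F x = g x $ 1 $ 2" and "G x = g x $ 2 $ 2"
    and "d x = sqrt (det (g x))" and "S x = E x + G x + 2 * d x" for x
  note ge = riemannian_metric_entries[OF g]
  have detE: "det (g x) = E x * G x - (F x)\<^sup>2" for x
    by (simp add: det_2 E_def F_def G_def ge(2) power2_eq_square)
  have tsm: "tsmooth E" "tsmooth F" "tsmooth G" unfolding E_def F_def G_def by (rule ge)+
  have "tsmooth (\<lambda>x. E x * G x - (F x)\<^sup>2)" by (intro tsmooth_intros tsm)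
  then have tdet: "tsmooth (\<lambda>x. det (g x))" unfolding detE .
  have td: "tsmooth d" unfolding d_def by (intro tsmooth_sqrt tdet ge)
  have dpos: "d x > 0" for x using ge(5)[of x] by (simp add: d_def)
  have d2: "(d x)\<^sup>2 = E x * G x - (F x)\<^sup>2" for x unfolding detE[symmetric] d_def using ge(5)[of x] by simp
  have tS: "tsmooth S" unfolding S_def by (intro tsmooth_intros tsm td)
  have Spos: "S x > 0" for x using ge(3,4)[of x] dpos[of x] by (simp add: S_def E_def G_def)
  have Snz: "S x \<noteq> 0" for x using Spos[of x] by simp
  define \<mu> where "\<mu> x = Complex ((E x - G x) / S x) (2 * F x / S x)" for x
  have "\<mu> = (\<lambda>x. complex_of_real ((E x - G x) / S x) + \<i> * complex_of_real (2 * F x / S x))"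
    by (auto simp: \<mu>_def complex_eq_iff)
  then have tm: "tsmooth \<mu>" by (simp only:) (intro tsmooth_intros tsm tS Snz)
  note alg = isothermal_algebra[OF S_def Spos d2 \<mu>_def]
  obtain C where C: "C \<ge> 0" "\<And>x. norm (S x / d x) \<le> C"
    using tsmooth_bounded[OF tsmooth_divide[OF tS td]] dpos by (metis less_irrefl)
  \<comment> \<open>By compactness \<open>S / d\<close> is bounded by \<open>C\<close>, and one
    minus the squared modulus of \<open>\<mu>\<close> is \<open>4 * d / S\<close>. Enlarging
    \<open>C\<close> by 4 keeps the radicand nonnegative.\<close>
  define q where "q = sqrt (1 - 4 / (C + 4))"
  have q1: "q < 1" using C by (simp add: q_def)
  have q: "norm (\<mu> x) \<le> q" for x
  proof -
    have "S x \<le> (C + 4) * d x"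
      using C(2)[of x] dpos[of x] Spos[of x] by (simp add: field_simps)
    then have "4 / (C + 4) \<le> 4 * d x / S x"
      using Spos[of x] C(1) by (simp add: field_simps)
    also have "4 * d x / S x = 1 - (norm (\<mu> x))\<^sup>2"
      using alg(5)[of x] Spos[of x] by (simp add: field_simps)
    finally show ?thesis unfolding q_def by (intro real_le_rsqrt) simp
  qed
  obtain \<omega> where w: "tsmooth \<omega>" "\<And>x. \<omega> x \<noteq> 0" and weq: "\<And>x. dbar \<omega> x = del (\<lambda>x. \<mu> x * \<omega> x) x"
    using beltrami_torus[OF tm q q1] by metis
  define P R where "P x = \<omega> x * (1 + \<mu> x)" and "R x = \<i> * \<omega> x * (1 - \<mu> x)" for x
  have tP: "tsmooth P" "tsmooth R" unfolding P_def R_def by (intro tsmooth_intros w tm)+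
  have tmw: "tsmooth (\<lambda>x. \<mu> x * \<omega> x)" by (intro tsmooth_intros tm w)
  have closed: "pd 2 P x = pd 1 R x" for x
  proof -
    have "P = (\<lambda>x. \<omega> x + \<mu> x * \<omega> x)" "R = (\<lambda>x. \<i> * (\<omega> x - \<mu> x * \<omega> x))"
      by (auto simp: P_def R_def algebra_simps)
    then have "pd 2 P x = pd 2 \<omega> x + pd 2 (\<lambda>x. \<mu> x * \<omega> x) x"
      "pd 1 R x = \<i> * (pd 1 \<omega> x - pd 1 (\<lambda>x. \<mu> x * \<omega> x) x)"
      by (simp_all add: pd_add pd_diff tsmooth_differentiable w tmw tsmooth_diff
          pd_bounded_linear[OF bounded_linear_mult_right])
    moreover have "pd 1 \<omega> x + \<i> * pd 2 \<omega> x = pd 1 (\<lambda>x. \<mu> x * \<omega> x) x - \<i> * pd 2 (\<lambda>x. \<mu> x * \<omega> x) x"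
      using weq[of x] unfolding dbar_def del_def divide_cancel_right by simp
    ultimately show ?thesis by (simp add: complex_eq_iff)
  qed
  have RI: "pd i (\<lambda>x. Re (u x)) x = Re (pd i u x)" "pd i (\<lambda>x. Im (u x)) x = Im (pd i u x)" if "tsmooth u" for u i x
    by (rule pd_bounded_linear[OF bounded_linear_Re tsmooth_differentiable[OF that]]
        pd_bounded_linear[OF bounded_linear_Im tsmooth_differentiable[OF that]])+
  have alg': "S x * ((Re (P x))\<^sup>2 + (Im (P x))\<^sup>2) = 4 * (norm (\<omega> x))\<^sup>2 * E x"
    "S x * ((Re (R x))\<^sup>2 + (Im (R x))\<^sup>2) = 4 * (norm (\<omega> x))\<^sup>2 * G x"
    "S x * (Re (P x) * Re (R x) + Im (P x) * Im (R x)) = 4 * (norm (\<omega> x))\<^sup>2 * F x"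
    "S x * (Re (P x) * Im (R x) - Re (R x) * Im (P x)) = 4 * (norm (\<omega> x))\<^sup>2 * d x" for x
    unfolding P_def R_def by (rule alg(1-4))+
  have nw: "(norm (\<omega> x))\<^sup>2 > 0" for x using w(2)[of x] by simp
  show thesis
  proof
    show "torus_frame (\<lambda>x. Re (P x)) (\<lambda>x. Re (R x)) (\<lambda>x. Im (P x)) (\<lambda>x. Im (R x))"
    proof
      fix x
      have "S x * (Re (P x) * Im (R x) - Re (R x) * Im (P x)) > 0"
        unfolding alg' using nw[of x] dpos[of x] by simp
      then show "Re (P x) * Im (R x) - Re (R x) * Im (P x) > 0"
        using Spos[of x] by (simp add: zero_less_mult_iff)
    qed (auto intro!: tsmooth_intros tP simp: RI tP closed)
    show "isothermal g (\<lambda>x. S x / (4 * (norm (\<omega> x))\<^sup>2)) (\<lambda>x. Re (P x)) (\<lambda>x. Re (R x)) (\<lambda>x. Im (P x)) (\<lambda>x. Im (R x))"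
      unfolding isothermal_def times_divide_eq_left alg'
      using nw Spos w(2) by (auto simp: E_def F_def G_def ge(2) simp del: zero_less_norm_iff)
  qed
qed

subsection \<open>Integration against area measures\<close>

lemma set_integrable_continuous:
  fixes u :: "real^2 \<Rightarrow> 'b::euclidean_space"
  assumes "continuous_on UNIV u"
  shows "set_integrable lborel usquare u" "(LINT x:usquare|lborel. u x) = integral usquare u"
proof -
  show i: "set_integrable lborel usquare u"
    unfolding set_integrable_def
    by (intro borel_integrable_compact continuous_on_subset[OF assms] compact_cbox) auto
  show "(LINT x:usquare|lborel. u x) = integral usquare u"
    using set_borel_integral_eq_integral(2)[OF i] .
qed

text \<open>The density is passed as a smooth function \<open>\<rho>\<close> because the square root
  of the determinant is also needed for the induced metric, where the determinant may
  vanish.\<close>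

lemma area_integral:
  fixes g :: "real^2 \<Rightarrow> real^2^2" and \<phi> :: "real^2 \<Rightarrow> real"
  assumes \<rho>: "\<And>x. sqrt (det (g x)) = \<rho> x" "\<And>x. \<rho> x \<ge> 0" "tsmooth \<rho>"
    and \<phi>: "\<phi> \<in> borel_measurable borel"
  shows "integrable (area g) \<phi> \<longleftrightarrow> set_integrable lborel usquare (\<lambda>x. \<rho> x * \<phi> x)"
    "(LINT x|area g. \<phi> x) = (LINT x:usquare|lborel. \<rho> x * \<phi> x)"
proof -
  have m: "\<rho> \<in> borel_measurable borel"
    by (rule borel_measurable_continuous_onI[OF tsmooth_continuous[OF \<rho>(3)]])
  have m2: "(\<lambda>x. indicator usquare x * \<rho> x) \<in> borel_measurable lborel"
    using m by measurable
  have nn: "AE x in lborel. 0 \<le> indicator usquare x * \<rho> x"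
    using \<rho>(2) by simp
  have m3: "\<phi> \<in> borel_measurable lborel" using \<phi> by simp
  show "integrable (area g) \<phi> \<longleftrightarrow> set_integrable lborel usquare (\<lambda>x. \<rho> x * \<phi> x)"
    unfolding area_def \<rho>(1) set_integrable_def integrable_density[OF m3 m2 nn]
    by (simp add: mult.assoc)
  show "(LINT x|area g. \<phi> x) = (LINT x:usquare|lborel. \<rho> x * \<phi> x)"
    unfolding area_def \<rho>(1) set_lebesgue_integral_def integral_density[OF m3 m2 nn]
    by (simp add: mult.assoc)
qed

lemma tsmooth_borel: "tsmooth (u :: real^2 \<Rightarrow> 'b::real_normed_vector) \<Longrightarrow> u \<in> borel_measurable borel"
  by (rule borel_measurable_continuous_onI[OF tsmooth_continuous])

lemma area_integral_tsmooth:
  assumes \<rho>: "\<And>x. sqrt (det (g x)) = \<rho> x" "\<And>x. \<rho> x \<ge> 0" "tsmooth \<rho>" and \<phi>: "tsmooth \<phi>"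
  shows "integrable (area g) \<phi>" "(LINT x|area g. \<phi> x) = integral usquare (\<lambda>x. \<rho> x * \<phi> x)"
proof -
  have "tsmooth (\<lambda>x. \<rho> x * \<phi> x)" by (intro tsmooth_intros \<rho> \<phi>)
  note c = set_integrable_continuous[OF tsmooth_continuous[OF this]]
  show "integrable (area g) \<phi>" "(LINT x|area g. \<phi> x) = integral usquare (\<lambda>x. \<rho> x * \<phi> x)"
    using c area_integral[OF \<rho> tsmooth_borel[OF \<phi>]] by auto
qed

lemma set_integrable_bound_mult:
  fixes \<psi> w :: "real^2 \<Rightarrow> real"
  assumes "tsmooth \<psi>" "set_integrable lborel usquare w"
  shows "set_integrable lborel usquare (\<lambda>x. w x * \<psi> x)"
proof -
  obtain C where C: "C \<ge> 0" "\<And>x. norm (\<psi> x) \<le> C" using tsmooth_bounded[OF assms(1)] by metis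
  have i: "integrable lborel (\<lambda>x. indicator usquare x *\<^sub>R w x)" using assms(2) by (simp add: set_integrable_def)
  have m: "\<psi> \<in> borel_measurable lborel" using tsmooth_borel[OF assms(1)] by simp
  have "integrable lborel (\<lambda>x. (indicator usquare x *\<^sub>R w x) * \<psi> x)"
  proof (rule Bochner_Integration.integrable_bound[OF integrable_mult_left[OF integrable_norm[OF i], of C]])
    show "(\<lambda>x. (indicator usquare x *\<^sub>R w x) * \<psi> x) \<in> borel_measurable lborel"
      using borel_measurable_integrable[OF i] m by measurable
    show "AE x in lborel. norm ((indicator usquare x *\<^sub>R w x) * \<psi> x) \<le> norm (norm (indicator usquare x *\<^sub>R w x) * C)"
      using C by (auto simp: abs_mult intro!: mult_left_mono)
  qed
  then show ?thesis by (simp add: set_integrable_def mult.assoc)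
qed

lemma matrix_inv_2:
  fixes A :: "real^2^2"
  assumes "det A \<noteq> 0"
  shows "matrix_inv A $ 1 $ 1 = A $ 2 $ 2 / det A" "matrix_inv A $ 1 $ 2 = - A $ 1 $ 2 / det A"
    "matrix_inv A $ 2 $ 1 = - A $ 2 $ 1 / det A" "matrix_inv A $ 2 $ 2 = A $ 1 $ 1 / det A"
proof -
  define B :: "real^2^2" where "B = (\<chi> i j. if i = 1 then (if j = 1 then A $ 2 $ 2 / det A else - A $ 1 $ 2 / det A)
     else (if j = 1 then - A $ 2 $ 1 / det A else A $ 1 $ 1 / det A))"
  have "invertible A" using assms by (simp add: invertible_det_nz)
  then have "A ** matrix_inv A = mat 1"
    unfolding matrix_inv_def invertible_def by (metis (mono_tags, lifting) someI_ex)
  moreover have "B ** A = mat 1"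
    using assms unfolding B_def
    by (simp add: vec_eq_iff forall_2 matrix_matrix_mult_def sum_2 mat_def det_2 divide_simps)
  ultimately have "matrix_inv A = B"
    by (metis matrix_mul_assoc matrix_mul_lid matrix_mul_rid)
  then show "matrix_inv A $ 1 $ 1 = A $ 2 $ 2 / det A" "matrix_inv A $ 1 $ 2 = - A $ 1 $ 2 / det A"
    "matrix_inv A $ 2 $ 1 = - A $ 2 $ 1 / det A" "matrix_inv A $ 2 $ 2 = A $ 1 $ 1 / det A"
    by (simp_all add: B_def)
qed

subsection \<open>Conformal invariants in an isothermal frame\<close>

locale isothermal_torus = torus_frame +
  fixes g0 :: "real^2 \<Rightarrow> real^2^2" and \<sigma> :: "real^2 \<Rightarrow> real"
  assumes metric: "riemannian_metric g0" and iso: "isothermal g0 \<sigma> \<alpha>1 \<alpha>2 \<beta>1 \<beta>2"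
begin

lemma sigma_pos: "\<sigma> x > 0" using iso by (simp add: isothermal_def)

lemma g0_entries: "g0 x $ 1 $ 1 = \<sigma> x * ((\<alpha>1 x)\<^sup>2 + (\<beta>1 x)\<^sup>2)"
  "g0 x $ 1 $ 2 = \<sigma> x * (\<alpha>1 x * \<alpha>2 x + \<beta>1 x * \<beta>2 x)" "g0 x $ 2 $ 1 = \<sigma> x * (\<alpha>1 x * \<alpha>2 x + \<beta>1 x * \<beta>2 x)"
  "g0 x $ 2 $ 2 = \<sigma> x * ((\<alpha>2 x)\<^sup>2 + (\<beta>2 x)\<^sup>2)"
  using iso by (simp_all add: isothermal_def)

lemma det_g0: "det (g0 x) = (\<sigma> x * Kd x)\<^sup>2"
  by (simp add: det_2 g0_entries Kd_def algebra_simps power2_eq_square)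

lemma sqrt_det_g0: "sqrt (det (g0 x)) = \<sigma> x * Kd x"
  using sigma_pos[of x] Kd_pos[of x] by (simp add: det_g0)

text \<open>In dimension two the area density times the inverse metric is conformally invariant:
  \<open>\<sigma>\<close> drops out. This makes the energy depend on the coframe only.\<close>

lemma inv_g0: "sqrt (det (g0 x)) * matrix_inv (g0 x) $ 1 $ 1 = ((\<alpha>2 x)\<^sup>2 + (\<beta>2 x)\<^sup>2) / Kd x"
  "sqrt (det (g0 x)) * matrix_inv (g0 x) $ 1 $ 2 = - (\<alpha>1 x * \<alpha>2 x + \<beta>1 x * \<beta>2 x) / Kd x"
  "sqrt (det (g0 x)) * matrix_inv (g0 x) $ 2 $ 1 = - (\<alpha>1 x * \<alpha>2 x + \<beta>1 x * \<beta>2 x) / Kd x"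
  "sqrt (det (g0 x)) * matrix_inv (g0 x) $ 2 $ 2 = ((\<alpha>1 x)\<^sup>2 + (\<beta>1 x)\<^sup>2) / Kd x"
proof -
  have "det (g0 x) \<noteq> 0" using sigma_pos[of x] Kd_pos[of x] by (simp add: det_g0)
  note m = matrix_inv_2[OF this]
  have s: "\<sigma> x \<noteq> 0" "Kd x \<noteq> 0" using sigma_pos[of x] Kd_pos[of x] by auto
  show "sqrt (det (g0 x)) * matrix_inv (g0 x) $ 1 $ 1 = ((\<alpha>2 x)\<^sup>2 + (\<beta>2 x)\<^sup>2) / Kd x"
    "sqrt (det (g0 x)) * matrix_inv (g0 x) $ 1 $ 2 = - (\<alpha>1 x * \<alpha>2 x + \<beta>1 x * \<beta>2 x) / Kd x"
    "sqrt (det (g0 x)) * matrix_inv (g0 x) $ 2 $ 1 = - (\<alpha>1 x * \<alpha>2 x + \<beta>1 x * \<beta>2 x) / Kd x"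
    "sqrt (det (g0 x)) * matrix_inv (g0 x) $ 2 $ 2 = ((\<alpha>1 x)\<^sup>2 + (\<beta>1 x)\<^sup>2) / Kd x"
    unfolding m sqrt_det_g0 unfolding det_g0 g0_entries using s
    by (simp_all add: power2_eq_square) (simp_all add: diff_divide_distrib add_divide_distrib)
qed

text \<open>The value of the covector \<open>w\<close> on the first frame field; \<open>e2\<close>
  belongs to the second. They are defined for arbitrary covector fields, since those in
  \<open>H1\<close> are not given as differentials.\<close>

definition e1 :: "(real^2 \<Rightarrow> real^2) \<Rightarrow> real^2 \<Rightarrow> real" where
  "e1 w x = (\<beta>2 x * w x $ 1 - \<beta>1 x * w x $ 2) / Kd x"

definition e2 :: "(real^2 \<Rightarrow> real^2) \<Rightarrow> real^2 \<Rightarrow> real" where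
  "e2 w x = (\<alpha>1 x * w x $ 2 - \<alpha>2 x * w x $ 1) / Kd x"

lemma conorm_e: "\<sigma> x * Kd x * conorm_sq g0 x (w x) = Kd x * ((e1 w x)\<^sup>2 + (e2 w x)\<^sup>2)"
proof -
  have "\<sigma> x * Kd x * conorm_sq g0 x (w x) = (sqrt (det (g0 x)) * matrix_inv (g0 x) $ 1 $ 1) * (w x $ 1)\<^sup>2
     + (sqrt (det (g0 x)) * matrix_inv (g0 x) $ 1 $ 2) * (w x $ 1 * w x $ 2)
     + (sqrt (det (g0 x)) * matrix_inv (g0 x) $ 2 $ 1) * (w x $ 1 * w x $ 2)
     + (sqrt (det (g0 x)) * matrix_inv (g0 x) $ 2 $ 2) * (w x $ 2)\<^sup>2"
    unfolding sqrt_det_g0 conorm_sq_def vec2_quadratic by (simp add: algebra_simps power2_eq_square)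
  also have "\<dots> = Kd x * ((e1 w x)\<^sup>2 + (e2 w x)\<^sup>2)"
    unfolding inv_g0 e1_def e2_def using Kd_nz[of x] by (simp add: field_simps power2_eq_square)
  finally show ?thesis .
qed

lemma conorm_nonneg: "conorm_sq g0 x (w x) \<ge> 0"
proof -
  have "0 \<le> \<sigma> x * Kd x * conorm_sq g0 x (w x)"
    unfolding conorm_e using Kd_pos[of x] by simp
  then show ?thesis
    using mult_pos_neg[OF mult_pos_pos[OF sigma_pos Kd_pos], of "conorm_sq g0 x (w x)" x x] by linarith
qed

lemma tsmooth_sigma_Kd: "tsmooth (\<lambda>x. \<sigma> x * Kd x)"
proof -
  have "tsmooth (\<lambda>x. g0 x $ 1 $ 1 * g0 x $ 2 $ 2 - g0 x $ 1 $ 2 * g0 x $ 2 $ 1)"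
    by (intro tsmooth_intros riemannian_metric_entries[OF metric])
  then have "tsmooth (\<lambda>x. det (g0 x))" unfolding det_2 .
  then have "tsmooth (\<lambda>x. sqrt (det (g0 x)))"
    by (intro tsmooth_intros riemannian_metric_entries[OF metric])
  then show ?thesis unfolding sqrt_det_g0 .
qed

lemma e_borel:
  assumes w: "w \<in> borel_measurable borel"
  shows "e1 w \<in> borel_measurable borel" "e2 w \<in> borel_measurable borel"
proof -
  have w1: "(\<lambda>x. w x $ i) \<in> borel_measurable borel" for i
    using measurable_comp[OF w borel_measurable_continuous_onI[OF linear_continuous_on[OF bounded_linear_vec_nth]], of i]
    by (simp add: o_def)
  note mm = tsmooth_borel[OF ts(1)] tsmooth_borel[OF ts(2)] tsmooth_borel[OF ts(3)] tsmooth_borel[OF ts(4)]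
    tsmooth_borel[OF tsmooth_Kd] w1[of 1] w1[of 2]
  show "e1 w \<in> borel_measurable borel" "e2 w \<in> borel_measurable borel"
    unfolding e1_def[abs_def] e2_def[abs_def] using mm by measurable
qed

lemma conorm_borel: "w \<in> borel_measurable borel \<Longrightarrow> (\<lambda>x. conorm_sq g0 x (w x)) \<in> borel_measurable borel"
proof -
  assume w: "w \<in> borel_measurable borel"
  have c: "conorm_sq g0 x (w x) = ((e1 w x)\<^sup>2 + (e2 w x)\<^sup>2) / \<sigma> x" for x
  proof -
    have "Kd x * (\<sigma> x * conorm_sq g0 x (w x)) = Kd x * ((e1 w x)\<^sup>2 + (e2 w x)\<^sup>2)"
      using conorm_e[of x w] by (simp add: mult_ac)
    then have "\<sigma> x * conorm_sq g0 x (w x) = (e1 w x)\<^sup>2 + (e2 w x)\<^sup>2" using Kd_nz[of x] by simp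
    then show ?thesis using sigma_pos[of x] by (simp add: field_simps)
  qed
  \<comment> \<open>The smoothness of \<open>\<sigma>\<close> is recovered here from the quotient of
    the area densities of the metric and of the coframe.\<close>
  have s: "\<sigma> = (\<lambda>x. \<sigma> x * Kd x / Kd x)" using Kd_nz by auto
  have "tsmooth \<sigma>" by (subst s) (intro tsmooth_divide tsmooth_sigma_Kd tsmooth_Kd Kd_nz)
  then show ?thesis
    unfolding c using tsmooth_borel[of \<sigma>] e_borel[OF w] by measurable
qed

lemma area_g0:
  assumes "w \<in> borel_measurable borel"
  shows "integrable (area g0) (\<lambda>x. conorm_sq g0 x (w x)) \<longleftrightarrow>
      set_integrable lborel usquare (\<lambda>x. Kd x * ((e1 w x)\<^sup>2 + (e2 w x)\<^sup>2))"
    "(LINT x|area g0. conorm_sq g0 x (w x)) = (LINT x:usquare|lborel. Kd x * ((e1 w x)\<^sup>2 + (e2 w x)\<^sup>2))"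
  using area_integral[OF sqrt_det_g0 _ tsmooth_sigma_Kd conorm_borel[OF assms]] sigma_pos Kd_pos
  unfolding conorm_e by (simp_all add: less_imp_le)

definition grad :: "(real^2 \<Rightarrow> real) \<Rightarrow> real^2 \<Rightarrow> real^2" where
  "grad u x = (\<chi> i. pd i u x)"

lemma e_grad: "e1 (grad u) x = D1 u x" "e2 (grad u) x = D2 u x"
  by (simp_all add: e1_def e2_def grad_def D1_def D2_def diff_divide_distrib)

text \<open>The conformal factor is omitted and the sign is opposite to that of
  \<open>laplace_beltrami\<close>; see \<open>laplace_beltrami_Lap\<close>.\<close>

definition Lap :: "(real^2 \<Rightarrow> 'b::real_normed_vector) \<Rightarrow> real^2 \<Rightarrow> 'b" where
  "Lap u x = D1 (D1 u) x + D2 (D2 u) x"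

lemma tsmooth_Lap [tsmooth_intros]: "tsmooth u \<Longrightarrow> tsmooth (Lap u)"
  unfolding Lap_def[abs_def] by (intro tsmooth_intros)

text \<open>The components of \<open>\<surd>det g0\<close> times the gradient of \<open>u\<close>.\<close>

definition flux1 :: "(real^2 \<Rightarrow> 'b::real_normed_vector) \<Rightarrow> real^2 \<Rightarrow> 'b" where
  "flux1 u x = \<beta>2 x *\<^sub>R D1 u x - \<alpha>2 x *\<^sub>R D2 u x"

definition flux2 :: "(real^2 \<Rightarrow> 'b::real_normed_vector) \<Rightarrow> real^2 \<Rightarrow> 'b" where
  "flux2 u x = \<alpha>1 x *\<^sub>R D2 u x - \<beta>1 x *\<^sub>R D1 u x"

lemma tsmooth_flux [tsmooth_intros]:
  "tsmooth u \<Longrightarrow> tsmooth (flux1 u)" "tsmooth u \<Longrightarrow> tsmooth (flux2 u)"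
  unfolding flux1_def[abs_def] flux2_def[abs_def] by (intro tsmooth_intros; assumption)+

text \<open>Closedness cancels the terms in which the coefficients of the fluxes are
  differentiated.\<close>

lemma div_flux:
  assumes u: "tsmooth u"
  shows "pd 1 (flux1 u) x + pd 2 (flux2 u) x = Kd x *\<^sub>R Lap u x"
proof -
  note td = tsmooth_differentiable[OF ts(1)] tsmooth_differentiable[OF ts(2)] tsmooth_differentiable[OF ts(3)]
    tsmooth_differentiable[OF ts(4)] tsmooth_differentiable[OF tsmooth_D1[OF u]] tsmooth_differentiable[OF tsmooth_D2[OF u]]
  have tf: "tsmooth (\<lambda>x. \<beta>2 x *\<^sub>R D1 u x)" "tsmooth (\<lambda>x. \<alpha>2 x *\<^sub>R D2 u x)"
    "tsmooth (\<lambda>x. \<alpha>1 x *\<^sub>R D2 u x)" "tsmooth (\<lambda>x. \<beta>1 x *\<^sub>R D1 u x)"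
    by (intro tsmooth_intros u)+
  note tdf = tf[THEN tsmooth_differentiable]
  have "pd 1 (flux1 u) x + pd 2 (flux2 u) x =
     (\<beta>2 x *\<^sub>R pd 1 (D1 u) x - \<beta>1 x *\<^sub>R pd 2 (D1 u) x) + (\<alpha>1 x *\<^sub>R pd 2 (D2 u) x - \<alpha>2 x *\<^sub>R pd 1 (D2 u) x)"
    unfolding flux1_def[abs_def] flux2_def[abs_def] pd_diff[OF tdf(1,2)] pd_diff[OF tdf(3,4)]
    by (simp add: pd_scaleR td closed_\<alpha> closed_\<beta> algebra_simps)
  also have "\<beta>2 x *\<^sub>R pd 1 (D1 u) x - \<beta>1 x *\<^sub>R pd 2 (D1 u) x = Kd x *\<^sub>R D1 (D1 u) x"
    using Kd_nz[of x] unfolding D1_def[of "D1 u"] by (simp add: scaleR_diff_right)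
  also have "\<alpha>1 x *\<^sub>R pd 2 (D2 u) x - \<alpha>2 x *\<^sub>R pd 1 (D2 u) x = Kd x *\<^sub>R D2 (D2 u) x"
    using Kd_nz[of x] unfolding D2_def[of "D2 u"] by (simp add: scaleR_diff_right)
  finally show ?thesis by (simp add: Lap_def scaleR_add_right)
qed

lemma flux_inv:
  "sqrt (det (g0 y)) *\<^sub>R (\<Sum>j\<in>UNIV. (matrix_inv (g0 y) $ 1 $ j) *\<^sub>R pd j u y) = flux1 u y"
  "sqrt (det (g0 y)) *\<^sub>R (\<Sum>j\<in>UNIV. (matrix_inv (g0 y) $ 2 $ j) *\<^sub>R pd j u y) = flux2 u y"
proof -
  have "sqrt (det (g0 y)) *\<^sub>R (\<Sum>j\<in>UNIV. (matrix_inv (g0 y) $ i $ j) *\<^sub>R pd j u y)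
     = (sqrt (det (g0 y)) * matrix_inv (g0 y) $ i $ 1) *\<^sub>R pd 1 u y + (sqrt (det (g0 y)) * matrix_inv (g0 y) $ i $ 2) *\<^sub>R pd 2 u y" for i
    by (simp add: sum_2 scaleR_add_right)
  note 1 = this[of 1, unfolded inv_g0] this[of 2, unfolded inv_g0]
  show "sqrt (det (g0 y)) *\<^sub>R (\<Sum>j\<in>UNIV. (matrix_inv (g0 y) $ 1 $ j) *\<^sub>R pd j u y) = flux1 u y"
    unfolding 1 flux1_def D1_def D2_def
    by (simp add: power2_eq_square algebra_simps add_divide_distrib diff_divide_distrib)
  show "sqrt (det (g0 y)) *\<^sub>R (\<Sum>j\<in>UNIV. (matrix_inv (g0 y) $ 2 $ j) *\<^sub>R pd j u y) = flux2 u y"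
    unfolding 1 flux2_def D1_def D2_def
    by (simp add: power2_eq_square algebra_simps add_divide_distrib diff_divide_distrib)
qed

lemma laplace_beltrami_Lap:
  assumes u: "tsmooth u"
  shows "laplace_beltrami g0 u x = - (1 / \<sigma> x) *\<^sub>R Lap u x"
proof -
  have "(\<Sum>i\<in>UNIV. pd i (\<lambda>y. sqrt (det (g0 y)) *\<^sub>R (\<Sum>j\<in>UNIV. (matrix_inv (g0 y) $ i $ j) *\<^sub>R pd j u y)) x)
     = Kd x *\<^sub>R Lap u x"
    by (subst sum_2) (simp only: flux_inv div_flux[OF u])
  then show ?thesis
    unfolding laplace_beltrami_def sqrt_det_g0 using Kd_nz[of x] by simp
qed

lemma Lap_by_parts:
  fixes u v :: "real^2 \<Rightarrow> 'b::euclidean_space"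
  assumes u: "tsmooth u" and v: "tsmooth v"
  shows "integral usquare (\<lambda>x. Kd x * (D1 u x \<bullet> D1 v x + D2 u x \<bullet> D2 v x)) = - integral usquare (\<lambda>x. Kd x * (u x \<bullet> Lap v x))"
proof -
  have "0 = integral usquare (\<lambda>x. Kd x * D1 (\<lambda>x. u x \<bullet> D1 v x) x) + integral usquare (\<lambda>x. Kd x * D2 (\<lambda>x. u x \<bullet> D2 v x) x)"
    by (simp add: integral_D tsmooth_inner tsmooth_D1 tsmooth_D2 u v)
  also have "\<dots> = integral usquare (\<lambda>x. Kd x * D1 (\<lambda>x. u x \<bullet> D1 v x) x + Kd x * D2 (\<lambda>x. u x \<bullet> D2 v x) x)"
    by (rule Henstock_Kurzweil_Integration.integral_add[symmetric]) (intro integrable_usquare tsmooth_intros u v)+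
  also have "(\<lambda>x. Kd x * D1 (\<lambda>x. u x \<bullet> D1 v x) x + Kd x * D2 (\<lambda>x. u x \<bullet> D2 v x) x)
    = (\<lambda>x. Kd x * (D1 u x \<bullet> D1 v x + D2 u x \<bullet> D2 v x) + Kd x * (u x \<bullet> Lap v x))"
    by (auto simp: D_inner u v tsmooth_D1 tsmooth_D2 Lap_def inner_add_right algebra_simps)
  also have "integral usquare \<dots> = integral usquare (\<lambda>x. Kd x * (D1 u x \<bullet> D1 v x + D2 u x \<bullet> D2 v x)) + integral usquare (\<lambda>x. Kd x * (u x \<bullet> Lap v x))"
    by (rule Henstock_Kurzweil_Integration.integral_add) (intro integrable_usquare tsmooth_intros u v)+
  finally show ?thesis by linarith
qed

end

lemma set_integrable_comparison:
  fixes \<phi> h :: "real^2 \<Rightarrow> real"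
  assumes "set_integrable lborel usquare h" "\<phi> \<in> borel_measurable borel" "\<And>x. \<bar>\<phi> x\<bar> \<le> h x"
  shows "set_integrable lborel usquare \<phi>"
  unfolding set_integrable_def
proof (rule Bochner_Integration.integrable_bound[OF assms(1)[unfolded set_integrable_def]])
  show "(\<lambda>x. indicator usquare x *\<^sub>R \<phi> x) \<in> borel_measurable lborel"
    using assms(2) by measurable
  have "h x \<ge> 0" for x using assms(3)[of x] by linarith
  then show "AE x in lborel. norm (indicator usquare x *\<^sub>R \<phi> x) \<le> norm (indicator usquare x *\<^sub>R h x)"
    using assms(3) by (auto simp: indicator_def)
qed

lemma set_integral_le:
  fixes \<phi> h :: "real^2 \<Rightarrow> real"
  assumes "set_integrable lborel usquare \<phi>" "set_integrable lborel usquare h" "\<And>x. \<phi> x \<le> h x"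
  shows "(LINT x:usquare|lborel. \<phi> x) \<le> (LINT x:usquare|lborel. h x)"
  by (rule set_integral_mono[OF assms(1,2)]) (rule assms(3))

section \<open>Branched minimal immersions and their Rayleigh quotients in the parallel
  frame\<close>

locale minimal_torus = isothermal_torus +
  fixes \<Phi> :: "real^2 \<Rightarrow> real^'m"
  assumes bmi: "branched_minimal_immersion g0 \<Phi>"
begin

lemma tsmooth_\<Phi> [tsmooth_intros]: "tsmooth \<Phi>"
  using bmi by (simp add: branched_minimal_immersion_def tsmooth_def)

lemma \<Phi>_unit: "\<Phi> x \<bullet> \<Phi> x = 1"
proof -
  have "norm (\<Phi> x) = 1" using bmi by (simp add: branched_minimal_immersion_def)
  then show ?thesis by (simp add: power2_norm_eq_inner[symmetric])
qed

text \<open>The density of the induced metric relative to the coframe, not to \<open>g0\<close>: the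
  two differ by the factor \<open>\<sigma>\<close>. It vanishes exactly at the branch
  points.\<close>

definition f :: "real^2 \<Rightarrow> real" where "f x = D1 \<Phi> x \<bullet> D1 \<Phi> x"

lemma tsmooth_f [tsmooth_intros]: "tsmooth f"
  unfolding f_def[abs_def] by (intro tsmooth_intros)

lemma f_nonneg: "f x \<ge> 0" by (simp add: f_def)

lemma conformal: "D2 \<Phi> x \<bullet> D2 \<Phi> x = f x" "D1 \<Phi> x \<bullet> D2 \<Phi> x = 0"
proof -
  have "D2 \<Phi> x \<bullet> D2 \<Phi> x = D1 \<Phi> x \<bullet> D1 \<Phi> x \<and> D1 \<Phi> x \<bullet> D2 \<Phi> x = 0"
  proof (cases "frechet_derivative \<Phi> (at x) = (\<lambda>_. 0)")
    case True
    then show ?thesis by (simp add: D1_def D2_def pd_def)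
  next
    case False
    then obtain c where c: "induced_metric \<Phi> x = c *\<^sub>R g0 x"
      using bmi unfolding branched_minimal_immersion_def by blast
    have p: "pd i \<Phi> x \<bullet> pd j \<Phi> x = c * g0 x $ i $ j" for i j
      using arg_cong[OF c, of "\<lambda>m. m $ i $ j"] by (simp add: induced_metric_def)
    define a b where "a = D1 \<Phi> x" and "b = D2 \<Phi> x"
    have Ka: "Kd x *\<^sub>R a = \<beta>2 x *\<^sub>R pd 1 \<Phi> x - \<beta>1 x *\<^sub>R pd 2 \<Phi> x"
      and Kb: "Kd x *\<^sub>R b = \<alpha>1 x *\<^sub>R pd 2 \<Phi> x - \<alpha>2 x *\<^sub>R pd 1 \<Phi> x"
      using Kd_nz[of x] by (simp_all add: a_def b_def D1_def D2_def scaleR_diff_right)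
    have p21: "pd 2 \<Phi> x \<bullet> pd 1 \<Phi> x = pd 1 \<Phi> x \<bullet> pd 2 \<Phi> x" by (rule inner_commute)
    have K2: "(Kd x)\<^sup>2 * (y \<bullet> z) = (Kd x *\<^sub>R y) \<bullet> (Kd x *\<^sub>R z)" for y z :: "real^'m"
      by (simp add: power2_eq_square)
    have k1: "(Kd x)\<^sup>2 * (a \<bullet> a) = c * \<sigma> x * ((Kd x)\<^sup>2 * 1)"
      unfolding K2 Ka unfolding inner_diff_left inner_diff_right inner_scaleR_left inner_scaleR_right p21 p g0_entries Kd_def
      by (simp add: algebra_simps power2_eq_square)
    have k2: "(Kd x)\<^sup>2 * (b \<bullet> b) = c * \<sigma> x * ((Kd x)\<^sup>2 * 1)"
      unfolding K2 Kb unfolding inner_diff_left inner_diff_right inner_scaleR_left inner_scaleR_right p21 p g0_entries Kd_def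
      by (simp add: algebra_simps power2_eq_square)
    have k3: "(Kd x)\<^sup>2 * (a \<bullet> b) = 0"
      unfolding K2 Ka Kb unfolding inner_diff_left inner_diff_right inner_scaleR_left inner_scaleR_right p21 p g0_entries
      by (simp add: algebra_simps power2_eq_square)
    show ?thesis using k1 k2 k3 Kd_nz[of x] unfolding a_def b_def by simp
  qed
  then show "D2 \<Phi> x \<bullet> D2 \<Phi> x = f x" "D1 \<Phi> x \<bullet> D2 \<Phi> x = 0" by (simp_all add: f_def)
qed

lemma induced_det: "sqrt (det (induced_metric \<Phi> x)) = f x * Kd x"
proof -
  have "det (induced_metric \<Phi> x) = (f x * Kd x)\<^sup>2"
    unfolding det_2 induced_metric_def vec_lambda_beta pd_D[of \<Phi>]
      inner_add_left inner_add_right inner_scaleR_left inner_scaleR_right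
      inner_commute[of "D2 \<Phi> x" "D1 \<Phi> x"] conformal f_def[symmetric]
    by (simp add: Kd_def algebra_simps power2_eq_square)
  then show ?thesis using f_nonneg[of x] Kd_pos[of x] by simp
qed

text \<open>Harmonicity says that \<open>Lap \<Phi>\<close> is normal to the sphere. Its normal part
  comes from differentiating the constant length of \<open>\<Phi>\<close> twice in each frame
  direction. This is the eigenvalue equation with eigenvalue 2.\<close>

lemma Lap_\<Phi>: "Lap \<Phi> x = - (2 * f x) *\<^sub>R \<Phi> x"
proof -
  have "laplace_beltrami g0 \<Phi> x = (laplace_beltrami g0 \<Phi> x \<bullet> \<Phi> x) *\<^sub>R \<Phi> x"
    using bmi by (simp add: branched_minimal_immersion_def harmonic_into_sphere_def)
  then have "(1 / \<sigma> x) *\<^sub>R Lap \<Phi> x = (1 / \<sigma> x) *\<^sub>R ((Lap \<Phi> x \<bullet> \<Phi> x) *\<^sub>R \<Phi> x)"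
    unfolding laplace_beltrami_Lap[OF tsmooth_\<Phi>] by simp
  from arg_cong[OF this, of "\<lambda>v. \<sigma> x *\<^sub>R v"]
  have L: "Lap \<Phi> x = (Lap \<Phi> x \<bullet> \<Phi> x) *\<^sub>R \<Phi> x"
    using sigma_pos[of x] by (simp add: less_imp_neq[symmetric])
  have u1: "(\<lambda>x. \<Phi> x \<bullet> \<Phi> x) = (\<lambda>x. 1)" using \<Phi>_unit by auto
  have z: "\<Phi> y \<bullet> D1 \<Phi> y = 0" "\<Phi> y \<bullet> D2 \<Phi> y = 0" for y
    using D_inner[OF tsmooth_\<Phi> tsmooth_\<Phi>, of y] unfolding u1 by (simp_all add: inner_commute)
  have u2: "(\<lambda>y. \<Phi> y \<bullet> D1 \<Phi> y) = (\<lambda>y. 0)" "(\<lambda>y. \<Phi> y \<bullet> D2 \<Phi> y) = (\<lambda>y. 0)" using z by auto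
  have "\<Phi> x \<bullet> D1 (D1 \<Phi>) x = - f x" "\<Phi> x \<bullet> D2 (D2 \<Phi>) x = - f x"
    using D_inner(1)[OF tsmooth_\<Phi> tsmooth_D1[OF tsmooth_\<Phi>], of x] D_inner(2)[OF tsmooth_\<Phi> tsmooth_D2[OF tsmooth_\<Phi>], of x]
    unfolding u2 conformal f_def[symmetric] by simp_all
  then have "Lap \<Phi> x \<bullet> \<Phi> x = - 2 * f x" by (simp add: Lap_def inner_add_left inner_add_right inner_commute)
  then show ?thesis using L by simp
qed

lemma \<Phi>_orth: "\<Phi> x \<bullet> D1 \<Phi> x = 0" "\<Phi> x \<bullet> D2 \<Phi> x = 0"
proof -
  have u1: "(\<lambda>x. \<Phi> x \<bullet> \<Phi> x) = (\<lambda>x. 1)" using \<Phi>_unit by auto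
  show "\<Phi> x \<bullet> D1 \<Phi> x = 0" "\<Phi> x \<bullet> D2 \<Phi> x = 0"
    using D_inner[OF tsmooth_\<Phi> tsmooth_\<Phi>, of x] unfolding u1 by (simp_all add: inner_commute)
qed

abbreviation g :: "real^2 \<Rightarrow> real^2^2" where "g \<equiv> induced_metric \<Phi>"

lemma tsmooth_fK: "tsmooth (\<lambda>x. f x * Kd x)" by (intro tsmooth_intros)

lemma fK_nonneg: "f x * Kd x \<ge> 0" using f_nonneg[of x] Kd_pos[of x] by simp

lemmas area_g = area_integral[of g, OF induced_det fK_nonneg tsmooth_fK]
lemmas area_g_tsmooth = area_integral_tsmooth[of g, OF induced_det fK_nonneg tsmooth_fK]

lemma conorm_nonneg_vec: "conorm_sq g0 x y \<ge> 0"
  using conorm_nonneg[of x "\<lambda>_. y"] .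

lemma grad_regular: "tsmooth u \<Longrightarrow> grad u \<in> borel_measurable borel" "tsmooth u \<Longrightarrow> periodic (grad u)"
  "tsmooth u \<Longrightarrow> continuous_on UNIV (grad u)"
proof -
  assume u: "tsmooth u"
  show c: "continuous_on UNIV (grad u)"
    unfolding grad_def by (intro continuous_on_vec_lambda tsmooth_continuous[OF tsmooth_pd[OF u]])
  show "grad u \<in> borel_measurable borel" by (rule borel_measurable_continuous_onI[OF c])
  show "periodic (grad u)"
    using tsmooth_periodic[OF tsmooth_pd[OF u]] by (simp add: periodic_def grad_def)
qed

lemma energy_grad:
  assumes u: "tsmooth u"
  shows "integrable (area g0) (\<lambda>x. conorm_sq g0 x (grad u x))"
    "(LINT x|area g0. conorm_sq g0 x (grad u x)) = integral usquare (\<lambda>x. Kd x * ((D1 u x)\<^sup>2 + (D2 u x)\<^sup>2))"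
proof -
  have "tsmooth (\<lambda>x. Kd x * ((D1 u x)\<^sup>2 + (D2 u x)\<^sup>2))" by (intro tsmooth_intros u)
  note c = set_integrable_continuous[OF tsmooth_continuous[OF this]]
  show "integrable (area g0) (\<lambda>x. conorm_sq g0 x (grad u x))"
    "(LINT x|area g0. conorm_sq g0 x (grad u x)) = integral usquare (\<lambda>x. Kd x * ((D1 u x)\<^sup>2 + (D2 u x)\<^sup>2))"
    using c area_g0[OF grad_regular(1)[OF u]] by (simp_all add: e_grad)
qed

lemma grad_in_pre_H1:
  assumes u: "tsmooth u"
  shows "(u, grad u) \<in> pre_H1 g0 g"
proof -
  have "tsmooth (\<lambda>x. (u x)\<^sup>2)" by (intro tsmooth_intros u)
  then have i: "integrable (area g) (\<lambda>x. (u x)\<^sup>2)" by (rule area_g_tsmooth(1))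
  have "weak_differential u (grad u)"
    unfolding weak_differential_def
  proof (intro conjI allI impI)
    show "set_integrable lborel usquare u" by (rule set_integrable_continuous(1)[OF tsmooth_continuous[OF u]])
    show "set_integrable lborel usquare (grad u)"
      by (rule set_integrable_continuous(1)[OF grad_regular(3)[OF u]])
    fix \<phi> :: "real^2 \<Rightarrow> real" and i
    assume "smooth_map \<phi> \<and> periodic \<phi>"
    then have p: "tsmooth \<phi>" by (simp add: tsmooth_def)
    have t: "tsmooth (\<lambda>x. u x * pd i \<phi> x)" "tsmooth (\<lambda>x. pd i u x * \<phi> x)" by (intro tsmooth_intros u p)+
    show "(LINT x:usquare|lborel. u x * pd i \<phi> x) = - (LINT x:usquare|lborel. grad u x $ i * \<phi> x)"
      using integral_by_parts[OF u p, of i] set_integrable_continuous(2)[OF tsmooth_continuous[OF t(1)]]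
        set_integrable_continuous(2)[OF tsmooth_continuous[OF t(2)]]
      by (simp add: grad_def)
  qed
  then show ?thesis
    using i energy_grad(1)[OF u] grad_regular[OF u] tsmooth_borel[OF u] tsmooth_periodic[OF u]
    by (simp add: pre_H1_def L2_pairs_def)
qed

lemma grad_in_H1:
  assumes u: "tsmooth u"
  shows "(u, grad u) \<in> H1 g0 g"
proof -
  have "H1_norm_sq g0 g (\<lambda>x. u x - u x) (\<lambda>x. grad u x - grad u x) = 0"
    by (simp add: H1_norm_sq_def conorm_sq_def)
  then show ?thesis
    using grad_in_pre_H1[OF u] unfolding H1_def pre_H1_def
    by (auto intro!: exI[of _ "\<lambda>_. u"] exI[of _ "\<lambda>_. grad u"])
qed

text \<open>If the weighted norm of \<open>u\<close> vanishes, then \<open>u\<close> is not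
  admissible, but the claim only says that the energy is nonnegative. Otherwise the pair of
  \<open>u\<close> and its gradient competes in the infimum, whose set is bounded below by
  0.\<close>

lemma lambda1_le:
  assumes u: "tsmooth u" and mean: "integral usquare (\<lambda>x. f x * Kd x * u x) = 0"
  shows "lambda1 g0 g * integral usquare (\<lambda>x. f x * Kd x * (u x)\<^sup>2)
    \<le> integral usquare (\<lambda>x. Kd x * ((D1 u x)\<^sup>2 + (D2 u x)\<^sup>2))"
proof -
  have tu2: "tsmooth (\<lambda>x. (u x)\<^sup>2)" by (intro tsmooth_intros u)
  let ?n = "integral usquare (\<lambda>x. f x * Kd x * (u x)\<^sup>2)"
  let ?e = "integral usquare (\<lambda>x. Kd x * ((D1 u x)\<^sup>2 + (D2 u x)\<^sup>2))"
  have n: "(LINT x|area g. (u x)\<^sup>2) = ?n" by (rule area_g_tsmooth(2)[OF tu2])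
  have e0: "?e \<ge> 0"
    using Kd_pos by (intro Henstock_Kurzweil_Integration.integral_nonneg integrable_usquare tsmooth_intros u)
      (simp add: less_imp_le)
  show ?thesis
  proof (cases "?n = 0")
    case True
    then show ?thesis using e0 by simp
  next
    case False
    have n0: "?n > 0"
      using False n Bochner_Integration.integral_nonneg[of "area g" "\<lambda>x. (u x)\<^sup>2"] by simp
    have "\<not> (AE x in area g. u x = 0)"
    proof
      assume "AE x in area g. u x = 0"
      then have "AE x in area g. (u x)\<^sup>2 = 0" by eventually_elim simp
      from integral_eq_zero_AE[OF this] show False using False n by simp
    qed
    then have "admissible g0 g u (grad u)"
      using grad_in_H1[OF u] mean area_g_tsmooth(2)[OF u] by (simp add: admissible_def)
    then have "lambda1 g0 g \<le> rayleigh g0 g u (grad u)"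
      unfolding lambda1_def
    proof (intro cInf_lower bdd_belowI[of _ 0])
      fix y assume "y \<in> {rayleigh g0 g u w |u w. admissible g0 g u w}"
      then show "0 \<le> y"
        unfolding rayleigh_def by (auto intro!: divide_nonneg_nonneg Bochner_Integration.integral_nonneg conorm_nonneg_vec)
    qed auto
    also have "\<dots> = ?e / ?n" unfolding rayleigh_def n energy_grad(2)[OF u] by (rule refl)
    finally show ?thesis using n0 by (simp add: field_simps)
  qed
qed

lemma e_flux: "Kd x * (e1 w x * D1 v x + e2 w x * D2 v x) = w x $ 1 * flux1 v x + w x $ 2 * flux2 v x"
  using Kd_nz[of x] by (simp add: e1_def e2_def flux1_def flux2_def field_simps)

text \<open>Green's formula, by testing the weak differential with the two flux components of
  \<open>v\<close>. It moves all derivatives onto \<open>v\<close>, a form that survives limits in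
  the weighted norm when \<open>v\<close> is an eigenfunction.\<close>

lemma pre_H1_weak:
  assumes UW: "(U, W) \<in> pre_H1 g0 g" and v: "tsmooth v"
  shows "set_integrable lborel usquare (\<lambda>x. Kd x * (e1 W x * D1 v x + e2 W x * D2 v x))"
    "set_integrable lborel usquare (\<lambda>x. U x * (Kd x * Lap v x))"
    "(LINT x:usquare|lborel. Kd x * (e1 W x * D1 v x + e2 W x * D2 v x)) = - (LINT x:usquare|lborel. U x * (Kd x * Lap v x))"
proof -
  have wd: "weak_differential U W" using UW by (simp add: pre_H1_def)
  then have iU: "set_integrable lborel usquare U" and iW: "set_integrable lborel usquare W"
    by (simp_all add: weak_differential_def)
  have iWi: "set_integrable lborel usquare (\<lambda>x. W x $ i)" for i
    using integrable_bounded_linear[OF bounded_linear_vec_nth iW[unfolded set_integrable_def], of i]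
    by (simp add: set_integrable_def)
  have tf: "tsmooth (flux1 v)" "tsmooth (flux2 v)" by (intro tsmooth_intros v)+
  note I1 = set_integrable_bound_mult[OF tf(1) iWi] set_integrable_bound_mult[OF tf(2) iWi]
  note I2 = set_integrable_bound_mult[OF tsmooth_pd[OF tf(1)] iU] set_integrable_bound_mult[OF tsmooth_pd[OF tf(2)] iU]
  show "set_integrable lborel usquare (\<lambda>x. Kd x * (e1 W x * D1 v x + e2 W x * D2 v x))"
    unfolding e_flux by (intro set_integral_add(1) I1)
  have d: "U x * (Kd x * Lap v x) = U x * pd 1 (flux1 v) x + U x * pd 2 (flux2 v) x" for x
    using div_flux[OF v, of x] by (simp add: distrib_left[symmetric])
  show "set_integrable lborel usquare (\<lambda>x. U x * (Kd x * Lap v x))"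
    unfolding d by (intro set_integral_add(1) I2)
  have w: "(LINT x:usquare|lborel. U x * pd i \<psi> x) = - (LINT x:usquare|lborel. W x $ i * \<psi> x)" if "tsmooth \<psi>" for \<psi> i
    using wd that unfolding weak_differential_def tsmooth_def by blast
  show "(LINT x:usquare|lborel. Kd x * (e1 W x * D1 v x + e2 W x * D2 v x)) = - (LINT x:usquare|lborel. U x * (Kd x * Lap v x))"
    unfolding e_flux d set_integral_add(2)[OF I1] set_integral_add(2)[OF I2] w[OF tf(1)] w[OF tf(2)] by simp
qed

text \<open>
  Elements of the completion need not be weakly differentiable a priori, since \<open>f\<close> may vanish. But
  integration by parts against an eigenfunction involves \<open>f\<close>-weighted products only, and passes to
  the limit.
\<close>

lemma H1_weak_eigen:
  assumes H: "(v, w) \<in> H1 g0 g" and v: "tsmooth v" and eig: "\<And>x. Lap v x = - 2 * f x * v x"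
  shows "set_integrable lborel usquare (\<lambda>x. Kd x * (e1 w x * D1 v x + e2 w x * D2 v x))"
    "(LINT x:usquare|lborel. Kd x * (e1 w x * D1 v x + e2 w x * D2 v x)) = 2 * integral usquare (\<lambda>x. f x * Kd x * (v x)\<^sup>2)"
proof -
  let ?S = "\<lambda>\<phi>. LINT x:usquare|lborel. (\<phi> x :: real)"
  define X where "X w x = Kd x * ((e1 w x)\<^sup>2 + (e2 w x)\<^sup>2)" for w x
  define Y where "Y u x = f x * Kd x * (u x)\<^sup>2" for u :: "real^2 \<Rightarrow> real" and x
  define B where "B w x = Kd x * (e1 w x * D1 v x + e2 w x * D2 v x)" for w x
  obtain U W where UW: "\<And>k. (U k, W k) \<in> pre_H1 g0 g"
    and lim: "(\<lambda>k::nat. H1_norm_sq g0 g (\<lambda>x. U k x - v x) (\<lambda>x. W k x - w x)) \<longlonglongrightarrow> 0"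
    using H unfolding H1_def by blast
  have L2: "(v, w) \<in> L2_pairs g0 g" using H unfolding H1_def by blast
  have bw: "w \<in> borel_measurable borel" and bW: "\<And>k. W k \<in> borel_measurable borel"
    and bU: "\<And>k. U k \<in> borel_measurable borel" and bv: "v \<in> borel_measurable borel"
    using L2 UW by (auto simp: L2_pairs_def pre_H1_def)
  have bWw: "(\<lambda>x. W k x - w x) \<in> borel_measurable borel" for k by (intro borel_measurable_diff bw bW)
  have bUv: "(\<lambda>x. U k x - v x) \<in> borel_measurable borel" for k by (intro borel_measurable_diff bv bU)
  have iX: "set_integrable lborel usquare (X w)" "\<And>k. set_integrable lborel usquare (X (W k))"
    using L2 UW area_g0(1)[OF bw] area_g0(1)[OF bW] unfolding X_def[abs_def] L2_pairs_def pre_H1_def by auto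
  have iY: "set_integrable lborel usquare (Y v)" "\<And>k. set_integrable lborel usquare (Y (U k))"
    using L2 UW area_g(1)[of "\<lambda>x. (v x)\<^sup>2"] area_g(1)[of "\<lambda>x. (U _ x)\<^sup>2"] borel_measurable_power[OF bv] borel_measurable_power[OF bU]
    unfolding Y_def[abs_def] L2_pairs_def pre_H1_def by auto
  have eD: "e1 (\<lambda>x. p x - q x) x = e1 p x - e1 q x" "e2 (\<lambda>x. p x - q x) x = e2 p x - e2 q x" for p q x
    by (simp_all add: e1_def e2_def algebra_simps diff_divide_distrib add_divide_distrib)
  note mb = tsmooth_borel[OF tsmooth_Kd] tsmooth_borel[OF tsmooth_f] tsmooth_borel[OF tsmooth_D1[OF v]] tsmooth_borel[OF tsmooth_D2[OF v]] bv
  have mX: "X p \<in> borel_measurable borel" if "p \<in> borel_measurable borel" for p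
    unfolding X_def[abs_def] using mb e_borel[OF that] by measurable
  have mY: "Y p \<in> borel_measurable borel" if "p \<in> borel_measurable borel" for p
    unfolding Y_def[abs_def] using mb that by measurable
  have mB: "B p \<in> borel_measurable borel" if "p \<in> borel_measurable borel" for p
    unfolding B_def[abs_def] using mb e_borel[OF that] by measurable
  have sq: "(a - b)\<^sup>2 \<le> 2 * a\<^sup>2 + 2 * b\<^sup>2" for a b :: real
    using zero_le_power2[of "a + b"] by (simp add: power2_eq_square algebra_simps)
  have X0: "X p x \<ge> 0" and Y0: "Y u x \<ge> 0" for p u x
    using Kd_pos[of x] f_nonneg[of x] by (auto simp: X_def Y_def)
  have iXd: "set_integrable lborel usquare (X (\<lambda>x. W k x - w x))" for k
  proof (rule set_integrable_comparison[OF _ mX[OF bWw]])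
    show "set_integrable lborel usquare (\<lambda>x. 2 * X (W k) x + 2 * X w x)"
      by (intro set_integral_add(1) set_integrable_mult_right iX)
    fix x
    have "(e1 (W k) x - e1 w x)\<^sup>2 + (e2 (W k) x - e2 w x)\<^sup>2
        \<le> 2 * ((e1 (W k) x)\<^sup>2 + (e2 (W k) x)\<^sup>2) + 2 * ((e1 w x)\<^sup>2 + (e2 w x)\<^sup>2)"
      using sq[of "e1 (W k) x" "e1 w x"] sq[of "e2 (W k) x" "e2 w x"] unfolding distrib_left by linarith
    from mult_left_mono[OF this less_imp_le[OF Kd_pos]]
    have "X (\<lambda>x. W k x - w x) x \<le> 2 * X (W k) x + 2 * X w x"
      unfolding X_def eD by (simp add: algebra_simps)
    then show "\<bar>X (\<lambda>x. W k x - w x) x\<bar> \<le> 2 * X (W k) x + 2 * X w x" using X0 by simp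
  qed
  have iYd: "set_integrable lborel usquare (Y (\<lambda>x. U k x - v x))" for k
  proof (rule set_integrable_comparison[OF _ mY[OF bUv]])
    show "set_integrable lborel usquare (\<lambda>x. 2 * Y (U k) x + 2 * Y v x)"
      by (intro set_integral_add(1) set_integrable_mult_right iY)
    fix x
    from mult_left_mono[OF sq[of "U k x" "v x"] fK_nonneg[of x]]
    have "Y (\<lambda>x. U k x - v x) x \<le> 2 * Y (U k) x + 2 * Y v x"
      unfolding Y_def by (simp add: algebra_simps)
    then show "\<bar>Y (\<lambda>x. U k x - v x) x\<bar> \<le> 2 * Y (U k) x + 2 * Y v x" using Y0 by simp
  qed
  define N where "N k = ?S (X (\<lambda>x. W k x - w x)) + ?S (Y (\<lambda>x. U k x - v x))" for k
  have N: "N \<longlonglongrightarrow> 0"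
  proof -
    have "H1_norm_sq g0 g (\<lambda>x. U k x - v x) (\<lambda>x. W k x - w x) = N k" for k
      using area_g0(2)[OF bWw, of k] area_g(2)[OF borel_measurable_power[OF bUv, of k 2]]
      unfolding H1_norm_sq_def N_def X_def[abs_def] Y_def[abs_def] by simp
    then show ?thesis using lim by simp
  qed
  define V where "V x = Kd x * ((D1 v x)\<^sup>2 + (D2 v x)\<^sup>2)" for x
  have tV: "tsmooth V" unfolding V_def[abs_def] by (intro tsmooth_intros v)
  have iV: "set_integrable lborel usquare V" by (rule set_integrable_continuous(1)[OF tsmooth_continuous[OF tV]])
  have young: "\<bar>a * b + c * d\<bar> \<le> (a\<^sup>2 + c\<^sup>2) / \<delta> + \<delta> * (b\<^sup>2 + d\<^sup>2)" if "\<delta> > 0" for a b c d \<delta> :: real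
  proof -
    have y: "\<bar>p * q\<bar> \<le> p\<^sup>2 / \<delta> + \<delta> * q\<^sup>2" for p q :: real
    proof -
      have "0 \<le> (\<bar>p\<bar> - \<delta> * \<bar>q\<bar>)\<^sup>2" by simp
      then have "2 * (\<delta> * \<bar>p * q\<bar>) \<le> p\<^sup>2 + \<delta>\<^sup>2 * q\<^sup>2"
        by (simp add: power2_diff power_mult_distrib abs_mult algebra_simps)
      moreover have "0 \<le> \<delta> * \<bar>p * q\<bar>" using that by simp
      ultimately have "\<delta> * \<bar>p * q\<bar> \<le> p\<^sup>2 + \<delta>\<^sup>2 * q\<^sup>2" by linarith
      then show ?thesis using that by (simp add: field_simps power2_eq_square)
    qed
    have "\<bar>a * b + c * d\<bar> \<le> (a\<^sup>2 / \<delta> + \<delta> * b\<^sup>2) + (c\<^sup>2 / \<delta> + \<delta> * d\<^sup>2)"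
      using y[of a b] y[of c d] by linarith
    then show ?thesis by (simp add: add_divide_distrib distrib_left)
  qed
  show iB: "set_integrable lborel usquare (\<lambda>x. Kd x * (e1 w x * D1 v x + e2 w x * D2 v x))"
  proof -
    have "set_integrable lborel usquare (B w)"
    proof (rule set_integrable_comparison[OF _ mB[OF bw]])
      show "set_integrable lborel usquare (\<lambda>x. X w x + V x)" by (intro set_integral_add(1) iX iV)
      fix x
      have "\<bar>B w x\<bar> = Kd x * \<bar>e1 w x * D1 v x + e2 w x * D2 v x\<bar>"
        unfolding B_def abs_mult using Kd_pos[of x] by simp
      also have "\<dots> \<le> Kd x * (((e1 w x)\<^sup>2 + (e2 w x)\<^sup>2) / 1 + 1 * ((D1 v x)\<^sup>2 + (D2 v x)\<^sup>2))"
        by (intro mult_left_mono young less_imp_le[OF Kd_pos]) simp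
      also have "\<dots> = X w x + V x" by (simp add: X_def V_def distrib_left)
      finally show "\<bar>B w x\<bar> \<le> X w x + V x" .
    qed
    then show ?thesis by (simp add: B_def[abs_def])
  qed
  have iB': "set_integrable lborel usquare (B w)" using iB by (simp add: B_def[abs_def])
  define Z where "Z = ?S (B w) - 2 * ?S (Y v)"
  have Z: "\<bar>Z\<bar> \<le> N k / \<delta> + \<delta> * (?S V + 4 * ?S (Y v))" if d: "\<delta> > 0" for k \<delta>
  proof -
    let ?h = "\<lambda>x. 2 * (f x * Kd x * U k x * v x)"
    have L: "U k x * (Kd x * Lap v x) = - ?h x" for x by (simp add: eig)
    note weak = pre_H1_weak[OF UW v, of k, unfolded L, folded B_def]
    have ih: "set_integrable lborel usquare ?h"
      using set_integrable_mult_right[of "-1" lborel usquare, OF weak(2)] by simp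
    have Bh: "?S (B (W k)) = ?S ?h"
      using weak(3) unfolding set_lebesgue_integral_def by simp
    have iBk: "set_integrable lborel usquare (B (W k))" using weak(1) .
    \<comment> \<open>The inserted terms \<open>B (W k)\<close> and \<open>?h\<close> have equal
      integrals, so \<open>\<Psi>\<close> integrates to \<open>Z\<close>. Each bracket is now linear
      in a difference that the norm of the completion controls.\<close>
    define \<Psi> where "\<Psi> x = (B w x - B (W k) x) + (?h x - 2 * Y v x)" for x
    have i\<Psi>: "set_integrable lborel usquare \<Psi>"
      unfolding \<Psi>_def by (intro set_integral_add(1) set_integral_diff(1) set_integrable_mult_right iB' iBk ih iY)
    have "?S \<Psi> = (?S (B w) - ?S (B (W k))) + (?S ?h - 2 * ?S (Y v))"
      unfolding \<Psi>_def
      by (simp add: set_integral_add set_integral_diff iB' iBk ih iY)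
    then have ZP: "Z = ?S \<Psi>" unfolding Bh Z_def by simp
    define b where "b x = (X (\<lambda>x. W k x - w x) x + Y (\<lambda>x. U k x - v x) x) / \<delta> + \<delta> * (V x + 4 * Y v x)" for x
    have ib: "set_integrable lborel usquare b"
      unfolding b_def by (intro set_integral_add(1) set_integrable_divide set_integrable_mult_right iXd iYd iV iY)
    have Sb: "?S b = N k / \<delta> + \<delta> * (?S V + 4 * ?S (Y v))"
      unfolding b_def N_def
      by (simp add: set_integral_add set_integrable_divide set_integrable_mult_right iXd iYd iV iY)
    have pt: "\<bar>\<Psi> x\<bar> \<le> b x" for x
    proof -
      \<comment> \<open>The summand \<open>0 * 0\<close> makes the second term fit the four-variable
        form of \<open>young\<close>.\<close>
      have P: "\<Psi> x = - (Kd x * (e1 (\<lambda>x. W k x - w x) x * D1 v x + e2 (\<lambda>x. W k x - w x) x * D2 v x))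
          + f x * Kd x * ((U k x - v x) * (2 * v x) + 0 * 0)"
        unfolding \<Psi>_def B_def Y_def eD by (simp add: algebra_simps power2_eq_square)
      have "\<bar>\<Psi> x\<bar> \<le> Kd x * \<bar>e1 (\<lambda>x. W k x - w x) x * D1 v x + e2 (\<lambda>x. W k x - w x) x * D2 v x\<bar>
          + f x * Kd x * \<bar>(U k x - v x) * (2 * v x) + 0 * 0\<bar>"
        unfolding P using Kd_pos[of x] fK_nonneg[of x]
        by (intro order_trans[OF abs_triangle_ineq]) (simp add: abs_mult f_nonneg)
      also have "\<dots> \<le> Kd x * (((e1 (\<lambda>x. W k x - w x) x)\<^sup>2 + (e2 (\<lambda>x. W k x - w x) x)\<^sup>2) / \<delta> + \<delta> * ((D1 v x)\<^sup>2 + (D2 v x)\<^sup>2))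
          + f x * Kd x * (((U k x - v x)\<^sup>2 + 0\<^sup>2) / \<delta> + \<delta> * ((2 * v x)\<^sup>2 + 0\<^sup>2))"
        by (intro add_mono mult_left_mono young d less_imp_le[OF Kd_pos] fK_nonneg)
      also have "\<dots> = b x"
        unfolding b_def X_def Y_def V_def by (simp add: distrib_left add_divide_distrib power_mult_distrib mult_ac)
      finally show ?thesis .
    qed
    have "?S \<Psi> \<le> ?S b" by (rule set_integral_le[OF i\<Psi> ib]) (rule abs_le_D1[OF pt])
    moreover have "- ?S \<Psi> \<le> ?S b"
    proof -
      have "?S (\<lambda>x. - 1 * \<Psi> x) \<le> ?S b"
        by (rule set_integral_le[OF set_integrable_mult_right[OF i\<Psi>] ib]) (use abs_le_D2[OF pt] in simp)
      then show ?thesis by (simp add: set_lebesgue_integral_def)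
    qed
    ultimately show ?thesis unfolding ZP Sb[symmetric] by linarith
  qed
  \<comment> \<open>First \<open>k\<close> tends to infinity with \<open>\<delta>\<close> fixed;
    then a small \<open>\<delta>\<close> forces \<open>Z\<close> to vanish.\<close>
  have Z2: "\<bar>Z\<bar> \<le> \<delta> * (?S V + 4 * ?S (Y v))" if d: "\<delta> > 0" for \<delta>
  proof -
    have "(\<lambda>k. N k / \<delta> + \<delta> * (?S V + 4 * ?S (Y v))) \<longlonglongrightarrow> 0 / \<delta> + \<delta> * (?S V + 4 * ?S (Y v))"
      using d by (intro tendsto_intros N) auto
    from Lim_bounded2[OF this, of 0 "\<bar>Z\<bar>"] show ?thesis using Z[OF d] by simp
  qed
  have "Z = 0"
  proof (rule ccontr)
    assume "Z \<noteq> 0"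
    define c where "c = \<bar>?S V + 4 * ?S (Y v)\<bar> + 1"
    have c: "c > 0" "?S V + 4 * ?S (Y v) < c" by (auto simp: c_def)
    have "\<bar>Z\<bar> \<le> \<bar>Z\<bar> / c * (?S V + 4 * ?S (Y v))" using Z2[of "\<bar>Z\<bar> / c"] c \<open>Z \<noteq> 0\<close> by simp
    also have "\<dots> < \<bar>Z\<bar> / c * c" using c \<open>Z \<noteq> 0\<close> by (intro mult_strict_left_mono) auto
    finally show False using c by simp
  qed
  moreover have "?S (Y v) = integral usquare (\<lambda>x. f x * Kd x * (v x)\<^sup>2)"
    unfolding Y_def
    by (rule set_integrable_continuous(2)[OF tsmooth_continuous]) (intro tsmooth_intros v)
  ultimately show "(LINT x:usquare|lborel. Kd x * (e1 w x * D1 v x + e2 w x * D2 v x)) = 2 * integral usquare (\<lambda>x. f x * Kd x * (v x)\<^sup>2)"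
    unfolding Z_def B_def[abs_def] by simp
qed

lemma eigen_energy:
  assumes v: "tsmooth v" and eig: "\<And>x. Lap v x = - 2 * f x * v x"
  shows "integral usquare (\<lambda>x. Kd x * ((D1 v x)\<^sup>2 + (D2 v x)\<^sup>2)) = 2 * integral usquare (\<lambda>x. f x * Kd x * (v x)\<^sup>2)"
proof -
  have "integral usquare (\<lambda>x. Kd x * ((D1 v x)\<^sup>2 + (D2 v x)\<^sup>2)) = - integral usquare (\<lambda>x. Kd x * (v x \<bullet> Lap v x))"
    using Lap_by_parts[OF v v] by (simp add: power2_eq_square)
  also have "(\<lambda>x. Kd x * (v x \<bullet> Lap v x)) = (\<lambda>x. (- 2) * (f x * Kd x * (v x)\<^sup>2))"
    by (auto simp: eig power2_eq_square)
  finally show ?thesis by simp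
qed

text \<open>The second component \<open>w\<close> is not known to be the differential of
  \<open>v\<close>, but its inner product with that differential is known. Expanding the square of
  the difference shows that \<open>w\<close> has at least the energy of \<open>v\<close>.\<close>

lemma H1_eigen_energy:
  assumes H: "(v, w) \<in> H1 g0 g" and v: "tsmooth v" and eig: "\<And>x. Lap v x = - 2 * f x * v x"
  shows "2 * integral usquare (\<lambda>x. f x * Kd x * (v x)\<^sup>2) \<le> (LINT x|area g0. conorm_sq g0 x (w x))"
proof -
  let ?S = "\<lambda>\<phi>. LINT x:usquare|lborel. (\<phi> x :: real)"
  have L2: "w \<in> borel_measurable borel" "integrable (area g0) (\<lambda>x. conorm_sq g0 x (w x))"
    using H unfolding H1_def L2_pairs_def by auto
  have iX: "set_integrable lborel usquare (\<lambda>x. Kd x * ((e1 w x)\<^sup>2 + (e2 w x)\<^sup>2))"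
    using area_g0(1)[OF L2(1)] L2(2) by simp
  note B = H1_weak_eigen[OF H v eig]
  have tV: "tsmooth (\<lambda>x. Kd x * ((D1 v x)\<^sup>2 + (D2 v x)\<^sup>2))" by (intro tsmooth_intros v)
  note V = set_integrable_continuous[OF tsmooth_continuous[OF tV]]
  have "?S (\<lambda>x. 2 * (Kd x * (e1 w x * D1 v x + e2 w x * D2 v x)))
    \<le> ?S (\<lambda>x. Kd x * ((e1 w x)\<^sup>2 + (e2 w x)\<^sup>2) + Kd x * ((D1 v x)\<^sup>2 + (D2 v x)\<^sup>2))"
  proof (rule set_integral_le)
    fix x
    have "0 \<le> Kd x * ((e1 w x - D1 v x)\<^sup>2 + (e2 w x - D2 v x)\<^sup>2)" using Kd_pos[of x] by simp
    then show "2 * (Kd x * (e1 w x * D1 v x + e2 w x * D2 v x))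
      \<le> Kd x * ((e1 w x)\<^sup>2 + (e2 w x)\<^sup>2) + Kd x * ((D1 v x)\<^sup>2 + (D2 v x)\<^sup>2)"
      by (simp add: power2_diff algebra_simps)
  qed (intro set_integrable_mult_right set_integral_add(1) iX B V)+
  then show ?thesis
    using B(2) V(2) area_g0(2)[OF L2(1)] eigen_energy[OF v eig]
    by (simp add: set_integral_add iX V)
qed

text \<open>Some coordinate of \<open>\<Phi>\<close> is not identically zero. It attains the
  infimum, and its Rayleigh quotient is at least 2 by \<open>H1_eigen_energy\<close>, so 2 is a
  lower bound for the first eigenvalue.\<close>

lemma spectral_inequality:
  assumes fe: "by_first_eigenfunctions g0 \<Phi>"
    and u: "tsmooth u" and mean: "integral usquare (\<lambda>x. f x * Kd x * u x) = 0"
  shows "2 * integral usquare (\<lambda>x. f x * Kd x * (u x)\<^sup>2)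
    \<le> integral usquare (\<lambda>x. Kd x * ((D1 u x)\<^sup>2 + (D2 u x)\<^sup>2))"
proof -
  have "\<exists>i. \<not> (\<forall>x. \<Phi> x $ i = 0)"
  proof (rule ccontr)
    assume "\<not> ?thesis"
    then have "\<Phi> 0 = 0" by (simp add: vec_eq_iff)
    then show False using \<Phi>_unit[of 0] by simp
  qed
  then obtain i where i: "first_eigenfunction g0 g (\<lambda>x. \<Phi> x $ i)"
    using fe unfolding by_first_eigenfunctions_def by blast
  define v where "v x = \<Phi> x $ i" for x
  have v: "tsmooth v" unfolding v_def[abs_def] by (intro tsmooth_intros)
  have Dv: "D1 v = (\<lambda>x. D1 \<Phi> x $ i)" "D2 v = (\<lambda>x. D2 \<Phi> x $ i)"
    unfolding v_def[abs_def]
    by (auto simp: D_bounded_linear[OF bounded_linear_vec_nth tsmooth_differentiable[OF tsmooth_\<Phi>]])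
  have "Lap v x = Lap \<Phi> x $ i" for x
    unfolding Lap_def Dv
    by (simp add: D_bounded_linear[OF bounded_linear_vec_nth tsmooth_differentiable[OF tsmooth_D1[OF tsmooth_\<Phi>]]]
        D_bounded_linear[OF bounded_linear_vec_nth tsmooth_differentiable[OF tsmooth_D2[OF tsmooth_\<Phi>]]])
  then have eig: "Lap v x = - 2 * f x * v x" for x by (simp add: Lap_\<Phi> v_def)
  obtain w where w: "admissible g0 g v w" "rayleigh g0 g v w = lambda1 g0 g"
    using i unfolding first_eigenfunction_def v_def[abs_def] by blast
  have H: "(v, w) \<in> H1 g0 g" using w(1) by (simp add: admissible_def)
  have tv2: "tsmooth (\<lambda>x. (v x)\<^sup>2)" by (intro tsmooth_intros v)
  have n: "(LINT x|area g. (v x)\<^sup>2) = integral usquare (\<lambda>x. f x * Kd x * (v x)\<^sup>2)" by (rule area_g_tsmooth(2)[OF tv2])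
  have n0: "(LINT x|area g. (v x)\<^sup>2) > 0"
  proof -
    have "(LINT x|area g. (v x)\<^sup>2) \<noteq> 0"
    proof
      assume "(LINT x|area g. (v x)\<^sup>2) = 0"
      then have "AE x in area g. (v x)\<^sup>2 = 0"
        using integral_nonneg_eq_0_iff_AE[OF area_g_tsmooth(1)[OF tv2]] by simp
      then have "AE x in area g. v x = 0" by eventually_elim simp
      then show False using w(1) by (simp add: admissible_def)
    qed
    moreover have "(LINT x|area g. (v x)\<^sup>2) \<ge> 0" by (rule Bochner_Integration.integral_nonneg) simp
    ultimately show ?thesis by linarith
  qed
  have "2 \<le> lambda1 g0 g"
    using H1_eigen_energy[OF H v eig] n0 unfolding w(2)[symmetric] rayleigh_def n[symmetric]
    by (simp add: field_simps)
  moreover have "0 \<le> integral usquare (\<lambda>x. f x * Kd x * (u x)\<^sup>2)"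
    using fK_nonneg by (intro Henstock_Kurzweil_Integration.integral_nonneg integrable_usquare tsmooth_intros u) simp
  ultimately have "2 * integral usquare (\<lambda>x. f x * Kd x * (u x)\<^sup>2) \<le> lambda1 g0 g * integral usquare (\<lambda>x. f x * Kd x * (u x)\<^sup>2)"
    by (rule mult_right_mono)
  then show ?thesis using lambda1_le[OF u mean] by linarith
qed

end

subsection \<open>Maps into a three-dimensional subspace\<close>

text \<open>A finite-dimensional subspace is its own double orthogonal complement. Membership
  becomes a family of linear equations, which pass to derivatives in \<open>D_in_V\<close>.\<close>

lemma subspace_memI:
  fixes V :: "'a::euclidean_space set"
  assumes "subspace V" "\<And>z. (\<And>v. v \<in> V \<Longrightarrow> z \<bullet> v = 0) \<Longrightarrow> z \<bullet> x = 0"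
  shows "x \<in> V"
proof -
  obtain p z where p: "p \<in> span V" "\<And>w. w \<in> span V \<Longrightarrow> orthogonal z w" "x = p + z"
    using orthogonal_subspace_decomp_exists[of V x] by metis
  have "p \<in> V" using p(1) assms(1) by (metis span_eq_iff)
  have "z \<bullet> v = 0" if "v \<in> V" for v
    using p(2)[of v] that by (simp add: orthogonal_def span_base)
  then have "z \<bullet> x = 0" "z \<bullet> p = 0" using assms(2) \<open>p \<in> V\<close> by auto
  then have "z = 0" using p(3) by (simp add: inner_add_right)
  then show ?thesis using p(3) \<open>p \<in> V\<close> by simp
qed

text \<open>Unless \<open>f\<close> is zero, the three vectors are an orthogonal basis: a nonzero
  remainder \<open>r\<close> would be a fourth orthogonal vector in a space of dimension 3.
  Multiplying by \<open>f\<close> covers the branch points, where both sides vanish.\<close>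

lemma orthogonal_triple_expand:
  fixes V :: "'a::euclidean_space set"
  assumes V: "subspace V" "dim V = 3" and m: "n \<in> V" "p \<in> V" "q \<in> V" "a \<in> V"
    and o: "n \<bullet> n = 1" "p \<bullet> p = f" "q \<bullet> q = f" "n \<bullet> p = 0" "n \<bullet> q = 0" "p \<bullet> q = 0"
  shows "(a \<bullet> p) *\<^sub>R p + (a \<bullet> q) *\<^sub>R q = f *\<^sub>R (a - (a \<bullet> n) *\<^sub>R n)"
proof (cases "f = 0")
  case True
  then show ?thesis using o by simp
next
  case False
  define r where "r = a - (a \<bullet> n) *\<^sub>R n - ((a \<bullet> p) / f) *\<^sub>R p - ((a \<bullet> q) / f) *\<^sub>R q"
  have rV: "r \<in> V" unfolding r_def by (intro subspace_diff subspace_scale V m)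
  have ro: "r \<bullet> n = 0" "r \<bullet> p = 0" "r \<bullet> q = 0"
    using o False by (simp_all add: r_def inner_diff_left inner_commute[of p n] inner_commute[of q n] inner_commute[of q p])
  have "r = 0"
  proof (rule ccontr)
    assume r: "r \<noteq> 0"
    have nz: "n \<noteq> 0" "p \<noteq> 0" "q \<noteq> 0" using o False by auto
    have ne: "n \<noteq> p" "n \<noteq> q" "n \<noteq> r" "p \<noteq> q" "p \<noteq> r" "q \<noteq> r"
      using o ro nz r by auto
    have "pairwise orthogonal {n, p, q, r}"
      using o ro by (auto simp: pairwise_def orthogonal_def inner_commute)
    then have "independent {n, p, q, r}"
      using nz r by (intro pairwise_orthogonal_independent) auto
    then have "card {n, p, q, r} \<le> dim V"
      using m rV by (intro independent_card_le_dim) auto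
    then show False using ne V(2) by simp
  qed
  then have "a - (a \<bullet> n) *\<^sub>R n = ((a \<bullet> p) / f) *\<^sub>R p + ((a \<bullet> q) / f) *\<^sub>R q"
    unfolding r_def by (simp add: algebra_simps)
  then show ?thesis using False by (simp add: scaleR_add_right)
qed

locale minimal_torus_in_sphere = minimal_torus \<alpha>1 \<alpha>2 \<beta>1 \<beta>2 g0 \<sigma> \<Phi>
  for \<alpha>1 \<alpha>2 \<beta>1 \<beta>2 g0 \<sigma> and \<Phi> :: "real^2 \<Rightarrow> real^'m" +
  fixes V :: "(real^'m) set"
  assumes V: "subspace V" "dim V = 3" and \<Phi>_V: "\<Phi> x \<in> V"
    and fe: "by_first_eigenfunctions g0 \<Phi>" and nonconst: "\<not> \<Phi> constant_on UNIV"
begin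

lemma D_in_V:
  assumes u: "tsmooth u" "\<And>x. u x \<in> V"
  shows "D1 u x \<in> V" "D2 u x \<in> V"
proof -
  have "pd i u x \<in> V" for i
  proof (rule subspace_memI[OF V(1)])
    fix z assume "\<And>v. v \<in> V \<Longrightarrow> z \<bullet> v = 0"
    then have "(\<lambda>x. z \<bullet> u x) = (\<lambda>x. 0)" using u(2) by auto
    then show "z \<bullet> pd i u x = 0"
      using pd_bounded_linear[OF bounded_linear_inner_right tsmooth_differentiable[OF u(1)], of i z x] by simp
  qed
  then show "D1 u x \<in> V" "D2 u x \<in> V"
    unfolding D1_def D2_def by (auto intro!: subspace_diff subspace_scale V(1))
qed

lemma expand:
  assumes "a \<in> V"
  shows "(a \<bullet> D1 \<Phi> x) *\<^sub>R D1 \<Phi> x + (a \<bullet> D2 \<Phi> x) *\<^sub>R D2 \<Phi> x = f x *\<^sub>R (a - (a \<bullet> \<Phi> x) *\<^sub>R \<Phi> x)"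
  by (rule orthogonal_triple_expand[OF V \<Phi>_V D_in_V[OF tsmooth_\<Phi> \<Phi>_V] assms])
    (simp_all add: \<Phi>_unit f_def[symmetric] conformal \<Phi>_orth)

lemma expand_inner:
  assumes "a \<in> V"
  shows "f x * (a \<bullet> a) = (a \<bullet> D1 \<Phi> x)\<^sup>2 + (a \<bullet> D2 \<Phi> x)\<^sup>2 + f x * (a \<bullet> \<Phi> x)\<^sup>2"
  using arg_cong[OF expand[OF assms, of x], of "\<lambda>v. v \<bullet> a"]
  by (simp add: inner_add_left inner_diff_left inner_commute power2_eq_square algebra_simps)

lemma ex_f_pos: "\<exists>y. f y > 0"
proof (rule ccontr)
  assume "\<not> ?thesis"
  then have f0: "f x = 0" for x using f_nonneg[of x] by (metis less_eq_real_def)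
  have "D1 \<Phi> x = 0" "D2 \<Phi> x = 0" for x using f0[of x] conformal(1)[of x] by (simp_all add: f_def)
  then have "pd 1 \<Phi> x = 0" "pd 2 \<Phi> x = 0" for x unfolding pd_D[of \<Phi>] by simp_all
  then have "norm (pd i \<Phi> x) \<le> 0" for i x using exhaust_2[of i] by auto
  from lipschitz_pd[OF tsmooth_differentiable[OF tsmooth_\<Phi>] this, of _ 0]
  have "\<Phi> x = \<Phi> 0" for x by simp
  then show False using nonconst unfolding constant_on_def by auto
qed

lemma integral_fK_pos: "integral usquare (\<lambda>x. f x * Kd x) > 0"
proof -
  obtain y where y: "f y > 0" using ex_f_pos by blast
  have "integral usquare (\<lambda>x. f x * Kd x) \<ge> 0"
    by (intro Henstock_Kurzweil_Integration.integral_nonneg integrable_usquare tsmooth_intros fK_nonneg)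
  moreover have "integral usquare (\<lambda>x. f x * Kd x) \<noteq> 0"
    using integral_eq_0_imp[OF tsmooth_fK fK_nonneg, of y] y Kd_pos[of y] by auto
  ultimately show ?thesis by linarith
qed

subsection \<open>The second variation on vector-valued functions\<close>

lemma D_vec_nth: "tsmooth u \<Longrightarrow> D1 (\<lambda>x. u x $ i) x = D1 u x $ i" "tsmooth u \<Longrightarrow> D2 (\<lambda>x. u x $ i) x = D2 u x $ i"
  by (simp_all add: D_bounded_linear[OF bounded_linear_vec_nth tsmooth_differentiable])

lemma spectral_vector:
  fixes u :: "real^2 \<Rightarrow> real^'m"
  assumes u: "tsmooth u" and mean: "integral usquare (\<lambda>x. (f x * Kd x) *\<^sub>R u x) = 0"
  shows "2 * integral usquare (\<lambda>x. f x * Kd x * (u x \<bullet> u x))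
    \<le> integral usquare (\<lambda>x. Kd x * (D1 u x \<bullet> D1 u x + D2 u x \<bullet> D2 u x))"
proof -
  have ui: "tsmooth (\<lambda>x. u x $ i)" for i by (intro tsmooth_intros u)
  have i: "(\<lambda>x. (f x * Kd x) *\<^sub>R u x) integrable_on usquare" by (intro integrable_usquare tsmooth_intros u)
  have mi: "integral usquare (\<lambda>x. f x * Kd x * u x $ i) = 0" for i
    using integral_linear[OF i bounded_linear_vec_nth, of i] mean by (simp add: o_def)
  have "2 * integral usquare (\<lambda>x. f x * Kd x * (u x \<bullet> u x)) = (\<Sum>i\<in>UNIV. 2 * integral usquare (\<lambda>x. f x * Kd x * (u x $ i)\<^sup>2))"
    unfolding inner_vec_def sum_distrib_left
    by (subst Henstock_Kurzweil_Integration.integral_sum)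
      (auto simp: power2_eq_square sum_distrib_left intro!: integrable_usquare tsmooth_intros u)
  also have "\<dots> \<le> (\<Sum>i\<in>UNIV. integral usquare (\<lambda>x. Kd x * ((D1 u x $ i)\<^sup>2 + (D2 u x $ i)\<^sup>2)))"
    using spectral_inequality[OF fe ui mi] by (intro sum_mono) (simp add: D_vec_nth u)
  also have "\<dots> = integral usquare (\<lambda>x. Kd x * (D1 u x \<bullet> D1 u x + D2 u x \<bullet> D2 u x))"
    unfolding inner_vec_def sum.distrib[symmetric] sum_distrib_left
    by (subst Henstock_Kurzweil_Integration.integral_sum)
      (auto simp: power2_eq_square intro!: integrable_usquare tsmooth_intros u)
  finally show ?thesis .
qed

text \<open>The Euler-Lagrange operator of the form \<open>Bil\<close>, up to sign and the density
  \<open>Kd\<close>; see \<open>Bil_Jac\<close>.\<close>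

definition Jac :: "(real^2 \<Rightarrow> real^'m) \<Rightarrow> real^2 \<Rightarrow> real^'m" where
  "Jac u x = Lap u x + (2 * f x) *\<^sub>R u x"

definition Bil :: "(real^2 \<Rightarrow> real^'m) \<Rightarrow> (real^2 \<Rightarrow> real^'m) \<Rightarrow> real" where
  "Bil u v = integral usquare (\<lambda>x. Kd x * (D1 u x \<bullet> D1 v x + D2 u x \<bullet> D2 v x) - 2 * (f x * Kd x * (u x \<bullet> v x)))"

lemma tsmooth_Jac [tsmooth_intros]: "tsmooth u \<Longrightarrow> tsmooth (Jac u)"
  unfolding Jac_def[abs_def] by (intro tsmooth_intros)

lemma Bil_Jac:
  assumes u: "tsmooth u" and v: "tsmooth v"
  shows "Bil u v = - integral usquare (\<lambda>x. Kd x * (u x \<bullet> Jac v x))"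
proof -
  have "Bil u v = integral usquare (\<lambda>x. Kd x * (D1 u x \<bullet> D1 v x + D2 u x \<bullet> D2 v x)) - integral usquare (\<lambda>x. 2 * (f x * Kd x * (u x \<bullet> v x)))"
    unfolding Bil_def by (rule Henstock_Kurzweil_Integration.integral_diff) (intro integrable_usquare tsmooth_intros u v)+
  also have "\<dots> = - (integral usquare (\<lambda>x. Kd x * (u x \<bullet> Lap v x)) + integral usquare (\<lambda>x. 2 * (f x * Kd x * (u x \<bullet> v x))))"
    unfolding Lap_by_parts[OF u v] by simp
  also have "integral usquare (\<lambda>x. Kd x * (u x \<bullet> Lap v x)) + integral usquare (\<lambda>x. 2 * (f x * Kd x * (u x \<bullet> v x)))
     = integral usquare (\<lambda>x. Kd x * (u x \<bullet> Lap v x) + 2 * (f x * Kd x * (u x \<bullet> v x)))"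
    by (rule Henstock_Kurzweil_Integration.integral_add[symmetric]) (intro integrable_usquare tsmooth_intros u v)+
  also have "(\<lambda>x. Kd x * (u x \<bullet> Lap v x) + 2 * (f x * Kd x * (u x \<bullet> v x))) = (\<lambda>x. Kd x * (u x \<bullet> Jac v x))"
    by (auto simp: Jac_def inner_add_right algebra_simps)
  finally show ?thesis .
qed

lemma Bil_expand:
  assumes u: "tsmooth u" and v: "tsmooth v"
  shows "Bil (\<lambda>x. u x + e *\<^sub>R v x) (\<lambda>x. u x + e *\<^sub>R v x) = Bil u u + 2 * e * Bil v u + e\<^sup>2 * Bil v v"
proof -
  have ev: "tsmooth (\<lambda>x. e *\<^sub>R v x)" by (intro tsmooth_intros v)
  have D: "D1 (\<lambda>x. u x + e *\<^sub>R v x) x = D1 u x + e *\<^sub>R D1 v x" "D2 (\<lambda>x. u x + e *\<^sub>R v x) x = D2 u x + e *\<^sub>R D2 v x" for x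
    by (simp_all add: D_add u ev D_bounded_linear[OF bounded_linear_scaleR_right tsmooth_differentiable[OF v]])
  define b where "b u v x = Kd x * (D1 u x \<bullet> D1 v x + D2 u x \<bullet> D2 v x) - 2 * (f x * Kd x * (u x \<bullet> v x))" for u v :: "real^2 \<Rightarrow> real^'m" and x
  have tb: "tsmooth (b p q)" if "tsmooth p" "tsmooth q" for p q
    unfolding b_def[abs_def] by (intro tsmooth_intros that)
  have bb: "b (\<lambda>x. u x + e *\<^sub>R v x) (\<lambda>x. u x + e *\<^sub>R v x) = (\<lambda>x. b u u x + (2 * e * b v u x + e\<^sup>2 * b v v x))"
    unfolding b_def D by (auto simp: inner_add_left inner_add_right inner_commute power2_eq_square algebra_simps)
  have Bb: "Bil p q = integral usquare (b p q)" for p q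
    by (simp add: Bil_def b_def[abs_def])
  show ?thesis
    unfolding Bb bb
    by (subst Henstock_Kurzweil_Integration.integral_add, (intro integrable_usquare tsmooth_intros tb u v)+)
      (subst Henstock_Kurzweil_Integration.integral_add, (intro integrable_usquare tsmooth_intros tb u v)+, simp)
qed

lemma Bil_nonneg:
  assumes u: "tsmooth u" and mean: "integral usquare (\<lambda>x. (f x * Kd x) *\<^sub>R u x) = 0"
  shows "Bil u u \<ge> 0"
proof -
  have "Bil u u = integral usquare (\<lambda>x. Kd x * (D1 u x \<bullet> D1 u x + D2 u x \<bullet> D2 u x)) - integral usquare (\<lambda>x. 2 * (f x * Kd x * (u x \<bullet> u x)))"
    unfolding Bil_def by (rule Henstock_Kurzweil_Integration.integral_diff) (intro integrable_usquare tsmooth_intros u)+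
  then show ?thesis using spectral_vector[OF u mean] by simp
qed

text \<open>The projection of a constant vector to the tangent planes: a conformal field of the sphere.\<close>

definition tang :: "real^'m \<Rightarrow> real^2 \<Rightarrow> real^'m" where
  "tang a x = a - (a \<bullet> \<Phi> x) *\<^sub>R \<Phi> x"

lemma tsmooth_tang [tsmooth_intros]: "tsmooth (tang a)"
  unfolding tang_def[abs_def] by (intro tsmooth_intros)

lemma tang_\<Phi>: "tang a x \<bullet> \<Phi> x = 0"
  by (simp add: tang_def inner_diff_left \<Phi>_unit)

section \<open>Compensating the mean of a field by a conformal field\<close>

definition mean_tang :: "real^'m \<Rightarrow> real^'m" where
  "mean_tang a = integral usquare (\<lambda>x. (f x * Kd x) *\<^sub>R tang a x)"

lemma integral_inner_fK:
  fixes u :: "real^2 \<Rightarrow> real^'m"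
  assumes "tsmooth u"
  shows "integral usquare (\<lambda>x. (f x * Kd x) *\<^sub>R u x) \<bullet> c = integral usquare (\<lambda>x. f x * Kd x * (u x \<bullet> c))"
proof -
  have "(\<lambda>x. (f x * Kd x) *\<^sub>R u x) integrable_on usquare" by (intro integrable_usquare tsmooth_intros assms)
  from integral_linear[OF this bounded_linear_inner_left[of c]] show ?thesis by (simp add: o_def)
qed

text \<open>The map is a linear endomorphism, so injectivity suffices. Pairing the mean with
  \<open>a\<close> gives the weighted integral of the squared length of \<open>tang a\<close>. If it
  vanishes, \<open>a\<close> is normal along the image near an immersed point, and moving that point
  in a tangent direction forces \<open>a\<close> to be zero.\<close>

lemma mean_tang_surj: "surj mean_tang"
proof -
  have lin: "linear mean_tang"
  proof
    fix a b :: "real^'m" and r :: real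
    have "(\<lambda>x. (f x * Kd x) *\<^sub>R tang (a + b) x) = (\<lambda>x. (f x * Kd x) *\<^sub>R tang a x + (f x * Kd x) *\<^sub>R tang b x)"
      by (auto simp: tang_def inner_add_left algebra_simps)
    then show "mean_tang (a + b) = mean_tang a + mean_tang b"
      unfolding mean_tang_def
      by (simp only:) (rule Henstock_Kurzweil_Integration.integral_add; intro integrable_usquare tsmooth_intros)
    have "(\<lambda>x. (f x * Kd x) *\<^sub>R tang (r *\<^sub>R a) x) = (\<lambda>x. r *\<^sub>R ((f x * Kd x) *\<^sub>R tang a x))"
      by (auto simp: tang_def algebra_simps)
    then show "mean_tang (r *\<^sub>R a) = r *\<^sub>R mean_tang a"
      unfolding mean_tang_def by (simp only: integral_cmul)
  qed
  have "a = 0" if "mean_tang a = 0" for a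
  proof -
    have tt: "tang a x \<bullet> a = tang a x \<bullet> tang a x" for x
      by (simp add: tang_def inner_diff_left inner_diff_right \<Phi>_unit inner_commute algebra_simps)
    have "0 = mean_tang a \<bullet> a" using that by simp
    also have "\<dots> = integral usquare (\<lambda>x. f x * Kd x * (tang a x \<bullet> tang a x))"
      unfolding mean_tang_def integral_inner_fK[OF tsmooth_tang] tt by (rule refl)
    finally have I0: "integral usquare (\<lambda>x. f x * Kd x * (tang a x \<bullet> tang a x)) = 0" by simp
    have "tsmooth (\<lambda>x. f x * Kd x * (tang a x \<bullet> tang a x))" by (intro tsmooth_intros)
    from integral_eq_0_imp[OF this _ I0]
    have "f x * Kd x * (tang a x \<bullet> tang a x) = 0" for x using fK_nonneg by simp
    then have ft: "f x *\<^sub>R tang a x = 0" for x using Kd_nz[of x] by auto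
    obtain y where y: "f y > 0" using ex_f_pos by blast
    have t0: "tang a y = 0" using ft[of y] y by simp
    \<comment> \<open>At \<open>y\<close> the field \<open>tang a\<close> vanishes, so
      differentiating the product leaves only \<open>f\<close> times its derivative.\<close>
    have "0 = D1 (\<lambda>x. f x *\<^sub>R tang a x) y" unfolding ft by simp
    also have "\<dots> = f y *\<^sub>R D1 (tang a) y" by (simp add: D_scaleR tsmooth_f tsmooth_tang t0)
    finally have "D1 (tang a) y = 0" using y by simp
    moreover have "D1 (tang a) y = - ((a \<bullet> \<Phi> y) *\<^sub>R D1 \<Phi> y + (a \<bullet> D1 \<Phi> y) *\<^sub>R \<Phi> y)"
    proof -
      have ta: "tsmooth (\<lambda>x. a \<bullet> \<Phi> x)" by (intro tsmooth_intros)
      have "D1 (tang a) y = D1 (\<lambda>x. a) y - D1 (\<lambda>x. (a \<bullet> \<Phi> x) *\<^sub>R \<Phi> x) y"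
        unfolding tang_def[abs_def] by (rule D_diff) (intro tsmooth_intros)+
      then show ?thesis by (simp add: D_scaleR ta tsmooth_\<Phi> D_inner tsmooth_const)
    qed
    ultimately have "(a \<bullet> \<Phi> y) *\<^sub>R D1 \<Phi> y + (a \<bullet> D1 \<Phi> y) *\<^sub>R \<Phi> y = 0" by (metis neg_equal_0_iff_equal)
    from arg_cong[OF this, of "\<lambda>v. v \<bullet> D1 \<Phi> y"]
    have "(a \<bullet> \<Phi> y) * f y = 0" by (simp add: inner_add_left f_def \<Phi>_orth)
    then show "a = 0" using t0 y by (simp add: tang_def)
  qed
  then have "inj mean_tang" using linear_injective_0[OF lin] by blast
  then show ?thesis using linear_injective_imp_surjective[OF lin] by blast
qed

lemma mean_tang_ex: "\<exists>a. mean_tang a = y"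
  using surjD[OF mean_tang_surj, of y] by auto

lemma Lap_scaleR:
  fixes v :: "real^2 \<Rightarrow> 'b::real_normed_vector"
  assumes u: "tsmooth u" and v: "tsmooth v"
  shows "Lap (\<lambda>x. u x *\<^sub>R v x) x = Lap u x *\<^sub>R v x + 2 *\<^sub>R (D1 u x *\<^sub>R D1 v x + D2 u x *\<^sub>R D2 v x) + u x *\<^sub>R Lap v x"
proof -
  have d: "D1 (\<lambda>x. u x *\<^sub>R v x) = (\<lambda>x. u x *\<^sub>R D1 v x + D1 u x *\<^sub>R v x)"
    "D2 (\<lambda>x. u x *\<^sub>R v x) = (\<lambda>x. u x *\<^sub>R D2 v x + D2 u x *\<^sub>R v x)"
    using D_scaleR[OF u v] by auto
  have t: "tsmooth (\<lambda>x. u x *\<^sub>R D1 v x)" "tsmooth (\<lambda>x. D1 u x *\<^sub>R v x)"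
    "tsmooth (\<lambda>x. u x *\<^sub>R D2 v x)" "tsmooth (\<lambda>x. D2 u x *\<^sub>R v x)"
    by (simp_all only: tsmooth_scaleR tsmooth_D1 tsmooth_D2 u v)
  have e: "((A + B) + (B + C)) + ((D + E) + (E + F)) = (C + F) + 2 *\<^sub>R (B + E) + (A + D)" for A B C D E F :: 'b
    by (simp add: scaleR_2)
  show ?thesis
    unfolding Lap_def d D_add(1)[OF t(1,2)] D_add(2)[OF t(3,4)] D_scaleR[OF u tsmooth_D1[OF v]]
      D_scaleR[OF u tsmooth_D2[OF v]] D_scaleR[OF tsmooth_D1[OF u] v] D_scaleR[OF tsmooth_D2[OF u] v]
      scaleR_add_left scaleR_add_right[of "u x"]
    by (rule e)
qed

lemma Lap_add: "tsmooth u \<Longrightarrow> tsmooth v \<Longrightarrow> Lap (\<lambda>x. u x + v x) x = Lap u x + Lap v x"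
proof -
  assume u: "tsmooth u" and v: "tsmooth v"
  have d: "D1 (\<lambda>x. u x + v x) = (\<lambda>x. D1 u x + D1 v x)" "D2 (\<lambda>x. u x + v x) = (\<lambda>x. D2 u x + D2 v x)"
    using D_add[OF u v] by auto
  show "Lap (\<lambda>x. u x + v x) x = Lap u x + Lap v x"
    unfolding Lap_def d by (simp add: D_add tsmooth_D1 tsmooth_D2 u v)
qed

text \<open>The result is normal while \<open>tang a\<close> is tangent, so \<open>Bil\<close>
  vanishes on it. Membership of \<open>a\<close> in \<open>V\<close> enters through
  \<open>expand\<close>: the tangent part of \<open>a\<close> has to be tangent to the
  image.\<close>

lemma Jac_tang:
  assumes a: "a \<in> V"
  shows "Jac (tang a) x = (4 * f x * (a \<bullet> \<Phi> x)) *\<^sub>R \<Phi> x"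
proof -
  have ta: "tsmooth (\<lambda>x. - (a \<bullet> \<Phi> x))" by (intro tsmooth_intros)
  have D: "D1 (\<lambda>x. - (a \<bullet> u x)) = (\<lambda>x. - (a \<bullet> D1 u x))" "D2 (\<lambda>x. - (a \<bullet> u x)) = (\<lambda>x. - (a \<bullet> D2 u x))" if "tsmooth u" for u
    using D_bounded_linear[OF bounded_linear_minus[OF bounded_linear_inner_right[of a]] tsmooth_differentiable[OF that]] by auto
  have La: "Lap (\<lambda>x. - (a \<bullet> \<Phi> x)) x = 2 * f x * (a \<bullet> \<Phi> x)"
  proof -
    have "Lap (\<lambda>x. - (a \<bullet> \<Phi> x)) x = - (a \<bullet> Lap \<Phi> x)"
      unfolding Lap_def by (simp add: D tsmooth_D1 tsmooth_D2 tsmooth_\<Phi> inner_add_right)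
    then show ?thesis by (simp add: Lap_\<Phi>)
  qed
  have "tang a = (\<lambda>x. a + (- (a \<bullet> \<Phi> x)) *\<^sub>R \<Phi> x)" by (auto simp: tang_def)
  then have "Lap (tang a) x = Lap (\<lambda>x. a) x + Lap (\<lambda>x. (- (a \<bullet> \<Phi> x)) *\<^sub>R \<Phi> x) x"
    by (simp only:) (rule Lap_add; intro tsmooth_intros)
  also have "Lap (\<lambda>x. a) x = 0" by (simp add: Lap_def)
  also have "Lap (\<lambda>x. (- (a \<bullet> \<Phi> x)) *\<^sub>R \<Phi> x) x = (2 * f x * (a \<bullet> \<Phi> x)) *\<^sub>R \<Phi> x
      - 2 *\<^sub>R ((a \<bullet> D1 \<Phi> x) *\<^sub>R D1 \<Phi> x + (a \<bullet> D2 \<Phi> x) *\<^sub>R D2 \<Phi> x) + (2 * f x * (a \<bullet> \<Phi> x)) *\<^sub>R \<Phi> x"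
    unfolding Lap_scaleR[OF ta tsmooth_\<Phi>] La D[OF tsmooth_\<Phi>] Lap_\<Phi> by (simp add: algebra_simps)
  finally have L: "Lap (tang a) x = (2 * f x * (a \<bullet> \<Phi> x)) *\<^sub>R \<Phi> x - 2 *\<^sub>R (f x *\<^sub>R tang a x) + (2 * f x * (a \<bullet> \<Phi> x)) *\<^sub>R \<Phi> x"
    unfolding expand[OF a] tang_def by simp
  have "A - 2 *\<^sub>R (f x *\<^sub>R y) + A + (2 * f x) *\<^sub>R y = 2 *\<^sub>R A" for A y :: "real^'m"
    by (simp add: scaleR_2)
  then show ?thesis
    unfolding Jac_def L by simp
qed

text \<open>
  A tangential field annihilated by the quadratic form, corrected by a conformal field so that it has
  mean zero, minimises the form among fields of mean zero. Varying it in the normal direction shows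
  that it is divergence free.
\<close>

lemma divergence_free:
  assumes X: "tsmooth X" "\<And>x. X x \<bullet> \<Phi> x = 0" "\<And>x. X x \<in> V" and h: "tsmooth h"
    and JX: "\<And>x. Jac X x = - (2 * h x) *\<^sub>R \<Phi> x"
  obtains a where "a \<in> V" "\<And>x. h x = 2 * f x * (a \<bullet> \<Phi> x)"
proof -
  obtain a where a: "mean_tang a = - integral usquare (\<lambda>x. (f x * Kd x) *\<^sub>R X x)"
    using mean_tang_ex by blast
  \<comment> \<open>Let \<open>q\<close> be the component of \<open>a\<close> orthogonal to
    \<open>V\<close>. Along the image \<open>tang a\<close> has the constant inner product
    \<open>q \<bullet> q\<close> with \<open>q\<close>, whereas \<open>X\<close> is orthogonal to
    \<open>q\<close>. Comparing the means gives \<open>q = 0\<close>.\<close>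
  have aV: "a \<in> V"
  proof (rule subspace_memI[OF V(1)])
    fix z assume z: "\<And>v. v \<in> V \<Longrightarrow> z \<bullet> v = 0"
    obtain p q where p: "p \<in> span V" "\<And>w. w \<in> span V \<Longrightarrow> orthogonal q w" "a = p + q"
      using orthogonal_subspace_decomp_exists[of V a] by metis
    have pV: "p \<in> V" using p(1) V(1) by (metis span_eq_iff)
    have qV: "q \<bullet> v = 0" if "v \<in> V" for v
      using p(2)[of v] that by (simp add: orthogonal_def span_base)
    have "mean_tang a \<bullet> q = - integral usquare (\<lambda>x. f x * Kd x * (X x \<bullet> q))"
      unfolding a inner_minus_left integral_inner_fK[OF X(1)] by (rule refl)
    also have "(\<lambda>x. f x * Kd x * (X x \<bullet> q)) = (\<lambda>x. 0)" using qV[OF X(3)] by (auto simp: inner_commute)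
    finally have "mean_tang a \<bullet> q = 0" by simp
    moreover have "mean_tang a \<bullet> q = integral usquare (\<lambda>x. f x * Kd x * (q \<bullet> q))"
    proof -
      have "tang a x \<bullet> q = q \<bullet> q" for x
        using qV[OF \<Phi>_V, of x] qV[OF pV] by (simp add: tang_def p(3) inner_diff_left inner_diff_right inner_add_left inner_add_right inner_commute)
      then show ?thesis unfolding mean_tang_def integral_inner_fK[OF tsmooth_tang] by simp
    qed
    ultimately have "integral usquare (\<lambda>x. f x * Kd x) * (q \<bullet> q) = 0" by simp
    then have "q = 0" using integral_fK_pos by simp
    then show "z \<bullet> a = 0" using z[OF pV] p(3) by simp
  qed
  \<comment> \<open>Half the normal coefficient of \<open>Jac\<close> of the corrected field
    \<open>u\<close>; the aim is that it vanishes.\<close>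
  define \<psi> where "\<psi> x = 2 * f x * (a \<bullet> \<Phi> x) - h x" for x
  have t\<psi>: "tsmooth \<psi>" unfolding \<psi>_def[abs_def] by (intro tsmooth_intros h)
  \<comment> \<open>The normal test field with coefficient \<open>\<psi>\<close> need not have mean
    zero, so it too is corrected by a conformal field. That field is tangent and leaves no trace in
    \<open>vu\<close>.\<close>
  obtain b where b: "mean_tang b = integral usquare (\<lambda>x. (f x * Kd x) *\<^sub>R (\<psi> x *\<^sub>R \<Phi> x))"
    using mean_tang_ex by blast
  define u where "u x = X x + tang a x" for x
  define v where "v x = \<psi> x *\<^sub>R \<Phi> x - tang b x" for x
  have tu: "tsmooth u" unfolding u_def[abs_def] by (intro tsmooth_intros X)
  have tv: "tsmooth v" unfolding v_def[abs_def] by (intro tsmooth_intros t\<psi>)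
  have mu: "integral usquare (\<lambda>x. (f x * Kd x) *\<^sub>R u x) = 0"
  proof -
    have "integral usquare (\<lambda>x. (f x * Kd x) *\<^sub>R u x) = integral usquare (\<lambda>x. (f x * Kd x) *\<^sub>R X x) + mean_tang a"
      unfolding u_def scaleR_add_right mean_tang_def
      by (rule Henstock_Kurzweil_Integration.integral_add) (intro integrable_usquare tsmooth_intros X)+
    then show ?thesis by (simp add: a)
  qed
  have mv: "integral usquare (\<lambda>x. (f x * Kd x) *\<^sub>R v x) = 0"
  proof -
    have "integral usquare (\<lambda>x. (f x * Kd x) *\<^sub>R v x) = integral usquare (\<lambda>x. (f x * Kd x) *\<^sub>R (\<psi> x *\<^sub>R \<Phi> x)) - mean_tang b"
      unfolding v_def scaleR_diff_right mean_tang_def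
      by (rule Henstock_Kurzweil_Integration.integral_diff) (intro integrable_usquare tsmooth_intros t\<psi>)+
    then show ?thesis by (simp add: b)
  qed
  have Ju: "Jac u x = (2 * \<psi> x) *\<^sub>R \<Phi> x" for x
  proof -
    have "Jac u x = Jac X x + Jac (tang a) x"
      unfolding Jac_def u_def[abs_def] Lap_add[OF X(1) tsmooth_tang] by (simp add: scaleR_add_right)
    then show ?thesis
      unfolding JX Jac_tang[OF aV] \<psi>_def scaleR_add_left[symmetric]
      by (simp add: algebra_simps)
  qed
  have uu: "Bil u u = 0"
    unfolding Bil_Jac[OF tu tu] Ju u_def by (simp add: inner_add_left X(2) tang_\<Phi>)
  have vu: "Bil v u = - 2 * integral usquare (\<lambda>x. Kd x * (\<psi> x)\<^sup>2)"
  proof -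
    have "(\<lambda>x. Kd x * (v x \<bullet> Jac u x)) = (\<lambda>x. 2 * (Kd x * (\<psi> x)\<^sup>2))"
      unfolding Ju v_def by (auto simp: inner_diff_left tang_\<Phi> \<Phi>_unit power2_eq_square)
    then show ?thesis unfolding Bil_Jac[OF tv tu] by simp
  qed
  let ?I = "integral usquare (\<lambda>x. Kd x * (\<psi> x)\<^sup>2)"
  have I0: "?I \<ge> 0"
    using Kd_pos by (intro Henstock_Kurzweil_Integration.integral_nonneg integrable_usquare tsmooth_intros t\<psi>)
      (simp add: less_imp_le)
  \<comment> \<open>The quadratic polynomial in \<open>e\<close> has no constant term and a
    nonpositive linear term; being nonnegative for small positive \<open>e\<close>, its linear term
    must be zero.\<close>
  have ineq: "4 * ?I \<le> e * Bil v v" if e: "e > 0" for e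
  proof -
    have "integral usquare (\<lambda>x. (f x * Kd x) *\<^sub>R (u x + e *\<^sub>R v x)) = 0"
    proof -
      have "integral usquare (\<lambda>x. (f x * Kd x) *\<^sub>R (u x + e *\<^sub>R v x)) =
         integral usquare (\<lambda>x. (f x * Kd x) *\<^sub>R u x + e *\<^sub>R ((f x * Kd x) *\<^sub>R v x))"
        by (simp add: scaleR_add_right mult.commute)
      also have "\<dots> = integral usquare (\<lambda>x. (f x * Kd x) *\<^sub>R u x) + integral usquare (\<lambda>x. e *\<^sub>R ((f x * Kd x) *\<^sub>R v x))"
        by (rule Henstock_Kurzweil_Integration.integral_add) (intro integrable_usquare tsmooth_intros tu tv)+
      finally show ?thesis by (simp add: mu mv del: scaleR_scaleR)
    qed
    then have "0 \<le> Bil (\<lambda>x. u x + e *\<^sub>R v x) (\<lambda>x. u x + e *\<^sub>R v x)"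
      by (intro Bil_nonneg tsmooth_intros tu tv)
    then have "0 \<le> e * (e * Bil v v - 4 * ?I)"
      unfolding Bil_expand[OF tu tv] uu vu by (simp add: algebra_simps power2_eq_square)
    then show ?thesis using e by (simp add: zero_le_mult_iff)
  qed
  have "?I = 0"
  proof (rule ccontr)
    assume "?I \<noteq> 0"
    then have Ip: "?I > 0" using I0 by simp
    define c where "c = \<bar>Bil v v\<bar> + 1"
    have c: "c > 0" "Bil v v \<le> c" by (auto simp: c_def)
    have "4 * ?I \<le> ?I / c * Bil v v" using ineq[of "?I / c"] Ip c by simp
    also have "\<dots> \<le> ?I / c * c" using Ip c by (intro mult_left_mono) auto
    finally show False using Ip c by simp
  qed
  moreover have "tsmooth (\<lambda>x. Kd x * (\<psi> x)\<^sup>2)" by (intro tsmooth_intros t\<psi>)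
  ultimately have K\<psi>: "Kd x * (\<psi> x)\<^sup>2 = 0" for x
    using integral_eq_0_imp[of "\<lambda>x. Kd x * (\<psi> x)\<^sup>2" x] Kd_pos by (simp add: less_imp_le)
  have "\<psi> x = 0" for x using K\<psi>[of x] Kd_nz[of x] by simp
  then show thesis using that[OF aV] by (simp add: \<psi>_def)
qed

section \<open>The density as a conformal factor: logarithmic gradient, positivity,
  curvature\<close>

lemma Jac_D\<Phi>: "Jac (D1 \<Phi>) x = - (2 * D1 f x) *\<^sub>R \<Phi> x" "Jac (D2 \<Phi>) x = - (2 * D2 f x) *\<^sub>R \<Phi> x"
proof -
  \<comment> \<open>The frame fields commute, hence commute with \<open>Lap\<close>. Differentiating
    the eigenvalue equation of \<open>\<Phi>\<close> therefore leaves the derivative of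
    \<open>f\<close> as the only new term.\<close>
  have c: "D2 (D1 \<Phi>) = D1 (D2 \<Phi>)" using D_commute[OF tsmooth_\<Phi>] by auto
  have LapF: "Lap \<Phi> = (\<lambda>x. (- 2 * f x) *\<^sub>R \<Phi> x)" using Lap_\<Phi> by auto
  have t2: "tsmooth (\<lambda>x. - 2 * f x)" by (intro tsmooth_intros)
  have D2f: "D1 (\<lambda>x. - 2 * f x) x = - 2 * D1 f x" "D2 (\<lambda>x. - 2 * f x) x = - 2 * D2 f x" for x
    by (rule D_bounded_linear[OF bounded_linear_mult_right tsmooth_differentiable[OF tsmooth_f]])+
  have tp: "tsmooth (D1 (D1 \<Phi>))" "tsmooth (D2 (D2 \<Phi>))" by (intro tsmooth_intros)+
  have "Lap (D1 \<Phi>) x = D1 (D1 (D1 \<Phi>)) x + D1 (D2 (D2 \<Phi>)) x"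
    unfolding Lap_def c using D_commute[OF tsmooth_D2[OF tsmooth_\<Phi>], of x] by simp
  also have "\<dots> = D1 (Lap \<Phi>) x" unfolding Lap_def[abs_def] by (rule D_add(1)[OF tp, symmetric])
  finally have 1: "Lap (D1 \<Phi>) x = (- 2 * f x) *\<^sub>R D1 \<Phi> x + (- 2 * D1 f x) *\<^sub>R \<Phi> x"
    unfolding LapF D_scaleR(1)[OF t2 tsmooth_\<Phi>] D2f .
  show "Jac (D1 \<Phi>) x = - (2 * D1 f x) *\<^sub>R \<Phi> x" unfolding Jac_def 1 by simp
  have "Lap (D2 \<Phi>) x = D2 (D1 (D1 \<Phi>)) x + D2 (D2 (D2 \<Phi>)) x"
    unfolding Lap_def c[symmetric] using D_commute[OF tsmooth_D1[OF tsmooth_\<Phi>], of x] by simp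
  also have "\<dots> = D2 (Lap \<Phi>) x" unfolding Lap_def[abs_def] by (rule D_add(2)[OF tp, symmetric])
  finally have 2: "Lap (D2 \<Phi>) x = (- 2 * f x) *\<^sub>R D2 \<Phi> x + (- 2 * D2 f x) *\<^sub>R \<Phi> x"
    unfolding LapF D_scaleR(2)[OF t2 tsmooth_\<Phi>] D2f .
  show "Jac (D2 \<Phi>) x = - (2 * D2 f x) *\<^sub>R \<Phi> x" unfolding Jac_def 2 by simp
qed

text \<open>The gradient of \<open>log f\<close>, multiplied by \<open>f\<close> because positivity
  is not yet available.\<close>

lemma log_gradient:
  obtains a b where "\<And>x. D1 f x = 2 * f x * (a \<bullet> \<Phi> x)" "\<And>x. D2 f x = 2 * f x * (b \<bullet> \<Phi> x)"
proof -
  obtain a where "\<And>x. D1 f x = 2 * f x * (a \<bullet> \<Phi> x)"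
    using divergence_free[of "D1 \<Phi>" "D1 f"] Jac_D\<Phi>(1) \<Phi>_orth D_in_V[OF tsmooth_\<Phi> \<Phi>_V]
    by (metis inner_commute tsmooth_D1 tsmooth_\<Phi> tsmooth_f)
  moreover obtain b where "\<And>x. D2 f x = 2 * f x * (b \<bullet> \<Phi> x)"
    using divergence_free[of "D2 \<Phi>" "D2 f"] Jac_D\<Phi>(2) \<Phi>_orth D_in_V[OF tsmooth_\<Phi> \<Phi>_V]
    by (metis inner_commute tsmooth_D2 tsmooth_\<Phi> tsmooth_f)
  ultimately show thesis using that by blast
qed

text \<open>Along a segment \<open>f\<close> satisfies a linear differential inequality, so it cannot reach zero.\<close>

lemma f_pos:
  assumes a: "\<And>x. D1 f x = 2 * f x * (a \<bullet> \<Phi> x)" and b: "\<And>x. D2 f x = 2 * f x * (b \<bullet> \<Phi> x)"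
  shows "f x > 0"
proof (rule ccontr)
  assume "\<not> f x > 0"
  then have fx: "f x = 0" using f_nonneg[of x] by simp
  obtain y where y: "f y > 0" using ex_f_pos by blast
  define q1 where "q1 x = 2 * (\<alpha>1 x * (a \<bullet> \<Phi> x) + \<beta>1 x * (b \<bullet> \<Phi> x))" for x
  define q2 where "q2 x = 2 * (\<alpha>2 x * (a \<bullet> \<Phi> x) + \<beta>2 x * (b \<bullet> \<Phi> x))" for x
  have tq: "tsmooth q1" "tsmooth q2" unfolding q1_def[abs_def] q2_def[abs_def] by (intro tsmooth_intros)+
  have pf: "pd 1 f z = q1 z * f z" "pd 2 f z = q2 z * f z" for z
    unfolding pd_D[of f] a b q1_def q2_def by (simp_all add: algebra_simps)
  obtain C1 where C1: "C1 \<ge> 0" "\<And>z. norm (q1 z) \<le> C1" using tsmooth_bounded[OF tq(1)] by metis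
  obtain C2 where C2: "C2 \<ge> 0" "\<And>z. norm (q2 z) \<le> C2" using tsmooth_bounded[OF tq(2)] by metis
  define w where "w = y - x"
  \<comment> \<open>A bound for the logarithmic derivative along the segment. With it
    \<open>k t * exp (- C * t)\<close> is nonincreasing, so a zero at \<open>x\<close> would spread
    to \<open>y\<close>.\<close>
  define C where "C = \<bar>w$1\<bar> * C1 + \<bar>w$2\<bar> * C2"
  define k where "k t = f (x + t *\<^sub>R w)" for t
  define q where "q t = w$1 * q1 (x + t *\<^sub>R w) + w$2 * q2 (x + t *\<^sub>R w)" for t
  have qC: "q t \<le> C" for t
  proof -
    have "\<bar>q t\<bar> \<le> \<bar>w$1\<bar> * \<bar>q1 (x + t *\<^sub>R w)\<bar> + \<bar>w$2\<bar> * \<bar>q2 (x + t *\<^sub>R w)\<bar>"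
      unfolding q_def by (rule order_trans[OF abs_triangle_ineq]) (simp add: abs_mult)
    also have "\<dots> \<le> C"
      unfolding C_def using C1(2) C2(2) by (intro add_mono mult_left_mono) auto
    finally show ?thesis by simp
  qed
  have kd: "(k has_field_derivative q t * k t) (at t)" for t
  proof -
    have "((\<lambda>t. x + t *\<^sub>R w) has_derivative (\<lambda>h. h *\<^sub>R w)) (at t)" by (auto intro!: derivative_eq_intros)
    from has_derivative_compose[OF this has_derivative_pd[OF tsmooth_differentiable[OF tsmooth_f]]]
    have "(k has_derivative (\<lambda>h. (h *\<^sub>R w)$1 *\<^sub>R pd 1 f (x + t *\<^sub>R w) + (h *\<^sub>R w)$2 *\<^sub>R pd 2 f (x + t *\<^sub>R w))) (at t)"
      unfolding k_def[abs_def] .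
    moreover have "(\<lambda>h. (h *\<^sub>R w)$1 *\<^sub>R pd 1 f (x + t *\<^sub>R w) + (h *\<^sub>R w)$2 *\<^sub>R pd 2 f (x + t *\<^sub>R w)) = (*) (q t * k t)"
      by (auto simp: pf q_def k_def algebra_simps)
    ultimately show ?thesis by (simp add: has_field_derivative_def)
  qed
  have "k 1 * exp (- C * 1) \<le> k 0 * exp (- C * 0)"
  proof (rule DERIV_nonpos_imp_nonincreasing[of 0 1 "\<lambda>t. k t * exp (- C * t)"])
    fix t :: real
    have "((\<lambda>t. k t * exp (- C * t)) has_field_derivative (q t - C) * (k t * exp (- C * t))) (at t)"
      by (auto intro!: derivative_eq_intros kd simp: algebra_simps)
    moreover have "(q t - C) * (k t * exp (- C * t)) \<le> 0"
      using qC[of t] f_nonneg by (intro mult_nonpos_nonneg) (auto simp: k_def)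
    ultimately show "\<exists>y. ((\<lambda>t. k t * exp (- C * t)) has_field_derivative y) (at t) \<and> y \<le> 0" by blast
  qed simp
  then have "k 1 * exp (- C) \<le> 0" by (simp add: k_def fx)
  moreover have "k 1 * exp (- C) > 0" using y by (simp add: k_def w_def)
  ultimately show False by linarith
qed

text \<open>Bochner's formula \<open>f \<Delta> f = \<bar>\<nabla> f\<bar>\<^sup>2 - 2 f\<^sup>3\<close>: the induced metric has curvature one.\<close>

lemma bochner: "f x * Lap f x = (D1 f x)\<^sup>2 + (D2 f x)\<^sup>2 - 2 * f x ^ 3"
proof -
  note tN = tsmooth_D1[OF tsmooth_\<Phi>] tsmooth_D2[OF tsmooth_\<Phi>]
  note tNN = tsmooth_D1[OF tN(1)] tsmooth_D2[OF tN(1)]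
  define N1 N2 where "N1 = D1 \<Phi>" and "N2 = D2 \<Phi>"
  have tn: "tsmooth N1" "tsmooth N2" unfolding N1_def N2_def by (rule tN)+
  have c: "D2 N1 = D1 N2" unfolding N1_def N2_def using D_commute[OF tsmooth_\<Phi>] by auto
  have f1: "f = (\<lambda>x. N1 x \<bullet> N1 x)" and f2: "f = (\<lambda>x. N2 x \<bullet> N2 x)" and z: "(\<lambda>x. N1 x \<bullet> N2 x) = (\<lambda>x. 0)"
    and z1: "(\<lambda>x. \<Phi> x \<bullet> N1 x) = (\<lambda>x. 0)"
    unfolding N1_def N2_def using conformal \<Phi>_orth by (auto simp: f_def)
  have A: "D1 f x = 2 * (D1 N1 x \<bullet> N1 x)" "D2 f x = 2 * (D2 N1 x \<bullet> N1 x)" for x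
    unfolding f1 by (simp_all add: D_inner tn inner_commute)
  have B: "D1 f x = 2 * (D1 N2 x \<bullet> N2 x)"
    unfolding f2 by (simp add: D_inner tn inner_commute)
  have C: "D1 N1 x \<bullet> N2 x = - (D1 N2 x \<bullet> N1 x)"
    using D_inner(1)[OF tn, of x] unfolding z by (simp add: inner_commute)
  have E1: "D1 N1 x \<bullet> \<Phi> x = - f x" "D2 N1 x \<bullet> \<Phi> x = 0"
    using D_inner[OF tsmooth_\<Phi> tn(1), of x] fun_cong[OF z, of x] unfolding z1
    by (simp_all add: N1_def[symmetric] N2_def[symmetric] f1 inner_commute)
  have inV: "D1 N1 x \<in> V" "D2 N1 x \<in> V"
    using D_in_V[OF tn(1)] D_in_V[OF tsmooth_\<Phi> \<Phi>_V] unfolding N1_def by auto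
  \<comment> \<open>In the orthogonal frame \<open>N1\<close>, \<open>N2\<close>,
    \<open>\<Phi>\<close> the inner products of \<open>D1 N1\<close> are half of
    \<open>D1 f\<close>, minus half of \<open>D2 f\<close>, and \<open>- f\<close>. They come from
    differentiating the conformality relations and from \<open>N1\<close> being tangent.\<close>
  have e11: "f x * (D1 N1 x \<bullet> D1 N1 x) = (D1 f x)\<^sup>2 / 4 + (D2 f x)\<^sup>2 / 4 + f x ^ 3"
    using expand_inner[OF inV(1), of x] A(1)[of x] A(2)[of x] C c E1(1)
    unfolding N1_def[symmetric] N2_def[symmetric] by (simp add: power2_eq_square power3_eq_cube)
  have e12: "f x * (D2 N1 x \<bullet> D2 N1 x) = (D1 f x)\<^sup>2 / 4 + (D2 f x)\<^sup>2 / 4"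
    using expand_inner[OF inV(2), of x] A(2)[of x] B c E1(2)
    unfolding N1_def[symmetric] N2_def[symmetric] by (simp add: power2_eq_square)
  have "Lap f x = 2 * (D1 N1 x \<bullet> D1 N1 x + D2 N1 x \<bullet> D2 N1 x) + 2 * (Lap N1 x \<bullet> N1 x)"
  proof -
    have g1: "D1 f = (\<lambda>x. 2 * (D1 N1 x \<bullet> N1 x))" "D2 f = (\<lambda>x. 2 * (D2 N1 x \<bullet> N1 x))" using A by auto
    have t: "tsmooth (\<lambda>x. D1 N1 x \<bullet> N1 x)" "tsmooth (\<lambda>x. D2 N1 x \<bullet> N1 x)" by (intro tsmooth_intros tn)+
    show ?thesis
      unfolding Lap_def g1
      by (simp add: D_mult tsmooth_const t D_inner tn tsmooth_D1 tsmooth_D2 inner_add_left algebra_simps)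
  qed
  moreover have "Lap N1 x \<bullet> N1 x = - 2 * (f x)\<^sup>2"
  proof -
    have "Lap N1 x = - (2 * D1 f x) *\<^sub>R \<Phi> x - (2 * f x) *\<^sub>R N1 x"
      using Jac_D\<Phi>(1)[of x] unfolding Jac_def N1_def by (simp add: algebra_simps)
    moreover have "\<Phi> x \<bullet> N1 x = 0" using fun_cong[OF z1, of x] .
    moreover have "N1 x \<bullet> N1 x = f x" unfolding f1 by (rule refl)
    ultimately show ?thesis by (simp add: inner_diff_left power2_eq_square)
  qed
  ultimately have "Lap f x = 2 * (D1 N1 x \<bullet> D1 N1 x + D2 N1 x \<bullet> D2 N1 x) - 4 * (f x)\<^sup>2" by simp
  then have "f x * Lap f x = f x * (2 * (D1 N1 x \<bullet> D1 N1 x + D2 N1 x \<bullet> D2 N1 x) - 4 * (f x)\<^sup>2)" by (rule arg_cong)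
  also have "\<dots> = 2 * (f x * (D1 N1 x \<bullet> D1 N1 x) + f x * (D2 N1 x \<bullet> D2 N1 x)) - 4 * f x ^ 3"
    by (simp add: algebra_simps power2_eq_square power3_eq_cube)
  finally have "f x * Lap f x = 2 * (f x * (D1 N1 x \<bullet> D1 N1 x) + f x * (D2 N1 x \<bullet> D2 N1 x)) - 4 * f x ^ 3" .
  then show ?thesis unfolding e11 e12 by simp
qed

text \<open>Gauss-Bonnet in divergence form: half the Laplacian of \<open>log f\<close> is the
  divergence of the periodic field with components \<open>a \<bullet> \<Phi>\<close> and
  \<open>b \<bullet> \<Phi>\<close>. Curvature one makes it equal to \<open>- f\<close>, whose
  weighted integral is negative, while the integral of a divergence is zero.\<close>

lemma no_minimal_torus: False
proof -
  obtain a b where a: "\<And>x. D1 f x = 2 * f x * (a \<bullet> \<Phi> x)" and b: "\<And>x. D2 f x = 2 * f x * (b \<bullet> \<Phi> x)"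
    using log_gradient by metis
  note pos = f_pos[OF a b]
  have ta: "tsmooth (\<lambda>x. a \<bullet> \<Phi> x)" "tsmooth (\<lambda>x. b \<bullet> \<Phi> x)" by (intro tsmooth_intros)+
  have Da: "D1 (\<lambda>x. a \<bullet> \<Phi> x) x = a \<bullet> D1 \<Phi> x" "D2 (\<lambda>x. b \<bullet> \<Phi> x) x = b \<bullet> D2 \<Phi> x" for x
    by (simp_all add: D_inner tsmooth_const tsmooth_\<Phi>)
  have Lf: "Lap f x = 4 * f x * ((a \<bullet> \<Phi> x)\<^sup>2 + (b \<bullet> \<Phi> x)\<^sup>2) + 2 * f x * (a \<bullet> D1 \<Phi> x + b \<bullet> D2 \<Phi> x)" for x
  proof -
    have d: "D1 f = (\<lambda>x. 2 * f x * (a \<bullet> \<Phi> x))" "D2 f = (\<lambda>x. 2 * f x * (b \<bullet> \<Phi> x))" using a b by auto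
    have t: "tsmooth (\<lambda>x. 2 * f x)" by (intro tsmooth_intros)
    have "D1 (D1 f) x = 2 * f x * (a \<bullet> D1 \<Phi> x) + (2 * D1 f x) * (a \<bullet> \<Phi> x)"
      by (subst d(1), subst D_mult(1)[OF t ta(1)]) (simp add: D_mult tsmooth_const tsmooth_f Da)
    moreover have "D2 (D2 f) x = 2 * f x * (b \<bullet> D2 \<Phi> x) + (2 * D2 f x) * (b \<bullet> \<Phi> x)"
      by (subst d(2), subst D_mult(2)[OF t ta(2)]) (simp add: D_mult tsmooth_const tsmooth_f Da)
    ultimately show ?thesis unfolding Lap_def a b by (simp add: algebra_simps power2_eq_square)
  qed
  \<comment> \<open>Inserting the gradient of \<open>f\<close> into the curvature identity cancels
    the squares and leaves a multiple of the square of \<open>f\<close>, which may now be divided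
    out.\<close>
  have key: "a \<bullet> D1 \<Phi> x + b \<bullet> D2 \<Phi> x = - f x" for x
  proof -
    have "2 * (f x)\<^sup>2 * (a \<bullet> D1 \<Phi> x + b \<bullet> D2 \<Phi> x) = 2 * (f x)\<^sup>2 * (- f x)"
      using bochner[of x] unfolding Lf a b by (simp add: algebra_simps power2_eq_square power3_eq_cube)
    then show ?thesis using pos[of x] unfolding mult_cancel_left by auto
  qed
  have "0 = integral usquare (\<lambda>x. Kd x * D1 (\<lambda>x. a \<bullet> \<Phi> x) x) + integral usquare (\<lambda>x. Kd x * D2 (\<lambda>x. b \<bullet> \<Phi> x) x)"
    by (simp add: integral_D ta)
  also have "\<dots> = integral usquare (\<lambda>x. Kd x * D1 (\<lambda>x. a \<bullet> \<Phi> x) x + Kd x * D2 (\<lambda>x. b \<bullet> \<Phi> x) x)"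
    by (rule Henstock_Kurzweil_Integration.integral_add[symmetric]) (intro integrable_usquare tsmooth_intros)+
  also have "(\<lambda>x. Kd x * D1 (\<lambda>x. a \<bullet> \<Phi> x) x + Kd x * D2 (\<lambda>x. b \<bullet> \<Phi> x) x) = (\<lambda>x. - (f x * Kd x))"
    unfolding Da distrib_left[symmetric] key by (auto simp: mult.commute)
  finally show False using integral_fK_pos by simp
qed

end

theorem proposition3p8:
  fixes n :: nat
    and g0 :: "real^2 \<Rightarrow> real^2^2"
    and \<Phi> :: "real^2 \<Rightarrow> real^'m"
  assumes "CARD('m) = n + 1"
    and "riemannian_metric g0"
    and "branched_minimal_immersion g0 \<Phi>"
    and "\<not> \<Phi> constant_on UNIV"
    and "by_first_eigenfunctions g0 \<Phi>"
  shows "\<not> equatorial_2_sphere (range \<Phi>)"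
proof
  assume "equatorial_2_sphere (range \<Phi>)"
  then obtain V where V: "subspace V" "dim V = 3" "range \<Phi> = sphere 0 1 \<inter> V"
    unfolding equatorial_2_sphere_def by blast
  obtain \<sigma> \<alpha>1 \<alpha>2 \<beta>1 \<beta>2 where fr: "torus_frame \<alpha>1 \<alpha>2 \<beta>1 \<beta>2" and iso: "isothermal g0 \<sigma> \<alpha>1 \<alpha>2 \<beta>1 \<beta>2"
    using isothermal_exists[OF assms(2)] by metis
  interpret torus_frame \<alpha>1 \<alpha>2 \<beta>1 \<beta>2 by (rule fr)
  interpret minimal_torus_in_sphere \<alpha>1 \<alpha>2 \<beta>1 \<beta>2 g0 \<sigma> \<Phi> V
    by unfold_locales (use assms iso V in auto)
  show False by (rule no_minimal_torus)
qed

end
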